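(* For any plane graph $G$ (and any choice of $\mathrm{alt}_{\mathrm i}(G)$), $$T(G;x,x)=T_i(\mathrm{alt}_{\mathrm i}(G);x),$$ where $T(G;x,y)$ is the Tutte polynomial of $G$.
   Context: An \emph{alternating dimap} is a finite directed graph (loops and multiple edges allowed) without isolated vertices, 2-cell-embedded in a disjoint union of oriented surfaces, one for each component, such that around each vertex the incident edges are directed alternately into and out of the vertex. The empty alternating dimap is allowed. All edges around a face go in the same direction; a face is a \emph{c-face} (clockwise) or \emph{a-face} (anticlockwise) accordingly. Each edge $e$ lies in exactly one c-face $C(e)$, one a-face $A(e)$, and one in-star $I(e)$ (the set of edges with the same head as $e$). The \emph{left successor} (resp. \emph{right successor}) of $e$ is the next edge after $e$ going around $A(e)$ (resp. $C(e)$) in the direction of $e$. Let $\omega=\exp(2\pi i/3)$. The permutations $\sigma_1,\sigma_\omega,\sigma_{\omega^2}$ of $E(G)$ send $e$ to the next edge in clockwise order around $I(e)$, $A(e)$, $C(e)$ respectively. They satisfy $\sigma_1\sigma_\omega\sigma_{\omega^2}=\mathrm{id}$ (rightmost applied first), and alternating dimaps correspond bijectively to such triples. \emph{Minor operations.} Let $e$ be an edge from $u$ to $v$. $H[\omega]e$: delete $e$ and, if the left successor $g$ of $e$ is not $e$, change the tail of $g$ from $v$ to $u$ so that $g$ takes the place of $e,g$ in $A(e)$. $H[\omega^2]e$: the same with the right successor and $C(e)$. A vertex left without edges disappears. Equivalently, with $\pi\setminus e$ the permutation obtained from $\pi$ by removing $e$ from its cycle: in $H[\omega]e$, $\sigma_1,\sigma_\omega$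 become $\sigma_1\setminus e,\sigma_\omega\setminus e$; in $H[\omega^2]e$, $\sigma_1,\sigma_{\omega^2}$ become $\sigma_1\setminus e,\sigma_{\omega^2}\setminus e$; the third permutation is determined by the product identity. \emph{Loops and semiloops.} A 1-loop is an edge whose head has degree 2; an $\omega$-loop (resp. $\omega^2$-loop) is an edge forming a single-edge a-face (resp. c-face). A triloop is a $\mu$-loop for some $\mu\in\{1,\omega,\omega^2\}$; for a triloop the reductions coincide and are written $H[*]e$. An ultraloop is a triloop that with its vertex constitutes a component (it is simultaneously a 1-loop, an $\omega$-loop and an $\omega^2$-loop). A 1-semiloop is a loop in the usual graph sense. An $\omega$-semiloop (resp. $\omega^2$-semiloop) is an edge $e$ such that, with $f$ its right successor (resp. left successor), either $f=e$ or $k(H\setminus\{e,f\})-\gamma(H\setminus\{e,f\})>k(H)-\gamma(H)$, where the deletion is in the underlying undirected embedded graph, $k$ is the number of components, and the genus $\gamma$ is given by $|V|-|E|+|F|=2(k-\gamma)$. A semiloop is a $\mu$-semiloop for some $\mu$; it is proper if it is not a triloop. \emph{The functions.} The Tutte polynomial: $T(G;x,y)=1$ if $E(G)=\emptyset$; otherwise, for any $e\in E(G)$, it is $x\,T(G\setminus e;x,y)$ if $e$ is a coloop, $y\,T(G/e;x,y)$ if $e$ is a loop, and $T(G/e;x,y)+T(G\setminus e;x,y)$ otherwise. For an embedded graph $G$, $\mathrm{alt}_{\mathrm i}(G)$ is any alternating dimap obtained from the medial graph $\mathrm{med}(G)$ of $G$ (an embedded 4-regular graph whose vertices represent the edges of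 $G$) by directing its edges so that the alternating property holds; there are two ways of doing so for each component. $T_i(H;x)$ denotes any invariant of alternating dimaps that satisfies the following: it is 1 if $H$ is empty; otherwise, for an edge $e$ of $H$, $T_i(H;x)$ equals $T_i(H[*]e;x)$ if $e$ is a 1-loop (including an ultraloop); $x\,T_i(H[\omega^2]e;x)$ if $e$ is a proper $\omega$-semiloop or a (proper) $\omega^2$-loop; $x\,T_i(H[\omega]e;x)$ if $e$ is a proper $\omega^2$-semiloop or a (proper) $\omega$-loop; $T_i(H[\omega]e;x)+T_i(H[\omega^2]e;x)$ if $e$ is not a semiloop. Nothing is specified when $e$ is a proper 1-semiloop (this does not arise in evaluating $T_i(\mathrm{alt}_{\mathrm i}(G);x)$ for plane $G$). The value $T_i(\mathrm{alt}_{\mathrm i}(G);x)$ is the one obtained by applying these rules recursively, with any choice of edge at each stage. A plane graph is a graph embedded with genus 0 (each component in its own sphere when disconnected). *)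

theory Defs
  imports Complex_Main "HOL-Combinatorics.Combinatorics"
begin

section \<open>Graphs and the Tutte polynomial\<close>

text \<open>Undirected multigraphs. \<open>ends G e\<close> is the set of endpoints of the edge \<open>e\<close>:
  a singleton for a loop, a two-element set otherwise.\<close>

record ('v, 'e) ugraph =
  verts :: "'v set"
  edges :: "'e set"
  ends :: "'e \<Rightarrow> 'v set"

definition adjacency :: "('v, 'e) ugraph \<Rightarrow> ('v \<times> 'v) set" where
  "adjacency G = {(u, v). \<exists>e\<in>edges G. u \<in> ends G e \<and> v \<in> ends G e}"

definition num_components :: "('v, 'e) ugraph \<Rightarrow> nat" where
  "num_components G = card (verts G // ((adjacency G)\<^sup>* \<inter> verts G \<times> verts G))"

definition delete_edge :: "('v, 'e) ugraph \<Rightarrow> 'e \<Rightarrow> ('v, 'e) ugraph" where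
  "delete_edge G e = G\<lparr>edges := edges G - {e}\<rparr>"

definition collapse :: "('v, 'e) ugraph \<Rightarrow> 'e \<Rightarrow> 'v \<Rightarrow> 'v" where
  "collapse G e v = (if v \<in> ends G e then SOME w. w \<in> ends G e else v)"

definition contract_edge :: "('v, 'e) ugraph \<Rightarrow> 'e \<Rightarrow> ('v, 'e) ugraph" where
  "contract_edge G e =
     \<lparr>verts = collapse G e ` verts G, edges = edges G - {e},
      ends = (\<lambda>f. collapse G e ` ends G f)\<rparr>"

definition is_loop :: "('v, 'e) ugraph \<Rightarrow> 'e \<Rightarrow> bool" where
  "is_loop G e \<longleftrightarrow> card (ends G e) = 1"

definition is_coloop :: "('v, 'e) ugraph \<Rightarrow> 'e \<Rightarrow> bool" where
  "is_coloop G e \<longleftrightarrow> num_components (delete_edge G e) > num_components G"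

text \<open>\<open>tutte_value x y G t\<close>: some run of the deletion-contraction recursion, with an arbitrary
  edge chosen at each stage, evaluates \<open>T(G;x,y)\<close> to \<open>t\<close>. The Tutte polynomial is the
  value common to all runs. The arguments \<open>x\<close> and \<open>y\<close> range over an arbitrary commutative
  ring, so they may be taken to be indeterminates.\<close>

inductive tutte_value ::
    "'r::comm_ring_1 \<Rightarrow> 'r \<Rightarrow> ('v, 'e) ugraph \<Rightarrow> 'r \<Rightarrow> bool" for x y where
  tutte_empty: "edges G = {} \<Longrightarrow> tutte_value x y G 1"
| tutte_coloop: "e \<in> edges G \<Longrightarrow> is_coloop G e \<Longrightarrow> tutte_value x y (delete_edge G e) t
    \<Longrightarrow> tutte_value x y G (x * t)"
| tutte_loop: "e \<in> edges G \<Longrightarrow> is_loop G e \<Longrightarrow> tutte_value x y (contract_edge G e) t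
    \<Longrightarrow> tutte_value x y G (y * t)"
| tutte_ordinary: "e \<in> edges G \<Longrightarrow> \<not> is_coloop G e \<Longrightarrow> \<not> is_loop G e
    \<Longrightarrow> tutte_value x y (contract_edge G e) s \<Longrightarrow> tutte_value x y (delete_edge G e) t
    \<Longrightarrow> tutte_value x y G (s + t)"

definition tutte :: "('v, 'e) ugraph \<Rightarrow> 'r::comm_ring_1 \<Rightarrow> 'r \<Rightarrow> 'r" where
  "tutte G x y = (THE t. tutte_value x y G t)"


section \<open>Embedded graphs\<close>

definition perm_delete :: "'a \<Rightarrow> ('a \<Rightarrow> 'a) \<Rightarrow> 'a \<Rightarrow> 'a" where
  "perm_delete e p = (\<lambda>a. if a = e then e else if p a = e then p e else p a)"

text \<open>A graph 2-cell-embedded in a disjoint union of oriented surfaces, one for each component,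
  as a rotation system. A dart is an end (half) of an edge; \<open>partner\<close> is the other half,
  \<open>org\<close> the vertex at which the dart sits, and \<open>rot\<close> the next dart clockwise around that
  vertex. Vertices that are the origin of no dart are isolated vertices.\<close>

record ('v, 'd) embedding =
  everts :: "'v set"
  darts :: "'d set"
  partner :: "'d \<Rightarrow> 'd"
  rot :: "'d \<Rightarrow> 'd"
  org :: "'d \<Rightarrow> 'v"

definition embedded_graph :: "('v, 'd) embedding \<Rightarrow> bool" where
  "embedded_graph M \<longleftrightarrow>
     finite (everts M) \<and> finite (darts M) \<and>
     partner M permutes darts M \<and> rot M permutes darts M \<and>
     (\<forall>d\<in>darts M. partner M d \<noteq> d \<and> partner M (partner M d) = d) \<and>
     org M ` darts M \<subseteq> everts M \<and>
     (\<forall>d\<in>darts M. \<forall>d'\<in>darts M. org M d = org M d' \<longleftrightarrow> d' \<in> orbit (rot M) d)"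

definition edge_of :: "('v, 'd) embedding \<Rightarrow> 'd \<Rightarrow> 'd set" where
  "edge_of M d = {d, partner M d}"

definition graph_of :: "('v, 'd) embedding \<Rightarrow> ('v, 'd set) ugraph" where
  "graph_of M = \<lparr>verts = everts M, edges = edge_of M ` darts M, ends = (\<lambda>e. org M ` e)\<rparr>"

text \<open>An isolated vertex is embedded in its own sphere, and so contributes one face.\<close>

definition num_faces :: "('v, 'd) embedding \<Rightarrow> nat" where
  "num_faces M =
     card (orbit (rot M \<circ> partner M) ` darts M) + card (everts M - org M ` darts M)"

text \<open>The genus, as the solution \<open>g\<close> of \<open>|V| - |E| + |F| = 2(k - g)\<close>.\<close>

definition genus :: "('v, 'd) embedding \<Rightarrow> real" where
  "genus M = real (num_components (graph_of M))
     - (real (card (everts M)) - real (card (edges (graph_of M))) + real (num_faces M)) / 2"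

definition plane_graph :: "('v, 'd) embedding \<Rightarrow> bool" where
  "plane_graph M \<longleftrightarrow> embedded_graph M \<and> genus M = 0"

definition delete_embedded_edge :: "('v, 'd) embedding \<Rightarrow> 'd \<Rightarrow> ('v, 'd) embedding" where
  "delete_embedded_edge M d = M\<lparr>
     darts := darts M - edge_of M d,
     partner := perm_restrict (partner M) (darts M - edge_of M d),
     rot := perm_delete d (perm_delete (partner M d) (rot M))\<rparr>"

text \<open>Isomorphism of embedded graphs, preserving the orientation of the surfaces.\<close>

definition embedding_iso :: "('v, 'd) embedding \<Rightarrow> ('w, 'c) embedding \<Rightarrow> bool" where
  "embedding_iso M N \<longleftrightarrow> (\<exists>\<phi> \<psi>.
     bij_betw \<phi> (everts M) (everts N) \<and> bij_betw \<psi> (darts M) (darts N) \<and>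
     (\<forall>d\<in>darts M. \<psi> (partner M d) = partner N (\<psi> d) \<and> \<psi> (rot M d) = rot N (\<psi> d) \<and>
        org N (\<psi> d) = \<phi> (org M d)))"

text \<open>The medial graph has the edges of \<open>G\<close> as vertices and one edge for each corner of \<open>G\<close>.
  The corner between \<open>c\<close> and the next dart \<open>rot G c\<close> is named by \<open>c\<close>; the two ends of
  the corresponding medial edge are \<open>(c, False)\<close>, at the edge of \<open>c\<close>, and \<open>(c, True)\<close>, at the
  edge of \<open>rot G c\<close>. With \<open>p\<close> the other end of the edge containing \<open>d\<close>, the medial darts
  around that edge are, in clockwise order,
  \<open>(d, False)\<close>, \<open>(inv (rot G) d, True)\<close>, \<open>(p, False)\<close>, \<open>(inv (rot G) p, True)\<close>.\<close>

definition medial :: "('v, 'd) embedding \<Rightarrow> ('d set, 'd \<times> bool) embedding" where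
  "medial G = \<lparr>
     everts = edge_of G ` darts G,
     darts = darts G \<times> UNIV,
     partner = perm_restrict (\<lambda>(c, b). (c, \<not> b)) (darts G \<times> UNIV),
     rot = perm_restrict
       (\<lambda>(c, b). if b then (partner G (rot G c), False) else (inv (rot G) c, True))
       (darts G \<times> UNIV),
     org = (\<lambda>(c, b). edge_of G (if b then rot G c else c))\<rparr>"


section \<open>Alternating dimaps\<close>

text \<open>An alternating dimap, given by its edges and the permutations
  \<open>\<sigma>\<^sub>1\<close>, \<open>\<sigma>\<^sub>\<omega>\<close>, \<open>\<sigma>\<^sub>\<omega>\<^sub>2\<close> that send an edge to the next one clockwise
  around its in-star, a-face and c-face.\<close>

record 'e dimap =
  arcs :: "'e set"
  sig1 :: "'e \<Rightarrow> 'e"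
  sigw :: "'e \<Rightarrow> 'e"
  sigw2 :: "'e \<Rightarrow> 'e"

definition alt_dimap :: "'e dimap \<Rightarrow> bool" where
  "alt_dimap H \<longleftrightarrow> finite (arcs H) \<and>
     sig1 H permutes arcs H \<and> sigw H permutes arcs H \<and> sigw2 H permutes arcs H \<and>
     sig1 H \<circ> sigw H \<circ> sigw2 H = id"

definition dimap_iso :: "'e dimap \<Rightarrow> 'f dimap \<Rightarrow> bool" where
  "dimap_iso H K \<longleftrightarrow> (\<exists>\<phi>. bij_betw \<phi> (arcs H) (arcs K) \<and>
     (\<forall>e\<in>arcs H. \<phi> (sig1 H e) = sig1 K (\<phi> e) \<and> \<phi> (sigw H e) = sigw K (\<phi> e) \<and>
        \<phi> (sigw2 H e) = sigw2 K (\<phi> e)))"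

definition in_star :: "'e dimap \<Rightarrow> 'e \<Rightarrow> 'e set" where
  "in_star H e = orbit (sig1 H) e"

definition a_face :: "'e dimap \<Rightarrow> 'e \<Rightarrow> 'e set" where
  "a_face H e = orbit (sigw H) e"

definition c_face :: "'e dimap \<Rightarrow> 'e \<Rightarrow> 'e set" where
  "c_face H e = orbit (sigw2 H) e"

text \<open>The edges of an a-face run anticlockwise around it, and those of a c-face clockwise.\<close>

definition left_succ :: "'e dimap \<Rightarrow> 'e \<Rightarrow> 'e" where
  "left_succ H e = inv (sigw H) e"

definition right_succ :: "'e dimap \<Rightarrow> 'e \<Rightarrow> 'e" where
  "right_succ H e = sigw2 H e"

text \<open>A vertex is identified with the in-star of edges directed into it. Since \<open>e\<close> is the left
  successor of \<open>sigw H e\<close>, the tail of \<open>e\<close> is the head of \<open>sigw H e\<close>.\<close>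

definition head :: "'e dimap \<Rightarrow> 'e \<Rightarrow> 'e set" where
  "head H e = in_star H e"

definition tail :: "'e dimap \<Rightarrow> 'e \<Rightarrow> 'e set" where
  "tail H e = head H (sigw H e)"

definition vertex_degree :: "'e dimap \<Rightarrow> 'e set \<Rightarrow> nat" where
  "vertex_degree H v = card {f \<in> arcs H. head H f = v} + card {f \<in> arcs H. tail H f = v}"

text \<open>The underlying undirected embedded graph: \<open>(e, True)\<close> is the half of \<open>e\<close> at its head and
  \<open>(e, False)\<close> the half at its tail. Clockwise around a vertex, an incoming edge is followed by
  its left successor, and an outgoing edge by the edge whose right successor it is.\<close>

definition underlying :: "'e dimap \<Rightarrow> ('e set, 'e \<times> bool) embedding" where
  "underlying H = \<lparr>
     everts = head H ` arcs H,
     darts = arcs H \<times> UNIV,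
     partner = perm_restrict (\<lambda>(e, b). (e, \<not> b)) (arcs H \<times> UNIV),
     rot = perm_restrict
       (\<lambda>(e, b). if b then (left_succ H e, False) else (inv (right_succ H) e, True))
       (arcs H \<times> UNIV),
     org = (\<lambda>(e, b). if b then head H e else tail H e)\<rparr>"

definition is_alt_i :: "('v, 'd) embedding \<Rightarrow> 'e dimap \<Rightarrow> bool" where
  "is_alt_i G H \<longleftrightarrow> alt_dimap H \<and> embedding_iso (underlying H) (medial G)"

text \<open>The reductions \<open>H[\<omega>]e\<close> and \<open>H[\<omega>\<^sup>2]e\<close>. The third permutation is determined by
  \<open>sig1 H \<circ> sigw H \<circ> sigw2 H = id\<close>.\<close>

definition reduce_w :: "'e dimap \<Rightarrow> 'e \<Rightarrow> 'e dimap" where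
  "reduce_w H e =
     (let s1 = perm_delete e (sig1 H); sw = perm_delete e (sigw H)
      in \<lparr>arcs = arcs H - {e}, sig1 = s1, sigw = sw, sigw2 = inv (s1 \<circ> sw)\<rparr>)"

definition reduce_w2 :: "'e dimap \<Rightarrow> 'e \<Rightarrow> 'e dimap" where
  "reduce_w2 H e =
     (let s1 = perm_delete e (sig1 H); sw2 = perm_delete e (sigw2 H)
      in \<lparr>arcs = arcs H - {e}, sig1 = s1, sigw = inv s1 \<circ> inv sw2, sigw2 = sw2\<rparr>)"

text \<open>\<open>H[*]e\<close>, used only for triloops, for which the reductions coincide.\<close>

definition reduce_triloop :: "'e dimap \<Rightarrow> 'e \<Rightarrow> 'e dimap" where
  "reduce_triloop H e = reduce_w H e"

definition loop_1 :: "'e dimap \<Rightarrow> 'e \<Rightarrow> bool" where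
  "loop_1 H e \<longleftrightarrow> vertex_degree H (head H e) = 2"

definition loop_w :: "'e dimap \<Rightarrow> 'e \<Rightarrow> bool" where
  "loop_w H e \<longleftrightarrow> a_face H e = {e}"

definition loop_w2 :: "'e dimap \<Rightarrow> 'e \<Rightarrow> bool" where
  "loop_w2 H e \<longleftrightarrow> c_face H e = {e}"

definition triloop :: "'e dimap \<Rightarrow> 'e \<Rightarrow> bool" where
  "triloop H e \<longleftrightarrow> loop_1 H e \<or> loop_w H e \<or> loop_w2 H e"

definition ultraloop :: "'e dimap \<Rightarrow> 'e \<Rightarrow> bool" where
  "ultraloop H e \<longleftrightarrow> triloop H e \<and> head H e = tail H e \<and>
     (\<forall>f\<in>arcs H. head H e \<in> {head H f, tail H f} \<longrightarrow> f = e)"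

definition components_minus_genus :: "('v, 'd) embedding \<Rightarrow> real" where
  "components_minus_genus M = real (num_components (graph_of M)) - genus M"

definition deletion_splits :: "'e dimap \<Rightarrow> 'e \<Rightarrow> 'e \<Rightarrow> bool" where
  "deletion_splits H e f \<longleftrightarrow>
     components_minus_genus
       (delete_embedded_edge (delete_embedded_edge (underlying H) (e, True)) (f, True))
     > components_minus_genus (underlying H)"

definition semiloop_1 :: "'e dimap \<Rightarrow> 'e \<Rightarrow> bool" where
  "semiloop_1 H e \<longleftrightarrow> head H e = tail H e"

definition semiloop_w :: "'e dimap \<Rightarrow> 'e \<Rightarrow> bool" where
  "semiloop_w H e \<longleftrightarrow> right_succ H e = e \<or> deletion_splits H e (right_succ H e)"

definition semiloop_w2 :: "'e dimap \<Rightarrow> 'e \<Rightarrow> bool" where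
  "semiloop_w2 H e \<longleftrightarrow> left_succ H e = e \<or> deletion_splits H e (left_succ H e)"

definition semiloop :: "'e dimap \<Rightarrow> 'e \<Rightarrow> bool" where
  "semiloop H e \<longleftrightarrow> semiloop_1 H e \<or> semiloop_w H e \<or> semiloop_w2 H e"

definition proper_semiloop_1 :: "'e dimap \<Rightarrow> 'e \<Rightarrow> bool" where
  "proper_semiloop_1 H e \<longleftrightarrow> semiloop_1 H e \<and> \<not> triloop H e"

definition proper_semiloop_w :: "'e dimap \<Rightarrow> 'e \<Rightarrow> bool" where
  "proper_semiloop_w H e \<longleftrightarrow> semiloop_w H e \<and> \<not> triloop H e"

definition proper_semiloop_w2 :: "'e dimap \<Rightarrow> 'e \<Rightarrow> bool" where
  "proper_semiloop_w2 H e \<longleftrightarrow> semiloop_w2 H e \<and> \<not> triloop H e"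


section \<open>The invariants $T_i$\<close>

text \<open>The situations in which the value at \<open>H\<close> is \<open>x\<close> times the value at \<open>H[\<omega>\<^sup>2]e\<close>,
  respectively at \<open>H[\<omega>]e\<close>. Nothing is specified for a proper 1-semiloop, even if it is at
  the same time a proper semiloop of another kind.\<close>

definition uses_reduce_w2 :: "'e dimap \<Rightarrow> 'e \<Rightarrow> bool" where
  "uses_reduce_w2 H e \<longleftrightarrow>
     proper_semiloop_w H e \<and> \<not> proper_semiloop_1 H e \<or> loop_w2 H e \<and> \<not> ultraloop H e"

definition uses_reduce_w :: "'e dimap \<Rightarrow> 'e \<Rightarrow> bool" where
  "uses_reduce_w H e \<longleftrightarrow>
     proper_semiloop_w2 H e \<and> \<not> proper_semiloop_1 H e \<or> loop_w H e \<and> \<not> ultraloop H e"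

definition Ti_invariant :: "'r::comm_ring_1 \<Rightarrow> ('e dimap \<Rightarrow> 'r) \<Rightarrow> bool" where
  "Ti_invariant x T \<longleftrightarrow>
     (\<forall>H K. alt_dimap H \<and> alt_dimap K \<and> dimap_iso H K \<longrightarrow> T H = T K) \<and>
     (\<forall>H. alt_dimap H \<and> arcs H = {} \<longrightarrow> T H = 1) \<and>
     (\<forall>H. alt_dimap H \<longrightarrow> (\<forall>e\<in>arcs H.
        (loop_1 H e \<longrightarrow> T H = T (reduce_triloop H e)) \<and>
        (uses_reduce_w2 H e \<longrightarrow> T H = x * T (reduce_w2 H e)) \<and>
        (uses_reduce_w H e \<longrightarrow> T H = x * T (reduce_w H e)) \<and>
        (\<not> semiloop H e \<longrightarrow> T H = T (reduce_w H e) + T (reduce_w2 H e))))"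

text \<open>\<open>Ti_value x H t\<close>: some recursive application of these rules, with an arbitrary edge
  chosen at each stage, evaluates \<open>T\<^sub>i(H;x)\<close> to \<open>t\<close>.\<close>

inductive Ti_value :: "'r::comm_ring_1 \<Rightarrow> 'e dimap \<Rightarrow> 'r \<Rightarrow> bool" for x where
  Ti_empty: "arcs H = {} \<Longrightarrow> Ti_value x H 1"
| Ti_loop_1: "e \<in> arcs H \<Longrightarrow> loop_1 H e \<Longrightarrow> Ti_value x (reduce_triloop H e) t
    \<Longrightarrow> Ti_value x H t"
| Ti_w2: "e \<in> arcs H \<Longrightarrow> uses_reduce_w2 H e \<Longrightarrow> Ti_value x (reduce_w2 H e) t
    \<Longrightarrow> Ti_value x H (x * t)"
| Ti_w: "e \<in> arcs H \<Longrightarrow> uses_reduce_w H e \<Longrightarrow> Ti_value x (reduce_w H e) t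
    \<Longrightarrow> Ti_value x H (x * t)"
| Ti_ordinary: "e \<in> arcs H \<Longrightarrow> \<not> semiloop H e
    \<Longrightarrow> Ti_value x (reduce_w H e) s \<Longrightarrow> Ti_value x (reduce_w2 H e) t
    \<Longrightarrow> Ti_value x H (s + t)"

end

theory Submission
  imports Defs
begin

text \<open>
  Both sides are one and the same state sum. In the rank generating sum of a plane graph, the term
  of an edge set \<open>A\<close> becomes \<open>(x - 1) ^ (c(A) - k)\<close> at \<open>y = x\<close>, where \<open>c(A)\<close> is the number of
  boundary circles of the ribbon subgraph with edges \<open>A\<close> and \<open>k\<close> the number of components. On the
  side of the dimap, where the in-degrees never exceed 2, the permutation \<open>sig1\<close> is an involution,
  and \<open>c\<close> counts the closed curves obtained by letting every edge continue to its left or to its right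
  successor, consistently at each vertex. Fixing this choice at the head of \<open>e\<close> and removing \<open>e\<close> from
  its curve gives the curves of \<open>H[\<omega>]e\<close> and \<open>H[\<omega>\<^sup>2]e\<close>, so the sum satisfies the rules once the
  change of \<open>k\<close> is known. The genus cancels in \<open>k - \<gamma>\<close>, so being a semiloop is a condition on
  faces only, and planarity makes it equivalent to a reduction disconnecting the dimap.
\<close>

section \<open>Counting classes and cycles\<close>

text \<open>The exponent c(A) - k comes from Euler's formula: every ribbon subgraph of a plane graph
  has genus 0, so c(A) = 2 k(A) + |A| - |V|, and c(A) - k is the sum of the exponents k(A) - k and
  |A| + k(A) - |V| of the rank generating sum, which merge at y = x. Two obstacles shape the rest.
  Each component of the medial graph can be directed in two ways: in one, the a-faces of the dimap
  are the faces of the graph; in the other, they are its vertices with the rotation reversed. So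
  graph and dimap are related by duality on some components and by reflection on the others;
  complementing A on the former and reversing the curves on the latter preserves the sum. Moreover,
  a reduction removes one arc, not both arcs into a vertex, and so leaves the class of dimaps of
  medial graphs. This is why half-edge maps whose involution may have fixed points serve both sides,
  and why planarity is turned into a condition on states, derived once from Euler's formula and then
  inherited.\<close>

definition gr :: "('a \<Rightarrow> 'a) \<Rightarrow> ('a \<times> 'a) set" where
  "gr p = range (\<lambda>a. (a, p a))"

definition linked :: "('a \<times> 'a) set \<Rightarrow> 'a \<Rightarrow> 'a \<Rightarrow> bool" where
  "linked r a b \<longleftrightarrow> (a, b) \<in> (r \<union> r\<inverse>)\<^sup>*"

text \<open>Permutations enter through \<open>gr\<close>, so that cycles of a permutation, pieces of
  a map and components of a graph are counted alike. All classes meeting \<open>S\<close> count,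
  wherever else they extend; thus \<open>S\<close> can be shrunk while the relation is kept.\<close>

definition ncls :: "'a set \<Rightarrow> ('a \<times> 'a) set \<Rightarrow> nat" where
  "ncls S r = card ((\<lambda>a. {b. linked r a b}) ` S)"

lemma linked_refl [simp]: "linked r a a"
  by (simp add: linked_def)

lemma linked_trans: "linked r a b \<Longrightarrow> linked r b c \<Longrightarrow> linked r a c"
  unfolding linked_def by (rule rtrancl_trans)

lemma linked_sym: "linked r a b \<Longrightarrow> linked r b a"
  unfolding linked_def
  by (rule symD[OF sym_rtrancl]) (auto simp: sym_def)

lemma linked_base: "(a, b) \<in> r \<Longrightarrow> linked r a b"
  unfolding linked_def by auto

lemma linked_gr: "linked (gr p) a (p a)"
  by (rule linked_base) (simp add: gr_def)

lemma linked_gr_Un: "linked (gr p \<union> r) a (p a)"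
  by (rule linked_base) (simp add: gr_def)

lemma linked_gr_Un2: "linked (r \<union> gr p) a (p a)"
  by (rule linked_base) (simp add: gr_def)

lemma linked_image:
  assumes "linked r a b"
    and "\<And>u v. (u, v) \<in> r \<Longrightarrow> linked r' (h u) (h v)"
  shows "linked r' (h a) (h b)"
  using assms(1) unfolding linked_def[of r]
proof (induction rule: rtrancl_induct)
  case (step y z)
  then show ?case
    by (auto intro: linked_trans linked_sym dest: assms(2))
qed simp

lemma linked_mono:
  assumes "linked r a b" and "\<And>u v. (u, v) \<in> r \<Longrightarrow> linked r' u v"
  shows "linked r' a b"
  using linked_image[of r a b r' "\<lambda>x. x"] assms by blast

lemma linked_closed:
  assumes "linked r a b" and "a \<in> X" and "\<And>u v. (u, v) \<in> r \<Longrightarrow> u \<in> X \<longleftrightarrow> v \<in> X"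
  shows "b \<in> X"
  using assms(1) unfolding linked_def
  by (induction rule: rtrancl_induct) (use assms(2,3) in auto)

lemma cls_eq_iff: "{c. linked r a c} = {c. linked r b c} \<longleftrightarrow> linked r a b"
  by (auto intro: linked_trans linked_sym)

lemma card_image_cong_kernel:
  assumes "\<And>a b. a \<in> S \<Longrightarrow> b \<in> S \<Longrightarrow> g a = g b \<longleftrightarrow> h (f a) = h (f b)"
  shows "card (g ` S) = card (h ` f ` S)"
proof -
  have "bij_betw (\<lambda>c. h (f (inv_into S g c))) (g ` S) (h ` f ` S)"
    unfolding bij_betw_def
  proof
    show "inj_on (\<lambda>c. h (f (inv_into S g c))) (g ` S)"
      by (rule inj_onI) (metis assms f_inv_into_f inv_into_into)
    have "h (f (inv_into S g (g a))) = h (f a)" if "a \<in> S" for a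
      using that assms[of "inv_into S g (g a)" a] by (simp add: inv_into_into f_inv_into_f)
    then show "(\<lambda>c. h (f (inv_into S g c))) ` g ` S = h ` f ` S"
      by (auto simp: image_image)
  qed
  then show ?thesis by (rule bij_betw_same_card)
qed

lemma card_image_le_kernel:
  assumes "finite S" and "\<And>a b. a \<in> S \<Longrightarrow> b \<in> S \<Longrightarrow> g a = g b \<Longrightarrow> h a = h b"
  shows "card (h ` S) \<le> card (g ` S)"
proof -
  have "h a = h (inv_into S g (g a))" if "a \<in> S" for a
    using that assms(2)[of a "inv_into S g (g a)"] by (simp add: inv_into_into f_inv_into_f)
  then have "h ` S \<subseteq> (\<lambda>c. h (inv_into S g c)) ` g ` S"
    by auto
  then show ?thesis
    using assms(1) by (meson card_image_le card_mono finite_imageI le_trans)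
qed

lemma ncls_image:
  assumes "\<And>a b. a \<in> S \<Longrightarrow> b \<in> S \<Longrightarrow> linked r a b \<longleftrightarrow> linked r' (f a) (f b)"
  shows "ncls S r = ncls (f ` S) r'"
  unfolding ncls_def by (rule card_image_cong_kernel) (simp add: cls_eq_iff assms)

lemma ncls_cong:
  assumes "\<And>a b. a \<in> S \<Longrightarrow> b \<in> S \<Longrightarrow> linked r a b \<longleftrightarrow> linked r' a b"
  shows "ncls S r = ncls S r'"
  using ncls_image[of S r r' "\<lambda>x. x"] assms by simp

lemma ncls_antimono:
  assumes "finite S" and "\<And>u v. (u, v) \<in> r \<Longrightarrow> linked r' u v"
  shows "ncls S r' \<le> ncls S r"
  unfolding ncls_def
  by (rule card_image_le_kernel[OF assms(1)])
     (use assms(2) in \<open>auto simp only: cls_eq_iff intro: linked_mono\<close>)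

lemma ncls_eqI:
  assumes "\<And>u v. (u, v) \<in> r \<Longrightarrow> linked r' u v" and "\<And>u v. (u, v) \<in> r' \<Longrightarrow> linked r u v"
  shows "ncls S r = ncls S r'"
  by (rule ncls_cong) (use assms in \<open>auto intro: linked_mono\<close>)

lemma ncls_insert_linked: "linked r a b \<Longrightarrow> ncls S (insert (a, b) r) = ncls S r"
  by (rule ncls_eqI) (auto intro: linked_base)

lemma linked_insert:
  "linked (insert (a, b) r) u v \<longleftrightarrow>
     linked r u v \<or> linked r u a \<and> linked r b v \<or> linked r u b \<and> linked r a v"
  (is "?l \<longleftrightarrow> ?r")
proof
  have m: "linked (insert (a, b) r) c d" if "linked r c d" for c d
    using that by (rule linked_mono) (auto intro: linked_base)
  have "linked (insert (a, b) r) a b" by (rule linked_base) simp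
  then show "?r \<Longrightarrow> ?l"
    using m linked_sym linked_trans by metis
  assume ?l
  then show ?r unfolding linked_def[of "insert (a, b) r"]
  proof (induction rule: rtrancl_induct)
    case (step y z)
    then consider "linked r y z" | "y = a" "z = b" | "y = b" "z = a"
      by (auto intro: linked_base linked_sym)
    then show ?case
      using step.IH by cases (metis linked_trans linked_sym linked_refl)+
  qed simp
qed

text \<open>By \<open>linked_insert\<close> only the classes of \<open>a\<close> and
  \<open>b\<close> are affected: they are replaced by their union.\<close>

lemma ncls_insert_not_linked:
  assumes "finite S" "a \<in> S" "b \<in> S" "\<not> linked r a b"
  shows "ncls S r = Suc (ncls S (insert (a, b) r))"
proof -
  let ?c = "\<lambda>r u. {v. linked r u v}"
  let ?r = "insert (a, b) r"
  have ab: "?c ?r u = ?c r a \<union> ?c r b" if "linked r u a \<or> linked r u b" for u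
    using that by (auto simp: linked_insert intro: linked_trans linked_sym)
  have o: "?c ?r u = ?c r u" if "\<not> (linked r u a \<or> linked r u b)" for u
    using that by (auto simp: linked_insert)
  have im: "?c ?r ` S = insert (?c r a \<union> ?c r b) (?c r ` S - {?c r a, ?c r b})" (is "_ = ?T")
  proof
    show "?c ?r ` S \<subseteq> ?T"
    proof
      fix C assume "C \<in> ?c ?r ` S"
      then obtain u where u: "u \<in> S" "C = ?c ?r u" by auto
      show "C \<in> ?T"
        using u ab[of u] o[of u] cls_eq_iff[of r u a] cls_eq_iff[of r u b] by auto
    qed
    have "C \<in> ?c ?r ` S" if "C \<in> ?c r ` S - {?c r a, ?c r b}" for C
    proof -
      obtain u where u: "u \<in> S" "C = ?c r u" using \<open>C \<in> _\<close> by auto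
      then have "\<not> (linked r u a \<or> linked r u b)"
        using that cls_eq_iff[of r u a] cls_eq_iff[of r u b] by auto
      then show ?thesis using o[of u] u by auto
    qed
    moreover have "?c r a \<union> ?c r b \<in> ?c ?r ` S"
      using ab[of a] assms(2) by (metis (no_types, lifting) image_eqI linked_refl)
    ultimately show "?T \<subseteq> ?c ?r ` S" by blast
  qed
  have notin: "?c r a \<union> ?c r b \<notin> ?c r ` S - {?c r a, ?c r b}"
  proof
    assume "?c r a \<union> ?c r b \<in> ?c r ` S - {?c r a, ?c r b}"
    then obtain u where u: "?c r a \<union> ?c r b = ?c r u" by auto
    have "a \<in> ?c r u" "b \<in> ?c r u"
      unfolding u[symmetric] by simp_all
    then have "linked r u a" "linked r u b"
      by simp_all
    then show False using assms(4) linked_trans linked_sym by metis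
  qed
  have ne: "?c r a \<noteq> ?c r b" using assms(4) cls_eq_iff by metis
  have sub: "{?c r a, ?c r b} \<subseteq> ?c r ` S" using assms by auto
  have fin: "finite (?c r ` S)" using assms by simp
  have "card (?c r ` S) \<ge> 2"
    using card_mono[OF fin sub] ne by simp
  moreover have "card (?c r ` S - {?c r a, ?c r b}) = card (?c r ` S) - 2"
    using card_Diff_subset[OF _ sub] ne by simp
  moreover have "card (?c ?r ` S) = Suc (card (?c r ` S - {?c r a, ?c r b}))"
    unfolding im using notin fin by (subst card_insert_disjoint) auto
  ultimately show ?thesis unfolding ncls_def by simp
qed

section \<open>Cycles of a permutation of a finite set\<close>

lemma linked_gr_funpow: "linked (gr p) a ((p ^^ n) a)"
  by (induction n) (auto intro: linked_trans linked_gr)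

lemma funpow_return:
  assumes "finite S" "p permutes S"
  obtains n where "n > 0" "(p ^^ n) a = a"
  using assms permutation_self permutation_permutes by metis

text \<open>A positive power of \<open>p\<close> returns to each point, so a backward step is also a
  forward iterate.\<close>

lemma linked_gr_iff:
  assumes "finite S" "p permutes S"
  shows "linked (gr p) a b \<longleftrightarrow> (\<exists>n. b = (p ^^ n) a)"
proof
  assume "linked (gr p) a b"
  then show "\<exists>n. b = (p ^^ n) a" unfolding linked_def
  proof (induction rule: rtrancl_induct)
    case (step y z)
    then obtain n where n: "y = (p ^^ n) a" by blast
    from step consider "z = p y" | "y = p z" by (auto simp: gr_def)
    then show ?case
    proof cases
      case 1
      then have "z = (p ^^ Suc n) a" using n by simp
      then show ?thesis by blast
    next
      case 2
      obtain m where m: "m > 0" "(p ^^ m) z = z"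
        using funpow_return[OF assms] .
      then obtain k where k: "m = Suc k" by (cases m) auto
      have "z = (p ^^ k) y" using m(2) by (simp add: 2 k funpow_swap1)
      then have "z = (p ^^ (k + n)) a" using n by (simp add: funpow_add)
      then show ?thesis by blast
    qed
  qed (auto intro: exI[of _ 0])
qed (auto intro: linked_gr_funpow)

lemma orbit_eq_linked:
  assumes "finite S" "p permutes S"
  shows "orbit p a = {b. linked (gr p) a b}"
proof -
  have "b = (p ^^ n) a \<Longrightarrow> b \<in> orbit p a" for b n
  proof (cases n)
    case 0
    assume "b = (p ^^ n) a"
    moreover obtain m where "m > 0" "(p ^^ m) a = a" using funpow_return[OF assms] .
    ultimately show ?thesis unfolding orbit_altdef using 0 by force
  next
    case (Suc k)
    assume "b = (p ^^ n) a"
    then show ?thesis unfolding orbit_altdef using Suc by blast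
  qed
  then show ?thesis
    by (auto simp: linked_gr_iff[OF assms] orbit_altdef)
qed

lemma card_orbits:
  assumes "finite S" "p permutes S"
  shows "card (orbit p ` T) = ncls T (gr p)"
  unfolding ncls_def using orbit_eq_linked[OF assms] by metis

text \<open>The new permutation sends \<open>b\<close> to \<open>p a\<close> and from there follows
  the old cycle of \<open>a\<close>, which never meets \<open>b\<close>, until it arrives at
  \<open>a\<close>.\<close>

lemma linked_transpose_merge:
  assumes "finite S" "p permutes S" "\<not> linked (gr p) a b"
  shows "linked (gr (p \<circ> transpose a b)) b a"
proof -
  let ?p = "p \<circ> transpose a b"
  have "linked (gr ?p) b ((p ^^ Suc i) a)" for i
  proof (induction i)
    case 0
    show ?case using linked_gr[of ?p b] by (simp add: comp_def)
  next
    case (Suc i)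
    let ?v = "(p ^^ Suc i) a"
    have "?v \<noteq> b" using linked_gr_funpow[of p a "Suc i"] assms(3) by metis
    show ?case
    proof (cases "?v = a")
      case True
      then have "(p ^^ Suc (Suc i)) a = ?p b" by simp
      then show ?thesis using linked_gr[of ?p b] by metis
    next
      case False
      then have "(p ^^ Suc (Suc i)) a = ?p ?v" using \<open>?v \<noteq> b\<close> by simp
      then show ?thesis using linked_gr[of ?p ?v] Suc linked_trans by metis
    qed
  qed
  moreover obtain n where "n > 0" "(p ^^ n) a = a" using funpow_return[OF assms(1,2)] .
  ultimately show ?thesis by (metis gr0_implies_Suc)
qed

lemma linked_transpose_merge_iff:
  assumes "finite S" "p permutes S" "\<not> linked (gr p) a b"
  shows "linked (gr (p \<circ> transpose a b)) x y \<longleftrightarrow> linked (insert (a, b) (gr p)) x y"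
proof
  let ?p = "p \<circ> transpose a b"
  have ba: "linked (gr ?p) b a" by (rule linked_transpose_merge[OF assms])
  show "linked (gr ?p) x y" if "linked (insert (a, b) (gr p)) x y"
    using that
  proof (rule linked_mono)
    fix u v assume "(u, v) \<in> insert (a, b) (gr p)"
    then consider "u = a" "v = b" | "v = p u" by (auto simp: gr_def)
    then show "linked (gr ?p) u v"
    proof cases
      case 2
      have "linked (gr ?p) b (p a)" using linked_gr[of ?p b] by simp
      moreover have "linked (gr ?p) a (p b)" using linked_gr[of ?p a] by simp
      moreover have "linked (gr ?p) u (p u)" if "u \<noteq> a" "u \<noteq> b"
        using linked_gr[of ?p u] that by simp
      ultimately show ?thesis using 2 ba by (metis linked_trans linked_sym)
    qed (use ba linked_sym in metis)
  qed
  show "linked (insert (a, b) (gr p)) x y" if "linked (gr ?p) x y"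
    using that
  proof (rule linked_mono)
    fix u v assume "(u, v) \<in> gr ?p"
    then have v: "v = p (transpose a b u)" by (auto simp: gr_def)
    have "linked (insert (a, b) (gr p)) c (p c)" for c
      by (rule linked_base) (auto simp: gr_def)
    moreover have "linked (insert (a, b) (gr p)) a b" by (rule linked_base) simp
    ultimately have "linked (insert (a, b) (gr p)) u (transpose a b u)"
      "linked (insert (a, b) (gr p)) (transpose a b u) v"
      unfolding v by (auto simp: transpose_def intro: linked_sym)
    then show "linked (insert (a, b) (gr p)) u v" by (rule linked_trans)
  qed
qed

lemma ncls_transpose_merge:
  assumes "finite S" "p permutes S" "a \<in> S" "b \<in> S" "\<not> linked (gr p) a b"
  shows "ncls S (gr p) = Suc (ncls S (gr (p \<circ> transpose a b)))"
  using ncls_insert_not_linked[OF assms(1,3-5)]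
    ncls_cong[of S, OF linked_transpose_merge_iff[OF assms(1,2,5)]] by simp

text \<open>The arc of the cycle that starts just after \<open>a\<close> and ends at
  \<open>b\<close> is closed up by the transposition, since \<open>b\<close> is now sent to
  \<open>p a\<close>.\<close>

lemma transpose_split:
  assumes "finite S" "p permutes S" "a \<noteq> b" "linked (gr p) a b"
  shows "\<not> linked (gr (p \<circ> transpose a b)) a b"
proof -
  let ?p = "p \<circ> transpose a b"
  define j where "j = (LEAST n. b = (p ^^ n) a)"
  have ex: "\<exists>n. b = (p ^^ n) a" using assms linked_gr_iff by metis
  have bj: "b = (p ^^ j) a" unfolding j_def using ex by (rule LeastI_ex)
  have min: "b \<noteq> (p ^^ n) a" if "n < j" for n using that not_less_Least unfolding j_def by blast
  have j0: "j > 0" using bj assms(3) by (cases j) auto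
  have na: "(p ^^ i) a \<noteq> a" if "0 < i" "i \<le> j" for i
  proof
    assume i: "(p ^^ i) a = a"
    have "(p ^^ (j - i)) ((p ^^ i) a) = (p ^^ j) a"
      using that by (metis comp_apply funpow_add le_add_diff_inverse2)
    then have "b = (p ^^ (j - i)) a" using i bj by simp
    then show False using min[of "j - i"] that by simp
  qed
  \<comment> \<open>The arc from \<open>p a\<close> to \<open>b\<close>. As \<open>j\<close> is the
    first time \<open>b\<close> is reached, \<open>a\<close> is not on it.\<close>
  define X where "X = (\<lambda>i. (p ^^ i) a) ` {1..j}"
  have inj: "inj p" using assms(2) by (rule permutes_inj)
  have "?p u \<in> X" if u: "u \<in> X" for u
  proof -
    obtain i where "i \<in> {1..j}" "u = (p ^^ i) a" using u unfolding X_def by blast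
    then have i: "u = (p ^^ i) a" "1 \<le> i" "i \<le> j" by simp_all
    show ?thesis
    proof (cases "i = j")
      case True
      then have "?p u = (p ^^ 1) a" using i bj by simp
      then show ?thesis unfolding X_def using j0 by (intro image_eqI[of _ _ 1]) auto
    next
      case False
      then have "u \<noteq> a" "u \<noteq> b" using na[of i] min[of i] i by auto
      then have "?p u = (p ^^ Suc i) a" using i by simp
      then show ?thesis unfolding X_def using False i by (intro image_eqI[of _ _ "Suc i"]) auto
    qed
  qed
  then have sub: "?p ` X \<subseteq> X" by auto
  have injp: "inj ?p" using inj by (intro inj_compose) auto
  have fin: "finite X" unfolding X_def by simp
  have surj: "?p ` X = X"
    by (rule endo_inj_surj[OF fin sub inj_on_subset[OF injp subset_UNIV]])
  have "linked (gr ?p) b a \<Longrightarrow> a \<in> X"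
  proof (erule linked_closed)
    show "b \<in> X" unfolding X_def using bj j0 by (intro image_eqI[of _ _ j]) auto
    show "u \<in> X \<longleftrightarrow> v \<in> X" if "(u, v) \<in> gr ?p" for u v
    proof -
      have v: "v = ?p u" using that unfolding gr_def by blast
      show ?thesis
      proof
        show "u \<in> X \<Longrightarrow> v \<in> X" unfolding v using sub by blast
        assume "v \<in> X"
        then obtain w where "w \<in> X" "?p u = ?p w" using surj v by auto
        then show "u \<in> X" using injp by (metis injD)
      qed
    qed
  qed
  moreover have "a \<notin> X" unfolding X_def using na by (fastforce dest: sym)
  ultimately show ?thesis using linked_sym by metis
qed

text \<open>Read backwards, this is a merge: the same transposition applied to the split permutation
  gives \<open>p\<close> again.\<close>

lemma ncls_transpose_split:
  assumes "finite S" "p permutes S" "a \<in> S" "b \<in> S" "a \<noteq> b" "linked (gr p) a b"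
  shows "ncls S (gr (p \<circ> transpose a b)) = Suc (ncls S (gr p))"
proof -
  let ?p = "p \<circ> transpose a b"
  have "?p permutes S"
    using permutes_compose[OF permutes_swap_id[OF assms(3,4)] assms(2)] .
  from ncls_transpose_merge[OF assms(1) this assms(3,4) transpose_split[OF assms(1,2,5,6)]]
  show ?thesis by (simp add: comp_assoc)
qed

text \<open>The relation \<open>t\<close> stands for further links that stay away from
  \<open>e\<close>. Pairs on the diagonal are permitted, because the graph of a permutation fixing
  \<open>e\<close> contains \<open>(e, e)\<close>.\<close>

lemma linked_perm_delete:
  assumes "inj p" "u \<noteq> e" "v \<noteq> e" "\<And>a b. (a, b) \<in> t \<Longrightarrow> a \<noteq> b \<Longrightarrow> a \<noteq> e \<and> b \<noteq> e"
  shows "linked (gr (perm_delete e p) \<union> t) u v \<longleftrightarrow> linked (gr p \<union> t) u v"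
proof
  assume "linked (gr (perm_delete e p) \<union> t) u v"
  then show "linked (gr p \<union> t) u v"
  proof (rule linked_mono)
    fix a b assume "(a, b) \<in> gr (perm_delete e p) \<union> t"
    then consider "b = perm_delete e p a" | "(a, b) \<in> t" by (auto simp: gr_def)
    then show "linked (gr p \<union> t) a b"
    proof cases
      case 1
      then show ?thesis
        using linked_gr_Un[of p t] unfolding perm_delete_def by (metis linked_trans linked_refl)
    qed (auto intro: linked_base)
  qed
next
  \<comment> \<open>The map \<open>?h\<close> pushes \<open>e\<close> to its successor, so a path
    through \<open>e\<close> becomes a path that jumps over it.\<close>
  let ?h = "\<lambda>a. if a = e then p e else a"
  let ?r = "gr (perm_delete e p) \<union> t"
  assume "linked (gr p \<union> t) u v"
  then have "linked ?r (?h u) (?h v)"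
  proof (rule linked_image)
    fix a b assume "(a, b) \<in> gr p \<union> t"
    then consider "b = p a" | "(a, b) \<in> t" by (auto simp: gr_def)
    then show "linked ?r (?h a) (?h b)"
    proof cases
      case 1
      show ?thesis
        using 1 linked_gr_Un[of "perm_delete e p" t a] \<open>inj p\<close>
        by (auto simp: perm_delete_def split: if_splits)
    next
      case 2
      then show ?thesis using assms(4)[OF 2] by (cases "a = b") (auto intro: linked_base)
    qed
  qed
  then show "linked ?r u v" using assms(2,3) by simp
qed

lemma linked_perm_delete':
  assumes "inj p" "u \<noteq> e" "v \<noteq> e"
  shows "linked (gr (perm_delete e p)) u v \<longleftrightarrow> linked (gr p) u v"
  using linked_perm_delete[of p u e v "{}"] assms by simp

lemma ncls_remove_linked:
  assumes "e \<in> S" "f \<in> S" "e \<noteq> f" "linked r e f"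
  shows "ncls (S - {e}) r = ncls S r"
proof -
  have "{c. linked r e c} = {c. linked r f c}" using assms(4) by (simp only: cls_eq_iff)
  then have "{b. linked r e b} \<in> (\<lambda>a. {b. linked r a b}) ` (S - {e})"
    using assms(2,3) by blast
  moreover have "(\<lambda>a. {b. linked r a b}) ` S =
      insert {b. linked r e b} ((\<lambda>a. {b. linked r a b}) ` (S - {e}))"
    using assms(1) by blast
  ultimately show ?thesis by (simp add: ncls_def insert_absorb)
qed

lemma ncls_remove_isolated:
  assumes "finite S" "e \<in> S" "\<And>u. u \<in> S \<Longrightarrow> linked r e u \<Longrightarrow> u = e"
  shows "ncls S r = Suc (ncls (S - {e}) r)"
proof -
  have "(\<lambda>a. {b. linked r a b}) ` S =
      insert {b. linked r e b} ((\<lambda>a. {b. linked r a b}) ` (S - {e}))"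
    using assms(2) by blast
  moreover have "{b. linked r e b} \<notin> (\<lambda>a. {b. linked r a b}) ` (S - {e})"
    using assms(3) cls_eq_iff[of r e] by fast
  ultimately show ?thesis using assms(1) by (simp add: ncls_def)
qed

lemma linked_fixed_iff:
  assumes "inj p" "p e = e" "\<And>a b. (a, b) \<in> t \<Longrightarrow> a \<noteq> b \<Longrightarrow> a \<noteq> e \<and> b \<noteq> e"
  shows "linked (gr p \<union> t) e u \<longleftrightarrow> u = e"
proof
  assume "linked (gr p \<union> t) e u"
  then have "u \<in> {e}"
    by (rule linked_closed) (use assms in \<open>auto simp: gr_def dest: injD\<close>)
  then show "u = e" by simp
qed simp

lemma ncls_perm_delete:
  assumes "finite S" "p permutes S" "e \<in> S" "\<And>a b. (a, b) \<in> t \<Longrightarrow> a \<noteq> b \<Longrightarrow> a \<noteq> e \<and> b \<noteq> e"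
  shows "ncls S (gr p \<union> t) =
    (if p e = e then Suc (ncls (S - {e}) (gr (perm_delete e p) \<union> t))
     else ncls (S - {e}) (gr (perm_delete e p) \<union> t))"
proof -
  have inj: "inj p" using assms(2) by (rule permutes_inj)
  have eq: "ncls (S - {e}) (gr (perm_delete e p) \<union> t) = ncls (S - {e}) (gr p \<union> t)"
    by (rule ncls_cong) (use linked_perm_delete[OF inj _ _ assms(4)] in auto)
  show ?thesis
  proof (cases "p e = e")
    case True
    then show ?thesis
      using ncls_remove_isolated[OF assms(1,3), of "gr p \<union> t"]
        linked_fixed_iff[of p e t, OF inj True assms(4)] eq by simp
  next
    case False
    have "p e \<in> S" using assms(2,3) by (simp add: permutes_in_image)
    then show ?thesis
      using ncls_remove_linked[of e S "p e" "gr p \<union> t"] assms(3) False eq linked_gr_Un[of p t e]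
      by auto
  qed
qed

lemma ncls_perm_delete':
  assumes "finite S" "p permutes S" "e \<in> S"
  shows "ncls S (gr p) = (if p e = e then Suc (ncls (S - {e}) (gr (perm_delete e p)))
     else ncls (S - {e}) (gr (perm_delete e p)))"
  using ncls_perm_delete[OF assms, of "{}"] by simp

lemma perm_delete_permutes:
  assumes "p permutes S"
  shows "perm_delete e p permutes (S - {e})"
proof -
  have eq: "perm_delete e p = p \<circ> transpose e (inv p e)"
    using permutes_inverses[OF assms]
    by (auto simp: perm_delete_def transpose_def fun_eq_iff)
  have "bij (perm_delete e p)"
    unfolding eq using permutes_bij[OF assms] by (intro bij_comp) auto
  then show ?thesis
    unfolding permutes_def bij_iff using permutes_not_in[OF assms]
    by (auto simp: perm_delete_def)
qed

lemma perm_delete_inv: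
  assumes "p permutes S"
  shows "perm_delete e (inv p) = inv (perm_delete e p)"
proof (rule inv_equality[symmetric])
  show "perm_delete e (inv p) (perm_delete e p a) = a" for a
    using permutes_inverses[OF assms] by (auto simp: perm_delete_def) (metis)+
  show "perm_delete e p (perm_delete e (inv p) a) = a" for a
    using permutes_inverses[OF assms] by (auto simp: perm_delete_def) (metis)+
qed

lemma linked_gr_inv:
  assumes "p permutes S"
  shows "linked (gr (inv p)) a b \<longleftrightarrow> linked (gr p) a b"
proof -
  have "gr (inv p) = (gr p)\<inverse>"
    using permutes_inverses[OF assms] by (force simp: gr_def)
  then show ?thesis by (simp add: linked_def Un_commute)
qed

section \<open>Half-edge maps and their state sum\<close>

definition swap_on :: "('a \<Rightarrow> 'a) \<Rightarrow> 'a set \<Rightarrow> 'a \<Rightarrow> 'a" where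
  "swap_on s A a = (if a \<in> A then s a else a)"

text \<open>Unions of 2-cycles of \<open>s\<close>. At a fixed point of \<open>s\<close> the
  continuations \<open>L a\<close> and \<open>L (s a)\<close> agree, so no choice is recorded there
  and no state is counted twice.\<close>

definition smoothings :: "'a set \<Rightarrow> ('a \<Rightarrow> 'a) \<Rightarrow> 'a set set" where
  "smoothings D s = {A. A \<subseteq> D \<and> (\<forall>a\<in>A. s a \<in> A \<and> s a \<noteq> a)}"

text \<open>The elements of \<open>D\<close> play two roles: half-edges of a graph with partner map \<open>s\<close> and rotation
  \<open>L\<close>, where \<open>A\<close> is a set of edges, and edges of a dimap with \<open>s\<close> its \<open>sig1\<close> and \<open>L\<close> its left
  successor, where \<open>A\<close> is the set of edges followed by their right successor \<open>L (s a)\<close>.\<close>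

definition circles :: "'a set \<Rightarrow> ('a \<Rightarrow> 'a) \<Rightarrow> ('a \<Rightarrow> 'a) \<Rightarrow> 'a set \<Rightarrow> nat" where
  "circles D s L A = ncls D (gr (L \<circ> swap_on s A))"

definition pieces :: "'a set \<Rightarrow> ('a \<Rightarrow> 'a) \<Rightarrow> ('a \<Rightarrow> 'a) \<Rightarrow> nat" where
  "pieces D s L = ncls D (gr L \<union> gr s)"

text \<open>The subtraction of natural numbers never truncates, by
  \<open>pieces_le_circles\<close>.\<close>

definition state_sum :: "'r::comm_ring_1 \<Rightarrow> 'a set \<Rightarrow> ('a \<Rightarrow> 'a) \<Rightarrow> ('a \<Rightarrow> 'a) \<Rightarrow> 'r" where
  "state_sum x D s L = (\<Sum>A\<in>smoothings D s. (x - 1) ^ (circles D s L A - pieces D s L))"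

text \<open>A form of planarity that is visibly inherited by minors: adding an edge to a connected part of
  a ribbon subgraph splits a boundary circle.\<close>

definition planar_half :: "'a set \<Rightarrow> ('a \<Rightarrow> 'a) \<Rightarrow> ('a \<Rightarrow> 'a) \<Rightarrow> bool" where
  "planar_half D s L \<longleftrightarrow> (\<forall>A\<in>smoothings D s. \<forall>e\<in>D - A.
     linked (gr L \<union> gr (swap_on s A)) e (s e) \<longrightarrow> linked (gr (L \<circ> swap_on s A)) e (s e))"

text \<open>Passing from \<open>L\<close> to \<open>L \<circ> s\<close> exchanges vertices and
  faces. The first half serves the \<open>\<omega>^2\<close>-semiloops, the second the
  \<open>\<omega>\<close>-semiloops.\<close>

definition planar_map :: "'a set \<Rightarrow> ('a \<Rightarrow> 'a) \<Rightarrow> ('a \<Rightarrow> 'a) \<Rightarrow> bool" where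
  "planar_map D s L \<longleftrightarrow> planar_half D s L \<and> planar_half D s (L \<circ> s)"

lemma gr_swap_on_nonfixed: "(a, b) \<in> gr (swap_on s A) \<Longrightarrow> a \<noteq> b \<Longrightarrow> a \<in> A \<and> b = s a"
  by (auto simp: gr_def swap_on_def split: if_splits)

text \<open>Fixed points of \<open>s\<close> are allowed because a minor removes the single half
  \<open>e\<close> and leaves its former partner behind as a fixed point.\<close>

locale half_edge_map =
  fixes D :: "'a set" and s L :: "'a \<Rightarrow> 'a"
  assumes fin: "finite D"
    and s_perm: "s permutes D"
    and s_s [simp]: "s (s a) = a"
    and L_perm: "L permutes D"
begin

lemma s_in [simp]: "s a \<in> D \<longleftrightarrow> a \<in> D"
  using s_perm by (simp add: permutes_in_image)

lemma L_in [simp]: "L a \<in> D \<longleftrightarrow> a \<in> D"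
  using L_perm by (simp add: permutes_in_image)

lemma s_inj [simp]: "s a = s b \<longleftrightarrow> a = b"
  using s_perm by (metis s_s)

lemma L_inj [simp]: "L a = L b \<longleftrightarrow> a = b"
  using L_perm by (metis permutes_inverses(2))

lemma finite_smoothings: "finite (smoothings D s)"
  using fin by (auto simp: smoothings_def intro: finite_subset[of _ "Pow D"])

lemma smoothing_subset: "A \<in> smoothings D s \<Longrightarrow> a \<in> A \<Longrightarrow> a \<in> D"
  by (auto simp: smoothings_def)

lemma smoothing_s: "A \<in> smoothings D s \<Longrightarrow> s a \<in> A \<longleftrightarrow> a \<in> A"
  unfolding smoothings_def using s_s by (metis (mono_tags, lifting) mem_Collect_eq)

lemma smoothing_nonfixed: "A \<in> smoothings D s \<Longrightarrow> a \<in> A \<Longrightarrow> s a \<noteq> a"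
  by (auto simp: smoothings_def)

lemma swap_on_permutes:
  assumes "A \<in> smoothings D s"
  shows "swap_on s A permutes D"
proof (rule bij_imp_permutes)
  show "bij_betw (swap_on s A) D D"
    by (rule bij_betwI[of _ _ _ "swap_on s A"])
       (use assms smoothing_s in \<open>auto simp: swap_on_def\<close>)
  show "swap_on s A a = a" if "a \<notin> D" for a
    using that assms smoothing_subset by (auto simp: swap_on_def)
qed

lemma state_permutes:
  assumes "A \<in> smoothings D s"
  shows "L \<circ> swap_on s A permutes D"
  using swap_on_permutes[OF assms] L_perm by (rule permutes_compose)

lemma dual: "half_edge_map D s (L \<circ> s)"
  by unfold_locales (use fin s_perm L_perm permutes_compose in auto)

lemma Ls_s: "L \<circ> s \<circ> s = L"
  by (auto simp: fun_eq_iff)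

lemma pieces_dual: "pieces D s (L \<circ> s) = pieces D s L"
  unfolding pieces_def
proof (rule ncls_eqI)
  fix u v assume "(u, v) \<in> gr (L \<circ> s) \<union> gr s"
  then have "v = s u \<or> v = L (s u)" by (auto simp: gr_def)
  then show "linked (gr L \<union> gr s) u v"
    using linked_gr_Un[of L "gr s"] linked_gr_Un2[of "gr L" s] linked_trans by metis
next
  fix u v assume "(u, v) \<in> gr L \<union> gr s"
  moreover have "L u = (L \<circ> s) (s u)" by simp
  ultimately show "linked (gr (L \<circ> s) \<union> gr s) u v"
    using linked_gr_Un[of "L \<circ> s" "gr s"] linked_gr_Un2[of "gr (L \<circ> s)" s] linked_trans
    by (smt (verit, best) UnE gr_def imageE prod.inject)
qed

lemma dual_smoothing:
  assumes "A \<in> smoothings D s"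
  shows "{a\<in>D. s a \<noteq> a} - A \<in> smoothings D s"
  using assms smoothing_s[OF assms] unfolding smoothings_def by auto

text \<open>Composing with \<open>s\<close> cancels the swap on \<open>A\<close> and performs it on
  all other 2-cycles.\<close>

lemma circles_dual:
  assumes "A \<in> smoothings D s"
  shows "circles D s (L \<circ> s) A = circles D s L ({a\<in>D. s a \<noteq> a} - A)"
proof -
  have "L \<circ> s \<circ> swap_on s A = L \<circ> swap_on s ({a\<in>D. s a \<noteq> a} - A)"
    using s_perm smoothing_subset[OF assms] smoothing_nonfixed[OF assms]
    by (auto simp: fun_eq_iff swap_on_def permutes_not_in)
  then show ?thesis by (simp add: circles_def)
qed

lemma state_sum_dual: "state_sum x D s (L \<circ> s) = state_sum x D s L"
  unfolding state_sum_def pieces_dual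
proof (rule sum.reindex_bij_witness)
  let ?d = "\<lambda>A. {a\<in>D. s a \<noteq> a} - A"
  have dd: "?d (?d A) = A" if "A \<in> smoothings D s" for A
    using that smoothing_subset[OF that] smoothing_nonfixed[OF that] by auto
  fix A assume A: "A \<in> smoothings D s"
  show "?d (?d A) = A" "?d (?d A) = A" "?d A \<in> smoothings D s" "?d A \<in> smoothings D s"
    using dd[OF A] dual_smoothing[OF A] by auto
  show "(x - 1) ^ (circles D s L (?d A) - pieces D s L) =
      (x - 1) ^ (circles D s (L \<circ> s) A - pieces D s L)"
    by (simp add: circles_dual[OF A])
qed

lemma pieces_le_circles:
  assumes "A \<in> smoothings D s"
  shows "pieces D s L \<le> circles D s L A"
  unfolding pieces_def circles_def
proof (rule ncls_antimono[OF fin])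
  fix u v assume "(u, v) \<in> gr (L \<circ> swap_on s A)"
  then have "v = L u \<or> v = L (s u)" by (auto simp: gr_def swap_on_def)
  then show "linked (gr L \<union> gr s) u v"
    using linked_gr_Un[of L "gr s"] linked_gr_Un2[of "gr L" s] linked_trans by metis
qed

lemma s_delete: "perm_delete e s a = (if a = e \<or> a = s e then a else s a)"
  by (auto simp: perm_delete_def)

lemma delete: "half_edge_map (D - {e}) (perm_delete e s) (perm_delete e L)"
proof
  show "perm_delete e s (perm_delete e s a) = a" for a
    by (auto simp: s_delete)
qed (use fin s_perm L_perm perm_delete_permutes in auto)

text \<open>Contraction is deletion in the dual map, followed by dualising back. The resulting
  rotation is the left successor in \<open>H[\<omega>^2]e\<close>, while deletion gives that in
  \<open>H[\<omega>]e\<close>.\<close>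

lemma contract: "half_edge_map (D - {e}) (perm_delete e s) (perm_delete e (L \<circ> s) \<circ> perm_delete e s)"
  using half_edge_map.dual[OF half_edge_map.delete[OF dual]] .

lemma smoothings_delete:
  "smoothings (D - {e}) (perm_delete e s) = {A \<in> smoothings D s. e \<notin> A}"
proof (intro set_eqI iffI)
  fix A assume "A \<in> smoothings (D - {e}) (perm_delete e s)"
  then show "A \<in> {A \<in> smoothings D s. e \<notin> A}"
    unfolding smoothings_def s_delete by (auto split: if_splits)
next
  fix A assume A: "A \<in> {A \<in> smoothings D s. e \<notin> A}"
  then have "s e \<notin> A" using smoothing_s by blast
  then show "A \<in> smoothings (D - {e}) (perm_delete e s)"
    using A unfolding smoothings_def s_delete by auto
qed

lemma smoothings_fixed: "s e = e \<Longrightarrow> {A \<in> smoothings D s. e \<notin> A} = smoothings D s"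
  unfolding smoothings_def by auto

lemma insert_smoothing:
  assumes "A \<in> smoothings D s" "e \<in> D" "s e \<noteq> e"
  shows "insert e (insert (s e) A) \<in> smoothings D s"
  using assms unfolding smoothings_def by auto

lemma swap_on_delete:
  assumes "A \<in> smoothings D s" "e \<notin> A"
  shows "swap_on (perm_delete e s) A = swap_on s A"
proof -
  have "s e \<notin> A" using assms smoothing_s by blast
  then show ?thesis using assms(2) by (auto simp: fun_eq_iff swap_on_def s_delete)
qed

lemma state_delete:
  assumes "A \<in> smoothings D s" "e \<notin> A"
  shows "perm_delete e L \<circ> swap_on s A = perm_delete e (L \<circ> swap_on s A)"
proof -
  have "s e \<notin> A" using assms smoothing_s by blast
  then have 1: "swap_on s A a = e \<longleftrightarrow> a = e" for a
    using assms(2) by (auto simp: swap_on_def)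
  have 2: "swap_on s A e = e" using assms(2) by (simp add: swap_on_def)
  show ?thesis by (simp add: perm_delete_def fun_eq_iff 1 2)
qed

text \<open>States of the contraction are the states that swap \<open>e\<close> with its partner,
  with \<open>e\<close> cut out of its curve. Together with \<open>state_delete\<close>, which
  handles the states without the swap, this matches the two reductions with the two choices at the
  head of \<open>e\<close>.\<close>

lemma state_contract:
  assumes "A \<in> smoothings D s" "e \<notin> A"
  shows "perm_delete e (L \<circ> s) \<circ> perm_delete e s \<circ> swap_on s A =
    perm_delete e (L \<circ> swap_on s (insert e (insert (s e) A)))"
proof
  fix a
  have "s e \<notin> A" using assms smoothing_s by blast
  have eq: "s a \<noteq> e \<longleftrightarrow> a \<noteq> s e" "s a \<noteq> s e \<longleftrightarrow> a \<noteq> e" "s a = e \<longleftrightarrow> a = s e" for a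
    by (metis s_s)+
  let ?B = "insert e (insert (s e) A)"
  have B: "swap_on s ?B a = e \<longleftrightarrow> a = s e" "swap_on s ?B e = s e"
    using eq(1)[of a] smoothing_s[OF assms(1), of a] by (auto simp: swap_on_def)
  consider "a = e" | "a = s e" "a \<noteq> e" | "a \<noteq> e" "a \<noteq> s e" "a \<in> A" | "a \<noteq> e" "a \<noteq> s e" "a \<notin> A"
    by blast
  then show "(perm_delete e (L \<circ> s) \<circ> perm_delete e s \<circ> swap_on s A) a =
      perm_delete e (L \<circ> swap_on s ?B) a"
  proof cases
    case 3
    then have "s a \<noteq> e" "s a \<noteq> s e" "s a \<in> A" using eq smoothing_s[OF assms(1)] by auto
    then show ?thesis using 3 by (simp add: perm_delete_def swap_on_def)
  next
    case 4
    then have "s a \<noteq> e" "s a \<noteq> s e" using eq by auto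
    then show ?thesis using 4 by (simp add: perm_delete_def swap_on_def)
  qed (use \<open>s e \<notin> A\<close> assms(2) in \<open>auto simp: perm_delete_def swap_on_def\<close>)
qed

text \<open>Changing the choice at \<open>e\<close> multiplies the state by a transposition, which
  merges two curves or splits one.\<close>

lemma state_insert:
  assumes "A \<in> smoothings D s" "e \<notin> A"
  shows "L \<circ> swap_on s (insert e (insert (s e) A)) = L \<circ> swap_on s A \<circ> transpose e (s e)"
proof -
  have "s e \<notin> A" using assms smoothing_s by blast
  then show ?thesis
    using assms(2) by (auto simp: fun_eq_iff swap_on_def transpose_def)
qed

end

lemma linked_perm_delete_self: "linked (gr p) a (perm_delete e p a)"
  using linked_gr[of p a] linked_trans[OF linked_gr[of p a] linked_gr[of p "p a"]]
  by (auto simp: perm_delete_def)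

section \<open>The state sum under deletion and contraction\<close>

context half_edge_map
begin

lemma linked_comp_swap_on:
  assumes "linked (gr (L \<circ> f)) u v" "\<And>a. linked (gr L \<union> t) a (f a)"
  shows "linked (gr L \<union> t) u v"
  using assms(1)
proof (rule linked_mono)
  fix a b assume "(a, b) \<in> gr (L \<circ> f)"
  then have "b = L (f a)" by (auto simp: gr_def)
  then show "linked (gr L \<union> t) a b"
    using assms(2)[of a] linked_gr_Un[of L t "f a"] linked_trans by metis
qed

lemma gr_s_delete: "(a, b) \<in> gr (perm_delete e s) \<Longrightarrow> a \<noteq> b \<Longrightarrow> a \<noteq> e \<and> b \<noteq> e"
  by (auto simp: gr_def s_delete split: if_splits)

lemma s_delete_transpose: "perm_delete e s = s \<circ> transpose e (s e)"
  by (auto simp: fun_eq_iff s_delete transpose_def)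

lemma circles_delete:
  assumes "A \<in> smoothings D s" "e \<notin> A" "e \<in> D"
  shows "circles D s L A =
    (if L e = e then Suc (circles (D - {e}) (perm_delete e s) (perm_delete e L) A)
     else circles (D - {e}) (perm_delete e s) (perm_delete e L) A)"
  using ncls_perm_delete'[OF fin state_permutes[OF assms(1)] assms(3)] assms(2)
  by (simp add: circles_def swap_on_delete[OF assms(1,2)] state_delete[OF assms(1,2)]
      swap_on_def[of s A e])

lemma circles_contract:
  assumes "A \<in> smoothings D s" "e \<notin> A" "e \<in> D" "s e \<noteq> e"
  shows "circles D s L (insert e (insert (s e) A)) =
    (if L (s e) = e
     then Suc (circles (D - {e}) (perm_delete e s) (perm_delete e (L \<circ> s) \<circ> perm_delete e s) A)
     else circles (D - {e}) (perm_delete e s) (perm_delete e (L \<circ> s) \<circ> perm_delete e s) A)"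
  using ncls_perm_delete'[OF fin state_permutes[OF insert_smoothing[OF assms(1,3,4)]] assms(3)]
    state_contract[OF assms(1,2)]
  by (simp add: circles_def swap_on_delete[OF assms(1,2)] swap_on_def[of s "insert _ _" e])

lemma ncls_without_swap:
  assumes "e \<in> D"
  shows "ncls D (gr L \<union> gr (perm_delete e s)) =
    (if L e = e then Suc (pieces (D - {e}) (perm_delete e s) (perm_delete e L))
     else pieces (D - {e}) (perm_delete e s) (perm_delete e L))"
  unfolding pieces_def by (rule ncls_perm_delete[OF fin L_perm assms gr_s_delete])

text \<open>Separates from \<open>s\<close> the single link between \<open>e\<close> and its
  partner; whether this link is already implied by the rest decides how deletion changes the number
  of pieces.\<close>

lemma pieces_insert:
  "pieces D s L = ncls D (insert (e, s e) (gr L \<union> gr (perm_delete e s)))"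
  unfolding pieces_def
proof (rule ncls_eqI)
  let ?r = "insert (e, s e) (gr L \<union> gr (perm_delete e s))"
  fix u v assume "(u, v) \<in> gr L \<union> gr s"
  then consider "(u, v) \<in> gr L" | "v = s u" "u = e" | "v = s u" "u = s e"
    | "v = perm_delete e s u"
    unfolding gr_def s_delete by (cases "u = e"; cases "u = s e") auto
  then show "linked ?r u v"
  proof cases
    case 3
    then show ?thesis using linked_sym[OF linked_base[of e "s e" ?r]] by simp
  qed (auto intro!: linked_base simp: gr_def)
next
  fix u v assume "(u, v) \<in> insert (e, s e) (gr L \<union> gr (perm_delete e s))"
  then have "(u, v) \<in> gr L \<union> gr s \<or> u = v" by (auto simp: gr_def s_delete)
  then show "linked (gr L \<union> gr s) u v" by (auto intro: linked_base)
qed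

lemma pieces_delete_linked:
  assumes "e \<in> D" "linked (gr L \<union> gr (perm_delete e s)) e (s e)" "L e \<noteq> e"
  shows "pieces (D - {e}) (perm_delete e s) (perm_delete e L) = pieces D s L"
  using ncls_without_swap[OF assms(1)] pieces_insert[of e] ncls_insert_linked[OF assms(2)] assms(3)
  by simp

lemma pieces_delete_not_linked:
  assumes "e \<in> D" "\<not> linked (gr L \<union> gr (perm_delete e s)) e (s e)"
  shows "Suc (pieces D s L) = ncls D (gr L \<union> gr (perm_delete e s))"
  using pieces_insert[of e] ncls_insert_not_linked[OF fin _ _ assms(2)] assms(1) by simp

lemma pieces_fixed:
  assumes "e \<in> D" "s e = e"
  shows "pieces D s L =
    (if L e = e then Suc (pieces (D - {e}) (perm_delete e s) (perm_delete e L))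
     else pieces (D - {e}) (perm_delete e s) (perm_delete e L))"
  using ncls_without_swap[OF assms(1)] pieces_insert[of e] assms(2)
  by (simp add: ncls_insert_linked)

text \<open>An edge with different faces on its two sides is not a bridge: removing it merges these
  faces, and the merged boundary leads from one half of the edge to the other.\<close>

lemma linked_without_swap:
  assumes "\<not> linked (gr (L \<circ> s)) e (s e)"
  shows "linked (gr L \<union> gr (perm_delete e s)) e (s e)"
proof (rule linked_comp_swap_on[of "perm_delete e s"])
  show "linked (gr (L \<circ> perm_delete e s)) e (s e)"
    using linked_transpose_merge[OF fin half_edge_map.L_perm[OF dual] assms]
    by (simp add: s_delete_transpose comp_assoc linked_sym)
qed (rule linked_gr_Un2)

text \<open>There is no choice to make at \<open>e\<close>. If \<open>L\<close> fixes
  \<open>e\<close> as well, a circle and a piece disappear together, and the exponent stays.\<close>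

theorem state_sum_fixed:
  assumes "e \<in> D" "s e = e"
  shows "state_sum x D s L = state_sum x (D - {e}) (perm_delete e s) (perm_delete e L)"
  unfolding state_sum_def smoothings_delete smoothings_fixed[OF assms(2)]
proof (rule sum.cong[OF refl])
  fix A assume A: "A \<in> smoothings D s"
  then have "e \<notin> A" using assms(2) smoothing_nonfixed by blast
  then show "(x - 1) ^ (circles D s L A - pieces D s L) =
      (x - 1) ^ (circles (D - {e}) (perm_delete e s) (perm_delete e L) A -
        pieces (D - {e}) (perm_delete e s) (perm_delete e L))"
    using circles_delete[OF A _ assms(1)] pieces_fixed[OF assms] by simp
qed

lemma sum_smoothings:
  assumes "e \<in> D" "s e \<noteq> e"
  shows "(\<Sum>A\<in>smoothings D s. f A) =
    (\<Sum>A\<in>smoothings (D - {e}) (perm_delete e s). f A + f (insert e (insert (s e) A)))"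
proof -
  let ?S = "smoothings D s"
  have "(\<Sum>A\<in>?S. f A) = (\<Sum>A\<in>{A\<in>?S. e \<notin> A}. f A) + (\<Sum>A\<in>{A\<in>?S. e \<in> A}. f A)"
    using finite_smoothings by (subst sum.union_disjoint[symmetric]) (auto intro: sum.cong)
  also have "(\<Sum>A\<in>{A\<in>?S. e \<in> A}. f A) = (\<Sum>A\<in>{A\<in>?S. e \<notin> A}. f (insert e (insert (s e) A)))"
  proof (rule sum.reindex_bij_witness[of _ "\<lambda>A. insert e (insert (s e) A)" "\<lambda>A. A - {e, s e}"])
    fix A assume A: "A \<in> {A\<in>?S. e \<in> A}"
    then have "s e \<in> A" using smoothing_s by auto
    then show "insert e (insert (s e) (A - {e, s e})) = A" using A by auto
    then show "f (insert e (insert (s e) (A - {e, s e}))) = f A" by simp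
    show "A - {e, s e} \<in> {A\<in>?S. e \<notin> A}"
      using A unfolding smoothings_def by auto
  next
    fix A assume A: "A \<in> {A\<in>?S. e \<notin> A}"
    then have "s e \<notin> A" using smoothing_s by auto
    then show "insert e (insert (s e) A) - {e, s e} = A" using A by auto
    show "insert e (insert (s e) A) \<in> {A\<in>?S. e \<in> A}"
      using A insert_smoothing assms by auto
  qed
  finally show ?thesis by (simp add: smoothings_delete sum.distrib)
qed

lemma contract_eq_delete:
  assumes "L e = e" "s e \<noteq> e"
  shows "perm_delete e (L \<circ> s) \<circ> perm_delete e s = perm_delete e L"
proof
  fix a
  have "L a = e \<longleftrightarrow> a = e" for a using assms(1) L_inj by metis
  moreover have "s a = e \<longleftrightarrow> a = s e" for a by (metis s_s)
  ultimately show "(perm_delete e (L \<circ> s) \<circ> perm_delete e s) a = perm_delete e L a"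
    using assms by (auto simp: perm_delete_def)
qed

text \<open>Without the swap, \<open>e\<close> is a curve of its own; with the swap, it is absorbed
  by another curve. So each state of the minor occurs with exponents \<open>n + 1\<close> and
  \<open>n\<close>, and (x - 1) + 1 = x.\<close>

theorem state_sum_loop:
  assumes "e \<in> D" "s e \<noteq> e" "L e = e"
  shows "state_sum x D s L = x * state_sum x (D - {e}) (perm_delete e s) (perm_delete e L)"
proof -
  let ?D = "D - {e}" and ?s = "perm_delete e s" and ?L = "perm_delete e L"
  interpret del: half_edge_map ?D ?s ?L by (rule delete)
  have "\<not> linked (gr L \<union> gr ?s) e (s e)"
    using linked_fixed_iff[of L e "gr ?s"] permutes_inj[OF L_perm] assms(2,3) gr_s_delete by blast
  then have p: "pieces D s L = pieces ?D ?s ?L"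
    using pieces_delete_not_linked[OF assms(1)] ncls_without_swap[OF assms(1)] assms(3) by simp
  have Lse: "L (s e) \<noteq> e" using assms(2,3) L_inj by metis
  have "(x - 1) ^ (circles D s L A - pieces D s L) +
      (x - 1) ^ (circles D s L (insert e (insert (s e) A)) - pieces D s L) =
      x * (x - 1) ^ (circles ?D ?s ?L A - pieces ?D ?s ?L)"
    if A: "A \<in> smoothings ?D ?s" for A
  proof -
    have A': "A \<in> smoothings D s" "e \<notin> A" using A by (auto simp: smoothings_delete)
    have "circles D s L A = Suc (circles ?D ?s ?L A)"
      using circles_delete[OF A' assms(1)] assms(3) by simp
    moreover have "circles D s L (insert e (insert (s e) A)) = circles ?D ?s ?L A"
      using circles_contract[OF A' assms(1,2)] contract_eq_delete[OF assms(3,2)] Lse by simp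
    ultimately show ?thesis
      using del.pieces_le_circles[OF A] by (simp add: p Suc_diff_le algebra_simps)
  qed
  then show ?thesis
    unfolding state_sum_def sum_smoothings[OF assms(1,2)] by (simp add: sum_distrib_left)
qed

lemma state_sum_split:
  assumes "e \<in> D" "s e \<noteq> e" "L e \<noteq> e" "L (s e) \<noteq> e"
  shows "state_sum x D s L =
    (\<Sum>A\<in>smoothings (D - {e}) (perm_delete e s).
      (x - 1) ^ (circles (D - {e}) (perm_delete e s) (perm_delete e L) A - pieces D s L)) +
    (\<Sum>A\<in>smoothings (D - {e}) (perm_delete e s).
      (x - 1) ^ (circles (D - {e}) (perm_delete e s)
        (perm_delete e (L \<circ> s) \<circ> perm_delete e s) A - pieces D s L))"
  unfolding state_sum_def sum_smoothings[OF assms(1,2)] sum.distrib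
  by (intro arg_cong2[where f = plus] sum.cong refl)
     (use circles_delete circles_contract assms in \<open>auto simp: smoothings_delete\<close>)

lemma pieces_contract:
  "pieces (D - {e}) (perm_delete e s) (perm_delete e (L \<circ> s) \<circ> perm_delete e s) =
     pieces (D - {e}) (perm_delete e s) (perm_delete e (L \<circ> s))"
  using half_edge_map.pieces_dual[OF half_edge_map.delete[OF dual]] .

lemma state_sum_contract:
  "state_sum x (D - {e}) (perm_delete e s) (perm_delete e (L \<circ> s) \<circ> perm_delete e s) =
     state_sum x (D - {e}) (perm_delete e s) (perm_delete e (L \<circ> s))"
  using half_edge_map.state_sum_dual[OF half_edge_map.delete[OF dual]] .

lemma pieces_contract_linked:
  assumes "e \<in> D" "L (s e) \<noteq> e" "\<not> linked (gr L) e (s e)"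
  shows "pieces (D - {e}) (perm_delete e s) (perm_delete e (L \<circ> s) \<circ> perm_delete e s) =
     pieces D s L"
proof -
  have "linked (gr (L \<circ> s) \<union> gr (perm_delete e s)) e (s e)"
    using half_edge_map.linked_without_swap[OF dual] assms(3) by (simp add: Ls_s)
  then show ?thesis
    using half_edge_map.pieces_delete_linked[OF dual assms(1)] assms(2)
    by (simp add: pieces_contract pieces_dual)
qed

text \<open>The halves of \<open>e\<close> lie on different cycles of both \<open>L\<close> and
  \<open>L \<circ> s\<close>, so neither reduction changes the number of pieces, and the two parts
  of \<open>state_sum_split\<close> are already the two state sums.\<close>

theorem state_sum_ordinary:
  assumes "e \<in> D" "s e \<noteq> e" "L e \<noteq> e" "L (s e) \<noteq> e"
    and "\<not> linked (gr L) e (s e)" "\<not> linked (gr (L \<circ> s)) e (s e)"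
  shows "state_sum x D s L = state_sum x (D - {e}) (perm_delete e s) (perm_delete e L) +
    state_sum x (D - {e}) (perm_delete e s) (perm_delete e (L \<circ> s) \<circ> perm_delete e s)"
  unfolding state_sum_split[OF assms(1-4)]
  unfolding state_sum_def pieces_contract_linked[OF assms(1,4,5)]
    pieces_delete_linked[OF assms(1) linked_without_swap[OF assms(6)] assms(3)] ..

text \<open>The largest smoothing avoiding \<open>e\<close>; at this smoothing
  \<open>planar_half\<close> speaks about the map with the edge of \<open>e\<close> deleted.\<close>

lemma swap_on_nonfixed:
  assumes "e \<in> D"
  shows "{a\<in>D. s a \<noteq> a} - {e, s e} \<in> smoothings D s"
    and "swap_on s ({a\<in>D. s a \<noteq> a} - {e, s e}) = perm_delete e s"
proof -
  show "{a\<in>D. s a \<noteq> a} - {e, s e} \<in> smoothings D s"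
    unfolding smoothings_def by auto
  show "swap_on s ({a\<in>D. s a \<noteq> a} - {e, s e}) = perm_delete e s"
    using permutes_not_in[OF s_perm] by (auto simp: fun_eq_iff swap_on_def s_delete)
qed

text \<open>An edge with the same face on both sides is a bridge. Its deletion splits that face,
  whereas planarity would keep its two halves on one curve if they remained connected.\<close>

lemma planar_not_linked:
  assumes "e \<in> D" "s e \<noteq> e" "planar_half D s L" "linked (gr (L \<circ> s)) e (s e)"
  shows "\<not> linked (gr L \<union> gr (perm_delete e s)) e (s e)"
proof
  assume "linked (gr L \<union> gr (perm_delete e s)) e (s e)"
  then have "linked (gr (L \<circ> perm_delete e s)) e (s e)"
    using assms(1,3) swap_on_nonfixed(1)[OF assms(1)]
    unfolding planar_half_def swap_on_nonfixed(2)[OF assms(1), symmetric] by blast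
  moreover have "\<not> linked (gr (L \<circ> perm_delete e s)) e (s e)"
    using transpose_split[OF fin half_edge_map.L_perm[OF dual] _ assms(4)] assms(2)
    by (simp add: s_delete_transpose comp_assoc)
  ultimately show False by contradiction
qed

text \<open>Here \<open>e\<close> is a bridge. In every state its halves lie on different curves
  that the swap merges, so deletion has one circle more than contraction. It also has one piece
  more, so both minors have the same sum, and relative to the pieces of the original map the two
  exponents again differ by one.\<close>

theorem state_sum_semiloop:
  assumes "e \<in> D" "s e \<noteq> e" "L e \<noteq> e" "L (s e) \<noteq> e"
    and "planar_half D s L" "linked (gr (L \<circ> s)) e (s e)"
  shows "state_sum x D s L = x * state_sum x (D - {e}) (perm_delete e s) (perm_delete e L)"
    and "state_sum x D s L =
      x * state_sum x (D - {e}) (perm_delete e s) (perm_delete e (L \<circ> s) \<circ> perm_delete e s)"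
proof -
  let ?D = "D - {e}" and ?s = "perm_delete e s" and ?L = "perm_delete e L"
  let ?M = "perm_delete e (L \<circ> s) \<circ> perm_delete e s"
  interpret del: half_edge_map ?D ?s ?L by (rule delete)
  have nl: "\<not> linked (gr L \<union> gr ?s) e (s e)"
    by (rule planar_not_linked[OF assms(1,2,5,6)])
  have "pieces ?D ?s ?L = Suc (pieces D s L)"
    using pieces_delete_not_linked[OF assms(1) nl] ncls_without_swap[OF assms(1)] assms(3) by simp
  moreover have "\<not> linked (gr L) e (s e)"
    using nl linked_mono[of "gr L" e "s e" "gr L \<union> gr ?s", OF _ linked_base] by blast
  then have pM: "pieces ?D ?s ?M = pieces D s L"
    by (rule pieces_contract_linked[OF assms(1,4)])
  moreover have c: "circles ?D ?s ?L A = Suc (circles ?D ?s ?M A)" if A: "A \<in> smoothings ?D ?s" for A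
  proof -
    have A': "A \<in> smoothings D s" "e \<notin> A" using A by (auto simp: smoothings_delete)
    have "\<not> linked (gr (L \<circ> swap_on s A)) e (s e)"
    proof
      assume "linked (gr (L \<circ> swap_on s A)) e (s e)"
      moreover have "linked (gr L \<union> gr ?s) a (swap_on s A a)" for a
        using swap_on_delete[OF A'] linked_gr_Un2[of "gr L" ?s]
        by (metis linked_refl swap_on_def)
      ultimately show False using nl linked_comp_swap_on by blast
    qed
    then have "circles D s L A = Suc (circles D s L (insert e (insert (s e) A)))"
      using ncls_transpose_merge[OF fin state_permutes[OF A'(1)]] assms(1)
      by (simp add: circles_def state_insert[OF A'])
    then show ?thesis
      using circles_delete[OF A' assms(1)] circles_contract[OF A' assms(1,2)] assms(3,4) by simp
  qed
  ultimately have eq: "circles ?D ?s ?L A - pieces ?D ?s ?L = circles ?D ?s ?M A - pieces ?D ?s ?M"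
    if "A \<in> smoothings ?D ?s" for A
    using that by simp
  then have same: "state_sum x ?D ?s ?L = state_sum x ?D ?s ?M"
    unfolding state_sum_def by simp
  have "circles ?D ?s ?M A \<ge> pieces D s L" if "A \<in> smoothings ?D ?s" for A
    using half_edge_map.pieces_le_circles[OF contract that] pM by simp
  then show "state_sum x D s L = x * state_sum x ?D ?s ?M"
    unfolding state_sum_split[OF assms(1-4)] unfolding state_sum_def pM
    by (simp add: c Suc_diff_le sum_distrib_left sum.distrib[symmetric] algebra_simps)
  with same show "state_sum x D s L = x * state_sum x ?D ?s ?L" by simp
qed

section \<open>Planarity of minors\<close>

lemma planar_half_delete:
  assumes "planar_half D s L"
  shows "planar_half (D - {e}) (perm_delete e s) (perm_delete e L)"
  unfolding planar_half_def
proof (intro ballI impI)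
  fix A a
  assume A: "A \<in> smoothings (D - {e}) (perm_delete e s)" and a: "a \<in> D - {e} - A"
    and l: "linked (gr (perm_delete e L) \<union> gr (swap_on (perm_delete e s) A)) a (perm_delete e s a)"
  have A': "A \<in> smoothings D s" "e \<notin> A" using A by (auto simp: smoothings_delete)
  have "s e \<notin> A" using A' smoothing_s by blast
  have eq: "swap_on (perm_delete e s) A = swap_on s A" by (rule swap_on_delete[OF A'])
  show "linked (gr (perm_delete e L \<circ> swap_on (perm_delete e s) A)) a (perm_delete e s a)"
  proof (cases "a = s e")
    case False
    then have sa: "perm_delete e s a = s a" "s a \<noteq> e" "a \<noteq> e"
      using a by (auto simp: s_delete)
    have t: "\<And>u v. (u, v) \<in> gr (swap_on s A) \<Longrightarrow> u \<noteq> v \<Longrightarrow> u \<noteq> e \<and> v \<noteq> e"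
      using gr_swap_on_nonfixed[of _ _ s A] A' smoothing_s by metis
    have "linked (gr L \<union> gr (swap_on s A)) a (s a)"
      using l linked_perm_delete[OF permutes_inj[OF L_perm] sa(3,2) t] by (simp add: sa eq)
    then have "linked (gr (L \<circ> swap_on s A)) a (s a)"
      using assms A' a unfolding planar_half_def by blast
    then show ?thesis
      using linked_perm_delete'[OF permutes_inj[OF state_permutes[OF A'(1)]] sa(3,2)]
      by (simp add: eq sa state_delete[OF A'])
  qed (simp add: s_delete)
qed

text \<open>A state \<open>A\<close> of the contraction comes from the state \<open>?B\<close> of
  the given map, and every link in the contraction uses only steps that \<open>?B\<close> provides.
  For the former partner of \<open>e\<close>, now a fixed point, nothing is to be shown.\<close>

lemma planar_half_contract:
  assumes "planar_half D s L" "e \<in> D" "s e \<noteq> e"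
  shows "planar_half (D - {e}) (perm_delete e s) (perm_delete e (L \<circ> s) \<circ> perm_delete e s)"
  unfolding planar_half_def
proof (intro ballI impI)
  let ?M = "perm_delete e (L \<circ> s) \<circ> perm_delete e s"
  fix A a
  assume A: "A \<in> smoothings (D - {e}) (perm_delete e s)" and a: "a \<in> D - {e} - A"
    and l: "linked (gr ?M \<union> gr (swap_on (perm_delete e s) A)) a (perm_delete e s a)"
  let ?B = "insert e (insert (s e) A)"
  have A': "A \<in> smoothings D s" "e \<notin> A" using A by (auto simp: smoothings_delete)
  have B: "?B \<in> smoothings D s" by (rule insert_smoothing[OF A'(1) assms(2,3)])
  have eq: "swap_on (perm_delete e s) A = swap_on s A" by (rule swap_on_delete[OF A'])
  \<comment> \<open>The instance \<open>A = {}\<close> of \<open>state_contract\<close>: one step of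
    the contracted rotation is a step of the state swapping only \<open>e\<close>, with
    \<open>e\<close> skipped.\<close>
  have M: "?M = perm_delete e (L \<circ> swap_on s {e, s e})"
    using state_contract[of "{}" e] by (simp add: smoothings_def swap_on_def[of s "{}"] comp_def)
  show "linked (gr (?M \<circ> swap_on (perm_delete e s) A)) a (perm_delete e s a)"
  proof (cases "a = s e")
    case False
    then have sa: "perm_delete e s a = s a" "s a \<noteq> e" "a \<noteq> e"
      using a by (auto simp: s_delete)
    have sw: "linked (gr L \<union> gr (swap_on s ?B)) u (swap_on s C u)" if "C \<subseteq> ?B" for C u
      using that linked_gr_Un2[of "gr L" "swap_on s ?B" u]
      by (auto simp: swap_on_def)
    have "linked (gr L \<union> gr (swap_on s ?B)) a (s a)"
      using l unfolding sa eq
    proof (rule linked_mono)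
      fix u v assume "(u, v) \<in> gr ?M \<union> gr (swap_on s A)"
      then consider "v = ?M u" | "v = swap_on s A u" unfolding gr_def by blast
      then show "linked (gr L \<union> gr (swap_on s ?B)) u v"
      proof cases
        case 1
        show ?thesis
          unfolding 1 M by (rule linked_comp_swap_on[OF linked_perm_delete_self sw]) auto
      next
        case 2
        show ?thesis unfolding 2 by (rule sw) auto
      qed
    qed
    then have "linked (gr (L \<circ> swap_on s ?B)) a (s a)"
      using assms(1) B a False unfolding planar_half_def by blast
    then show ?thesis
      using linked_perm_delete'[OF permutes_inj[OF state_permutes[OF B]] sa(3,2)]
      by (simp add: eq sa state_contract[OF A'])
  qed (simp add: s_delete)
qed

lemma planar_map_dual: "planar_map D s L \<Longrightarrow> planar_map D s (L \<circ> s)"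
  by (simp add: planar_map_def Ls_s)

text \<open>The dual of a deletion is a contraction of the dual, which explains the use of both
  inheritance lemmas. If \<open>s\<close> fixes \<open>e\<close>, deletion commutes with
  dualising.\<close>

lemma planar_map_delete:
  assumes "planar_map D s L" "e \<in> D"
  shows "planar_map (D - {e}) (perm_delete e s) (perm_delete e L)"
proof (cases "s e = e")
  case True
  then have "perm_delete e s = s" by (auto simp: fun_eq_iff s_delete)
  moreover have "perm_delete e L \<circ> s = perm_delete e (L \<circ> s)"
    using True by (auto simp: fun_eq_iff perm_delete_def)
  ultimately show ?thesis
    using assms planar_half_delete[of e] half_edge_map.planar_half_delete[OF dual, of e]
    by (auto simp: planar_map_def)
next
  case False
  then show ?thesis
    using assms planar_half_delete[of e] half_edge_map.planar_half_contract[OF dual, of e]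
    by (auto simp: planar_map_def Ls_s)
qed

lemma planar_map_contract:
  assumes "planar_map D s L" "e \<in> D"
  shows "planar_map (D - {e}) (perm_delete e s) (perm_delete e (L \<circ> s) \<circ> perm_delete e s)"
  by (rule half_edge_map.planar_map_dual[OF half_edge_map.delete[OF dual]
        half_edge_map.planar_map_delete[OF dual planar_map_dual[OF assms(1)] assms(2)]])

text \<open>The previous theorem for the dual map, where deletion and contraction trade
  places.\<close>

theorem state_sum_semiloop_dual:
  assumes "e \<in> D" "s e \<noteq> e" "L e \<noteq> e" "L (s e) \<noteq> e"
    and "planar_half D s (L \<circ> s)" "linked (gr L) e (s e)"
  shows "state_sum x D s L = x * state_sum x (D - {e}) (perm_delete e s) (perm_delete e L)"
    and "state_sum x D s L =
      x * state_sum x (D - {e}) (perm_delete e s) (perm_delete e (L \<circ> s) \<circ> perm_delete e s)"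
proof -
  have "L (s (s e)) \<noteq> e" "linked (gr (L \<circ> s \<circ> s)) e (s e)"
    using assms(3,6) by (simp_all add: Ls_s)
  then have "(L \<circ> s) e \<noteq> e" "(L \<circ> s) (s e) \<noteq> e" "linked (gr (L \<circ> s \<circ> s)) e (s e)"
    using assms(4) by simp_all
  note * = half_edge_map.state_sum_semiloop[OF dual assms(1,2) this(1,2) assms(5) this(3), of x]
  show "state_sum x D s L = x * state_sum x (D - {e}) (perm_delete e s) (perm_delete e L)"
    using *(2) half_edge_map.state_sum_dual[OF delete, of x e] by (simp add: Ls_s state_sum_dual)
  show "state_sum x D s L =
      x * state_sum x (D - {e}) (perm_delete e s) (perm_delete e (L \<circ> s) \<circ> perm_delete e s)"
    using *(1) by (simp add: state_sum_contract state_sum_dual)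
qed

text \<open>Four times the genus of the ribbon subgraph with set \<open>A\<close> of half-edges; it grows with \<open>A\<close>, so it
  vanishes for all \<open>A\<close> if it does for \<open>A = D\<close>.\<close>

definition defect :: "'a set \<Rightarrow> int" where
  "defect A = 4 * int (ncls D (gr L \<union> gr (swap_on s A))) + int (card A)
     - 2 * int (ncls D (gr L)) - 2 * int (circles D s L A)"

text \<open>A new edge joins two components and merges their circles, or splits a circle, or runs
  between two circles of one component. Only the last case adds a handle, which counts 4.\<close>

lemma defect_insert:
  assumes A: "A \<in> smoothings D s" and e: "e \<in> D - A" "s e \<noteq> e"
  shows "defect (insert e (insert (s e) A)) = defect A +
    (if linked (gr L \<union> gr (swap_on s A)) e (s e) \<and> \<not> linked (gr (L \<circ> swap_on s A)) e (s e)
     then 4 else 0)"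
proof -
  let ?B = "insert e (insert (s e) A)"
  let ?r = "gr L \<union> gr (swap_on s A)"
  have se: "s e \<in> D" "s e \<notin> A" using e smoothing_s[OF A] by auto
  have "finite A" using A fin finite_subset unfolding smoothings_def by blast
  then have card: "card ?B = card A + 2" using e se by simp
  have "ncls D (gr L \<union> gr (swap_on s ?B)) = ncls D (insert (e, s e) ?r)"
  proof (rule ncls_eqI)
    fix u v assume "(u, v) \<in> gr L \<union> gr (swap_on s ?B)"
    then have "v = L u \<or> v = swap_on s ?B u" by (auto simp: gr_def)
    then consider "v = L u" | "v = swap_on s A u" | "u = e" "v = s e" | "u = s e" "v = e"
      unfolding swap_on_def by (cases "u = e"; cases "u = s e") auto
    then show "linked (insert (e, s e) ?r) u v"
      by cases (auto intro: linked_base linked_sym simp: gr_def)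
  next
    fix u v assume "(u, v) \<in> insert (e, s e) ?r"
    then have "v = L u \<or> v = swap_on s ?B u \<or> v = u"
      by (auto simp: gr_def swap_on_def)
    then show "linked (gr L \<union> gr (swap_on s ?B)) u v"
      using linked_gr_Un linked_gr_Un2 linked_refl by metis
  qed
  then have k: "ncls D (gr L \<union> gr (swap_on s A)) =
      (if linked ?r e (s e) then ncls D (gr L \<union> gr (swap_on s ?B))
       else Suc (ncls D (gr L \<union> gr (swap_on s ?B))))"
    using ncls_insert_linked[of ?r e "s e"] ncls_insert_not_linked[of D e "s e" ?r] fin e(1) se
    by simp
  have "circles D s L ?B = ncls D (gr (L \<circ> swap_on s A \<circ> transpose e (s e)))"
    using state_insert[OF A, of e] e by (simp add: circles_def)
  then have c: "int (circles D s L ?B) = int (circles D s L A) +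
      (if linked (gr (L \<circ> swap_on s A)) e (s e) then 1 else - 1)"
    using ncls_transpose_merge[OF fin state_permutes[OF A], of e "s e"]
      ncls_transpose_split[OF fin state_permutes[OF A], of e "s e"] e se
    by (simp add: circles_def[of D s L A])
  have sub: "linked (gr (L \<circ> swap_on s A)) e (s e) \<Longrightarrow> linked ?r e (s e)"
    by (rule linked_comp_swap_on[OF _ linked_gr_Un2])
  show ?thesis
    unfolding defect_def c card k
    by (cases "linked (gr (L \<circ> swap_on s A)) e (s e)"; cases "linked ?r e (s e)") (simp_all add: sub)
qed

lemma defect_empty: "defect {} = 0"
proof -
  have "swap_on s {} = id" by (simp add: swap_on_def fun_eq_iff)
  moreover have "ncls D (gr L \<union> gr id) = ncls D (gr L)"
    by (rule ncls_eqI) (auto intro: linked_base simp: gr_def)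
  ultimately show ?thesis by (simp add: defect_def circles_def)
qed

lemma defect_nonneg: "A \<in> smoothings D s \<Longrightarrow> 0 \<le> defect A"
proof (induction "card A" arbitrary: A rule: less_induct)
  case less
  have "finite A" using less.prems fin finite_subset unfolding smoothings_def by blast
  show ?case
  proof (cases "A = {}")
    case False
    then obtain e where e: "e \<in> A" by blast
    let ?A = "A - {e, s e}"
    have A: "?A \<in> smoothings D s"
      using less.prems unfolding smoothings_def by auto
    have "card ?A < card A" using e \<open>finite A\<close> by (intro psubset_card_mono) auto
    then have "0 \<le> defect ?A" using A less.hyps by blast
    moreover have "insert e (insert (s e) ?A) = A" using e smoothing_s[OF less.prems] by auto
    moreover have "e \<in> D - ?A" "s e \<noteq> e"
      using e smoothing_subset[OF less.prems] smoothing_nonfixed[OF less.prems] by auto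
    ultimately show ?thesis using defect_insert[OF A, of e] by (auto split: if_splits)
  qed (simp add: defect_empty)
qed

text \<open>Missing edges are inserted one by one; since \<open>s\<close> has no fixed point in
  \<open>D\<close>, this ends at \<open>D\<close> itself.\<close>

lemma defect_le_full:
  assumes "\<And>a. a \<in> D \<Longrightarrow> s a \<noteq> a" "A \<in> smoothings D s"
  shows "defect A \<le> defect D"
  using assms(2)
proof (induction "card (D - A)" arbitrary: A rule: less_induct)
  case less
  show ?case
  proof (cases "D \<subseteq> A")
    case False
    then obtain e where e: "e \<in> D" "e \<notin> A" by blast
    let ?B = "insert e (insert (s e) A)"
    have "?B \<in> smoothings D s" using insert_smoothing less.prems e assms(1) by blast
    moreover have "card (D - ?B) < card (D - A)" using e fin by (intro psubset_card_mono) auto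
    ultimately have "defect ?B \<le> defect D" using less.hyps by blast
    then show ?thesis using defect_insert[OF less.prems, of e] e assms(1) by (auto split: if_splits)
  next
    case True
    then have "A = D" using less.prems by (auto simp: smoothings_def)
    then show ?thesis by simp
  qed
qed

lemma swap_on_full: "swap_on s D = s"
  using permutes_not_in[OF s_perm] by (auto simp: fun_eq_iff swap_on_def)

text \<open>Hypothesis and conclusion are V - E + F = 2k, multiplied by 2 so that half-edges can be
  counted in place of edges. The defect is nonnegative and bounded by that of \<open>D\<close>,
  hence zero for each \<open>A\<close>.\<close>

lemma euler_circles:
  assumes "\<And>a. a \<in> D \<Longrightarrow> s a \<noteq> a"
    and "2 * ncls D (gr L) + 2 * ncls D (gr (L \<circ> s)) = 4 * pieces D s L + card D"
    and "A \<in> smoothings D s"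
  shows "2 * circles D s L A + 2 * ncls D (gr L) = 4 * ncls D (gr L \<union> gr (swap_on s A)) + card A"
proof -
  have "defect D = 0"
    using assms(2) unfolding defect_def circles_def swap_on_full pieces_def by linarith
  then have "defect A = 0"
    using defect_nonneg[OF assms(3)] defect_le_full[OF assms(1,3)] by simp
  then show ?thesis unfolding defect_def by linarith
qed

lemma euler_planar_half:
  assumes "\<And>a. a \<in> D \<Longrightarrow> s a \<noteq> a"
    and "2 * ncls D (gr L) + 2 * ncls D (gr (L \<circ> s)) = 4 * pieces D s L + card D"
  shows "planar_half D s L"
  unfolding planar_half_def
proof (intro ballI impI)
  fix A e
  assume A: "A \<in> smoothings D s" and e: "e \<in> D - A"
    and l: "linked (gr L \<union> gr (swap_on s A)) e (s e)"
  have "insert e (insert (s e) A) \<in> smoothings D s"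
    using insert_smoothing[OF A] e assms(1) by blast
  from euler_circles[OF assms this] euler_circles[OF assms A]
  have "defect (insert e (insert (s e) A)) = defect A"
    unfolding defect_def by linarith
  then show "linked (gr (L \<circ> swap_on s A)) e (s e)"
    using defect_insert[OF A e] l e assms(1) by (auto split: if_splits)
qed

theorem euler_planar_map:
  assumes "\<And>a. a \<in> D \<Longrightarrow> s a \<noteq> a"
    and "2 * ncls D (gr L) + 2 * ncls D (gr (L \<circ> s)) = 4 * pieces D s L + card D"
  shows "planar_map D s L"
  unfolding planar_map_def
proof
  show "planar_half D s L" by (rule euler_planar_half[OF assms])
  show "planar_half D s (L \<circ> s)"
    using half_edge_map.euler_planar_half[OF dual assms(1)] assms(2)
    by (simp add: Ls_s pieces_dual)
qed

end

section \<open>The rank generating sum of a graph\<close>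

definition adj_rel :: "('v, 'e) ugraph \<Rightarrow> 'e set \<Rightarrow> ('v \<times> 'v) set" where
  "adj_rel G A = {(u, v). \<exists>e\<in>A. u \<in> ends G e \<and> v \<in> ends G e}"

definition comps :: "('v, 'e) ugraph \<Rightarrow> 'e set \<Rightarrow> nat" where
  "comps G A = ncls (verts G) (adj_rel G A)"

definition wf_ugraph :: "('v, 'e) ugraph \<Rightarrow> bool" where
  "wf_ugraph G \<longleftrightarrow> finite (verts G) \<and> finite (edges G) \<and>
     (\<forall>e\<in>edges G. ends G e \<subseteq> verts G \<and> (card (ends G e) = 1 \<or> card (ends G e) = 2))"

text \<open>The exponents are the rank defect and the nullity of \<open>A\<close>. On a well-formed
  graph neither subtraction truncates, by \<open>comps_antimono\<close> and
  \<open>card_verts_le\<close>.\<close>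

definition rank_sum :: "'r::comm_ring_1 \<Rightarrow> 'r \<Rightarrow> ('v, 'e) ugraph \<Rightarrow> 'r" where
  "rank_sum x y G = (\<Sum>A\<in>Pow (edges G).
     (x - 1) ^ (comps G A - comps G (edges G)) *
     (y - 1) ^ (card A + comps G A - card (verts G)))"

lemma num_components_eq: "num_components G = comps G (edges G)"
proof -
  have adj: "adjacency G = adj_rel G (edges G)"
    by (simp add: adjacency_def adj_rel_def)
  have "adj_rel G (edges G) \<union> (adj_rel G (edges G))\<inverse> = adj_rel G (edges G)"
    by (auto simp: adj_rel_def)
  then have l: "linked (adj_rel G (edges G)) u v \<longleftrightarrow> (u, v) \<in> (adjacency G)\<^sup>*" for u v
    by (simp add: linked_def adj)
  let ?r = "(adjacency G)\<^sup>* \<inter> verts G \<times> verts G"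
  have "verts G // ?r = (\<lambda>u. ?r `` {u}) ` verts G"
    by (auto simp: quotient_def)
  moreover have "card ((\<lambda>u. ?r `` {u}) ` verts G) =
      card ((\<lambda>u. {v. linked (adj_rel G (edges G)) u v}) ` (\<lambda>u. u) ` verts G)"
  proof (rule card_image_cong_kernel)
    fix u v assume uv: "u \<in> verts G" "v \<in> verts G"
    have "?r `` {u} = ?r `` {v} \<longleftrightarrow> linked (adj_rel G (edges G)) u v"
    proof
      assume "?r `` {u} = ?r `` {v}"
      moreover have "v \<in> ?r `` {v}" using uv by auto
      ultimately show "linked (adj_rel G (edges G)) u v" by (auto simp: l)
    next
      assume "linked (adj_rel G (edges G)) u v"
      then show "?r `` {u} = ?r `` {v}"
        using uv cls_eq_iff[of "adj_rel G (edges G)" u v] unfolding l by blast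
    qed
    then show "?r `` {u} = ?r `` {v} \<longleftrightarrow>
        {w. linked (adj_rel G (edges G)) u w} = {w. linked (adj_rel G (edges G)) v w}"
      by (simp only: cls_eq_iff)
  qed
  ultimately show ?thesis by (simp add: num_components_def comps_def ncls_def)
qed

lemma adj_rel_delete: "adj_rel (delete_edge G e) A = adj_rel G A"
  by (simp add: adj_rel_def delete_edge_def)

lemma comps_delete: "comps (delete_edge G e) A = comps G A"
  by (simp add: comps_def adj_rel_delete) (simp add: delete_edge_def)

lemma comps_insert_eq:
  assumes "ends G e = {u, v}"
  shows "comps G (insert e A) = ncls (verts G) (insert (u, v) (adj_rel G A))"
  unfolding comps_def
proof (rule ncls_eqI)
  fix a b assume "(a, b) \<in> adj_rel G (insert e A)"
  then consider "(a, b) \<in> adj_rel G A" | "a \<in> {u, v}" "b \<in> {u, v}"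
    using assms by (auto simp: adj_rel_def)
  then show "linked (insert (u, v) (adj_rel G A)) a b"
    by cases (auto intro: linked_base linked_sym)
qed (use assms in \<open>auto intro!: linked_base simp: adj_rel_def\<close>)

lemma ends_cases:
  assumes "wf_ugraph G" "e \<in> edges G"
  obtains u v where "ends G e = {u, v}" "u \<in> verts G" "v \<in> verts G"
    "card (ends G e) = 1 \<longleftrightarrow> u = v"
proof -
  from assms consider "card (ends G e) = 1" | "card (ends G e) = 2" by (auto simp: wf_ugraph_def)
  then obtain u v where "ends G e = {u, v}" "card (ends G e) = 1 \<longleftrightarrow> u = v"
  proof cases
    case 1
    then obtain u where "ends G e = {u}" by (auto simp: card_1_singleton_iff)
    then show ?thesis using that[of u u] 1 by simp
  next
    case 2
    then obtain u v where "ends G e = {u, v}" "u \<noteq> v" by (auto simp: card_2_iff)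
    then show ?thesis using that[of u v] 2 by simp
  qed
  then show ?thesis using assms that[of u v] by (auto simp: wf_ugraph_def)
qed

lemma comps_insert:
  assumes "wf_ugraph G" "ends G e = {u, v}" "u \<in> verts G" "v \<in> verts G"
  shows "comps G A = (if linked (adj_rel G A) u v then comps G (insert e A)
    else Suc (comps G (insert e A)))"
  using ncls_insert_linked[of "adj_rel G A" u v] ncls_insert_not_linked[of "verts G" u v "adj_rel G A"]
    assms(1,3,4) unfolding comps_insert_eq[OF assms(2)] by (simp add: wf_ugraph_def comps_def)

lemma comps_empty:
  fixes G :: "('v, 'e) ugraph"
  shows "comps G {} = card (verts G)"
proof -
  have "linked {} u v \<longleftrightarrow> u = v" for u v :: 'v by (simp add: linked_def)
  then show ?thesis by (simp add: comps_def ncls_def adj_rel_def card_image inj_on_def)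
qed

text \<open>The nullity is nonnegative, because each edge lowers the number of components by at most
  one.\<close>

lemma card_verts_le:
  assumes "wf_ugraph G" "A \<subseteq> edges G"
  shows "card (verts G) \<le> card A + comps G A"
proof -
  have "finite A" using assms finite_subset unfolding wf_ugraph_def by blast
  then show ?thesis using assms(2)
  proof (induction A)
    case (insert e A)
    have "e \<in> edges G" using insert.prems by simp
    then obtain u v where "ends G e = {u, v}" "u \<in> verts G" "v \<in> verts G"
      using ends_cases[OF assms(1), of e] by blast
    from comps_insert[OF assms(1) this, of A] have "comps G A \<le> Suc (comps G (insert e A))"
      by (simp split: if_splits)
    then show ?case using insert by simp
  qed (simp add: comps_empty)
qed

lemma adj_rel_mono: "A \<subseteq> B \<Longrightarrow> adj_rel G A \<subseteq> adj_rel G B"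
  by (auto simp: adj_rel_def)

lemma comps_antimono:
  assumes "wf_ugraph G" "A \<subseteq> B"
  shows "comps G B \<le> comps G A"
  unfolding comps_def
proof (rule ncls_antimono)
  show "finite (verts G)" using assms(1) by (simp add: wf_ugraph_def)
  show "linked (adj_rel G B) u v" if "(u, v) \<in> adj_rel G A" for u v
    using that assms(2) by (intro linked_base) (auto simp: adj_rel_def)
qed

lemma sum_Pow_insert:
  assumes "finite E" "e \<in> E"
  shows "(\<Sum>A\<in>Pow E. f A) = (\<Sum>A\<in>Pow (E - {e}). f A + f (insert e A))"
proof -
  have "Pow E = Pow (E - {e}) \<union> insert e ` Pow (E - {e})"
    using assms(2) Pow_insert[of e "E - {e}"] by (simp add: insert_absorb)
  moreover have "Pow (E - {e}) \<inter> insert e ` Pow (E - {e}) = {}" by auto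
  moreover have "inj_on (insert e) (Pow (E - {e}))" by (auto simp: inj_on_def)
  ultimately show ?thesis
    using assms(1) by (simp add: sum.union_disjoint sum.reindex sum.distrib)
qed

text \<open>Inserting \<open>e\<close> into any \<open>A\<close> joins two components, so it keeps
  the nullity and lowers the rank defect by one. The defect in the graph without \<open>e\<close> is
  measured from one more component, which leaves the factor (x - 1) + 1.\<close>

lemma rank_sum_coloop:
  assumes wf: "wf_ugraph G" and e: "e \<in> edges G" and "is_coloop G e"
  shows "rank_sum x y G = x * rank_sum x y (delete_edge G e)"
proof -
  let ?E = "edges G - {e}"
  obtain u v where uv: "ends G e = {u, v}" "u \<in> verts G" "v \<in> verts G"
    using ends_cases[OF wf e] by blast
  note ins = comps_insert[OF wf uv]
  have E: "insert e ?E = edges G" using e by auto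
  have "comps G (edges G) < comps G ?E"
    using assms(3) by (simp add: is_coloop_def num_components_eq comps_delete)
      (simp add: delete_edge_def)
  then have nl: "\<not> linked (adj_rel G ?E) u v" and cE: "comps G ?E = Suc (comps G (edges G))"
    using ins[of ?E] E by (auto split: if_splits)
  have summand: "(x - 1) ^ (comps G A - comps G (edges G)) *
       (y - 1) ^ (card A + comps G A - card (verts G)) +
      (x - 1) ^ (comps G (insert e A) - comps G (edges G)) *
       (y - 1) ^ (card (insert e A) + comps G (insert e A) - card (verts G)) =
      x * ((x - 1) ^ (comps G A - comps G ?E) * (y - 1) ^ (card A + comps G A - card (verts G)))"
    if A: "A \<in> Pow ?E" for A
  proof -
    have "\<not> linked (adj_rel G A) u v"
      using nl linked_mono[of "adj_rel G A" u v "adj_rel G ?E"] adj_rel_mono[of A ?E G] A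
      by (auto intro: linked_base)
    then have c: "comps G A = Suc (comps G (insert e A))" using ins[of A] by simp
    moreover have "comps G ?E \<le> comps G A" using A comps_antimono[OF wf] by auto
    moreover have "card (insert e A) = Suc (card A)"
      using A wf finite_subset[of A "edges G"] by (subst card_insert_disjoint) (auto simp: wf_ugraph_def)
    moreover have "comps G A - comps G (edges G) = Suc (comps G A - comps G ?E)"
      using calculation cE by simp
    moreover have "comps G (insert e A) - comps G (edges G) = comps G A - comps G ?E"
      using calculation cE by simp
    ultimately show ?thesis by (simp add: algebra_simps)
  qed
  have fin: "finite (edges G)" using wf by (simp add: wf_ugraph_def)
  have "rank_sum x y (delete_edge G e) = (\<Sum>A\<in>Pow ?E.
      (x - 1) ^ (comps G A - comps G ?E) * (y - 1) ^ (card A + comps G A - card (verts G)))"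
    by (simp add: rank_sum_def comps_delete) (simp add: delete_edge_def)
  then show ?thesis
    unfolding rank_sum_def[of _ _ G] sum_Pow_insert[OF fin e] sum_distrib_left
    by (simp only:) (rule trans[OF sum.cong[OF refl summand]], auto simp: sum_distrib_left)
qed

lemma collapse_in_ends: "v \<in> ends G e \<Longrightarrow> collapse G e v \<in> ends G e"
  unfolding collapse_def by (auto intro: someI)

lemma collapse_eq: "u \<in> ends G e \<Longrightarrow> v \<in> ends G e \<Longrightarrow> collapse G e u = collapse G e v"
  unfolding collapse_def by auto

text \<open>Vertices identified by the collapse are joined by \<open>e\<close>, so the components on
  both sides correspond.\<close>

lemma comps_contract: "comps (contract_edge G e) A = comps G (insert e A)"
proof -
  let ?c = "collapse G e" and ?r = "adj_rel G (insert e A)" and ?r' = "adj_rel (contract_edge G e) A"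
  have c: "linked ?r u (?c u)" for u
  proof (cases "u \<in> ends G e")
    case True
    then show ?thesis
      using collapse_in_ends[OF True] by (intro linked_base) (auto simp: adj_rel_def)
  qed (simp add: collapse_def)
  have "linked ?r a b \<longleftrightarrow> linked ?r' (?c a) (?c b)" for a b
  proof
    assume "linked ?r a b"
    then show "linked ?r' (?c a) (?c b)"
    proof (rule linked_image)
      fix u v assume "(u, v) \<in> ?r"
      then consider "u \<in> ends G e" "v \<in> ends G e" | "(u, v) \<in> adj_rel G A"
        by (auto simp: adj_rel_def)
      then show "linked ?r' (?c u) (?c v)"
      proof cases
        case 1
        then show ?thesis using collapse_eq[OF 1] by simp
      next
        case 2
        then show ?thesis by (intro linked_base) (auto simp: adj_rel_def contract_edge_def)
      qed
    qed
  next
    assume "linked ?r' (?c a) (?c b)"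
    then have "linked ?r (?c a) (?c b)"
    proof (rule linked_mono)
      fix u v assume "(u, v) \<in> ?r'"
      then obtain w z where wz: "u = ?c w" "v = ?c z" "(w, z) \<in> ?r"
        by (auto simp: adj_rel_def contract_edge_def)
      show "linked ?r u v"
        using linked_trans[OF linked_sym[OF c[of w]] linked_trans[OF linked_base[OF wz(3)] c[of z]]]
        by (simp add: wz)
    qed
    then show "linked ?r a b"
      using linked_trans[OF c[of a] linked_trans[OF _ linked_sym[OF c[of b]]]] by blast
  qed
  then show ?thesis
    unfolding comps_def
    using ncls_image[of "verts G" ?r ?r' ?c] by (simp add: contract_edge_def)
qed

lemma rank_sum_contract:
  assumes "wf_ugraph G" "e \<in> edges G"
  shows "rank_sum x y (contract_edge G e) = (\<Sum>A\<in>Pow (edges G - {e}).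
    (x - 1) ^ (comps G (insert e A) - comps G (edges G)) *
    (y - 1) ^ (card A + comps G (insert e A) - card (collapse G e ` verts G)))"
  unfolding rank_sum_def comps_contract
  using assms(2) by (simp add: contract_edge_def insert_absorb)

lemma card_insert_edge:
  assumes "wf_ugraph G" "A \<in> Pow (edges G - {e})"
  shows "card (insert e A) = Suc (card A)"
  using assms finite_subset[of A "edges G"] by (subst card_insert_disjoint) (auto simp: wf_ugraph_def)

text \<open>Inserting a loop changes no component and raises the nullity by one, which gives 1 + (y
  - 1) = y.\<close>

lemma rank_sum_loop:
  assumes wf: "wf_ugraph G" and e: "e \<in> edges G" and l: "is_loop G e"
  shows "rank_sum x y G = y * rank_sum x y (contract_edge G e)"
proof -
  let ?E = "edges G - {e}"
  obtain u where uv: "ends G e = {u, u}" "u \<in> verts G"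
    using ends_cases[OF wf e] l unfolding is_loop_def by metis
  have fin: "finite (edges G)" using wf by (simp add: wf_ugraph_def)
  have "collapse G e w = w" for w using uv by (auto simp: collapse_def)
  then have im: "collapse G e ` verts G = verts G" by simp
  have summand: "(x - 1) ^ (comps G A - comps G (edges G)) *
       (y - 1) ^ (card A + comps G A - card (verts G)) +
      (x - 1) ^ (comps G (insert e A) - comps G (edges G)) *
       (y - 1) ^ (card (insert e A) + comps G (insert e A) - card (verts G)) =
      y * ((x - 1) ^ (comps G (insert e A) - comps G (edges G)) *
       (y - 1) ^ (card A + comps G (insert e A) - card (verts G)))"
    if A: "A \<in> Pow ?E" for A
  proof -
    have "comps G A = comps G (insert e A)" using comps_insert[OF wf uv(1,2,2)] by simp
    moreover have "card (verts G) \<le> card A + comps G A" using card_verts_le[OF wf] A by auto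
    ultimately show ?thesis
      using card_insert_edge[OF wf A] by (simp add: Suc_diff_le algebra_simps)
  qed
  show ?thesis
    unfolding rank_sum_contract[OF wf e] im unfolding rank_sum_def
    unfolding sum_Pow_insert[OF fin e] sum_distrib_left
    by (rule sum.cong[OF refl summand])
qed

lemma card_collapse:
  assumes "finite (verts G)" "ends G e = {u, v}" "u \<in> verts G" "v \<in> verts G" "u \<noteq> v"
  shows "card (verts G) = Suc (card (collapse G e ` verts G))"
proof -
  define w where "w = collapse G e u"
  have w: "w = u \<or> w = v" using collapse_in_ends[of u G e] assms(2) by (auto simp: w_def)
  have c: "collapse G e z = (if z = u \<or> z = v then w else z)" for z
    using collapse_eq[of u G e v] assms(2) by (auto simp: w_def collapse_def)
  have "collapse G e ` verts G = verts G - ({u, v} - {w})"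
    using w assms by (auto simp: c)
  moreover have "card ({u, v} - {w}) = 1" using w assms(5) by auto
  moreover have "card (verts G) > 0" using assms(1,3) by (auto simp: card_gt_0_iff)
  moreover have "card (verts G - ({u, v} - {w})) = card (verts G) - card ({u, v} - {w})"
    using assms(3,4) by (intro card_Diff_subset) auto
  ultimately show ?thesis by simp
qed

lemma rank_sum_ordinary:
  assumes wf: "wf_ugraph G" and e: "e \<in> edges G" and nl: "\<not> is_loop G e" and nc: "\<not> is_coloop G e"
  shows "rank_sum x y G = rank_sum x y (contract_edge G e) + rank_sum x y (delete_edge G e)"
proof -
  let ?E = "edges G - {e}"
  obtain u v where uv: "ends G e = {u, v}" "u \<in> verts G" "v \<in> verts G" "u \<noteq> v"
    using ends_cases[OF wf e] nl unfolding is_loop_def by metis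
  have fin: "finite (edges G)" using wf by (simp add: wf_ugraph_def)
  have V: "card (verts G) = Suc (card (collapse G e ` verts G))"
    using card_collapse[OF _ uv] wf by (simp add: wf_ugraph_def)
  have "comps G ?E \<le> comps G (edges G)"
    using nc by (simp add: is_coloop_def num_components_eq comps_delete)
      (simp add: delete_edge_def)
  then have cE: "comps G ?E = comps G (edges G)"
    using comps_antimono[OF wf, of ?E "edges G"] by auto
  have del: "rank_sum x y (delete_edge G e) = (\<Sum>A\<in>Pow ?E.
      (x - 1) ^ (comps G A - comps G ?E) * (y - 1) ^ (card A + comps G A - card (verts G)))"
    by (simp add: rank_sum_def comps_delete) (simp add: delete_edge_def)
  show ?thesis
    unfolding rank_sum_contract[OF wf e] del cE unfolding rank_sum_def
    unfolding sum_Pow_insert[OF fin e] sum.distrib[symmetric]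
    by (rule sum.cong[OF refl]) (simp add: card_insert_edge[OF wf] V add.commute)
qed

lemma wf_delete: "wf_ugraph G \<Longrightarrow> wf_ugraph (delete_edge G e)"
  by (auto simp: wf_ugraph_def delete_edge_def)

lemma wf_contract:
  assumes "wf_ugraph G"
  shows "wf_ugraph (contract_edge G e)"
  unfolding wf_ugraph_def
proof (intro conjI ballI)
  fix f assume "f \<in> edges (contract_edge G e)"
  then have f: "f \<in> edges G" by (simp add: contract_edge_def)
  obtain u v where uv: "ends G f = {u, v}" "u \<in> verts G" "v \<in> verts G"
    using ends_cases[OF assms f] by blast
  then show "ends (contract_edge G e) f \<subseteq> verts (contract_edge G e)"
    by (simp add: contract_edge_def)
  show "card (ends (contract_edge G e) f) = 1 \<or> card (ends (contract_edge G e) f) = 2"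
    by (cases "collapse G e u = collapse G e v") (simp_all add: contract_edge_def uv)
qed (use assms in \<open>auto simp: wf_ugraph_def contract_edge_def\<close>)

lemma tutte_value_rank_sum:
  assumes "tutte_value x y G t" "wf_ugraph G"
  shows "t = rank_sum x y G"
  using assms
proof (induction rule: tutte_value.induct)
  case (tutte_empty G)
  then show ?case by (simp add: rank_sum_def comps_empty)
next
  case (tutte_coloop e G t)
  then show ?case using rank_sum_coloop wf_delete by metis
next
  case (tutte_loop e G t)
  then show ?case using rank_sum_loop wf_contract by metis
next
  case (tutte_ordinary e G s t)
  then show ?case using rank_sum_ordinary wf_delete wf_contract by metis
qed

text \<open>Some rule applies at every edge. With the uniqueness just shown, this gives the
  \<open>THE\<close> in \<open>tutte\<close> its meaning.\<close>

lemma tutte_value_exists: "wf_ugraph G \<Longrightarrow> \<exists>t. tutte_value x y G t"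
proof (induction "card (edges G)" arbitrary: G rule: less_induct)
  case less
  show ?case
  proof (cases "edges G = {}")
    case False
    then obtain e where e: "e \<in> edges G" by blast
    have "card (edges G - {e}) < card (edges G)"
      using e less.prems by (intro psubset_card_mono) (auto simp: wf_ugraph_def)
    then obtain s t where "tutte_value x y (contract_edge G e) s" "tutte_value x y (delete_edge G e) t"
      using less.hyps[of "contract_edge G e"] less.hyps[of "delete_edge G e"]
        wf_delete[OF less.prems] wf_contract[OF less.prems]
      by (auto simp: contract_edge_def delete_edge_def)
    then show ?thesis
      using e tutte_value.intros(2-4) by metis
  qed (auto intro: tutte_empty)
qed

theorem tutte_eq_rank_sum: "wf_ugraph G \<Longrightarrow> tutte G x y = rank_sum x y G"
  unfolding tutte_def using tutte_value_rank_sum tutte_value_exists by (metis the_equality)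

section \<open>Semiloops\<close>

text \<open>Along a \<open>p\<close>-cycle that avoids \<open>Y\<close>, the permutation
  \<open>q\<close> takes the same steps.\<close>

lemma ncls_delete_darts_aux:
  assumes "finite S" "p permutes S" "q permutes S" "\<And>c. c \<in> S - Y \<Longrightarrow> q c = p c"
    and "a \<in> S" "\<And>b. b \<in> Y \<Longrightarrow> \<not> linked (gr p) a b"
  shows "linked (gr q) a b \<longleftrightarrow> linked (gr p) a b"
proof -
  have "(q ^^ n) a = (p ^^ n) a" for n
  proof (induction n)
    case (Suc n)
    have "(p ^^ n) a \<in> S" using assms(2,5) by (induction n) (auto simp: permutes_in_image)
    moreover have "(p ^^ n) a \<notin> Y" using assms(6) linked_gr_funpow[of p a n] by blast
    ultimately show ?case using Suc assms(4) by simp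
  qed simp
  then show ?thesis by (simp add: linked_gr_iff[OF assms(1,2)] linked_gr_iff[OF assms(1,3)])
qed

text \<open>The \<open>q\<close>-cycles avoiding \<open>Y\<close> are the \<open>p\<close>-cycles avoiding \<open>Y\<close>, that is, the
  vertices that have lost all their darts.\<close>

lemma ncls_delete_darts:
  assumes "finite S" "p permutes S" "q permutes S" "Y \<subseteq> S" "\<And>c. c \<in> S - Y \<Longrightarrow> q c = p c"
    and vert: "\<And>a b. a \<in> S \<Longrightarrow> b \<in> S \<Longrightarrow> vert a = vert b \<longleftrightarrow> linked (gr p) a b"
  shows "ncls S (gr q) = ncls Y (gr q) + card (vert ` S - vert ` Y)"
proof -
  let ?c = "\<lambda>a. {b. linked (gr q) a b}"
  define T where "T = {a \<in> S. \<forall>b\<in>Y. \<not> linked (gr q) a b}"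
  have pq: "linked (gr q) a b \<longleftrightarrow> linked (gr p) a b"
    if "a \<in> S" "(\<forall>b\<in>Y. \<not> linked (gr q) a b) \<or> (\<forall>b\<in>Y. \<not> linked (gr p) a b)" for a b
    using that(2) ncls_delete_darts_aux[OF assms(1,2,3,5) that(1)]
      ncls_delete_darts_aux[OF assms(1,3,2) _ that(1), of Y] assms(5) by metis
  have T: "T = {a \<in> S. \<forall>b\<in>Y. \<not> linked (gr p) a b}"
    unfolding T_def using pq by blast
  have "?c ` S - ?c ` Y = ?c ` T"
    unfolding T_def by (auto simp: cls_eq_iff image_iff)
  moreover have "vert ` S - vert ` Y = vert ` T"
    unfolding T using vert assms(4) by (auto simp: image_iff) blast
  moreover have "card (vert ` T) = card (?c ` (\<lambda>a. a) ` T)"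
  proof (rule card_image_cong_kernel)
    fix a b assume ab: "a \<in> T" "b \<in> T"
    then have "vert a = vert b \<longleftrightarrow> linked (gr p) a b" using vert T_def by blast
    also have "\<dots> \<longleftrightarrow> linked (gr q) a b" using pq ab T_def by blast
    finally show "vert a = vert b \<longleftrightarrow> ?c a = ?c b" by (simp only: cls_eq_iff)
  qed
  moreover have "card (?c ` S) = card (?c ` Y) + card (?c ` S - ?c ` Y)"
    using assms(1,4) by (subst card_Diff_subset) (auto simp: image_mono finite_subset card_mono)
  ultimately show ?thesis by (simp add: ncls_def)
qed

lemma perm_delete_comp:
  assumes "\<And>a. r a = x \<longleftrightarrow> a = x"
  shows "perm_delete x p \<circ> r = perm_delete x (p \<circ> r)"
proof -
  have r: "r x = x" using assms by blast
  show ?thesis by (simp add: fun_eq_iff perm_delete_def assms r)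
qed

section \<open>Faces and vertices of the underlying graph of a dimap\<close>

locale dimap =
  fixes H :: "'e dimap"
  assumes alt: "alt_dimap H"
begin

abbreviation "D \<equiv> arcs H"
abbreviation "L \<equiv> left_succ H"
abbreviation "R \<equiv> right_succ H"

lemma L_eq: "L = inv (sigw H)"
  by (simp add: left_succ_def fun_eq_iff)

lemma R_eq: "R = sigw2 H"
  by (simp add: right_succ_def fun_eq_iff)

lemma fin: "finite D"
  and sig1: "sig1 H permutes D"
  and sigw: "sigw H permutes D"
  and R: "R permutes D"
  and L: "L permutes D"
  using alt permutes_inv by (auto simp: alt_dimap_def L_eq R_eq)

lemma sigw_L [simp]: "sigw H (L a) = a" and L_sigw [simp]: "L (sigw H a) = a"
  using permutes_inverses[OF sigw] by (simp_all add: left_succ_def)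

lemma inv_R: "inv R a = sig1 H (sigw H a)"
proof -
  have "sig1 H (sigw H (R b)) = b" for b
    using alt unfolding alt_dimap_def right_succ_def by (metis comp_apply id_apply)
  then show ?thesis using permutes_inverses(1)[OF R] by metis
qed

lemma R_sig1_sigw [simp]: "R (sig1 H (sigw H a)) = a"
  using permutes_inverses[OF R] by (simp add: inv_R[symmetric])

abbreviation "S \<equiv> D \<times> (UNIV :: bool set)"

lemma finite_S: "finite S"
  using fin by simp

lemma rot_underlying:
  "rot (underlying H) = perm_restrict (\<lambda>(e, b). if b then (L e, False) else (inv R e, True)) S"
  by (simp add: underlying_def)

lemma partner_underlying:
  "partner (underlying H) = perm_restrict (\<lambda>(e, b). (e, \<not> b)) S"
  by (simp add: underlying_def)

lemma rot_permutes: "rot (underlying H) permutes S"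
proof (rule bij_imp_permutes)
  have "inv R a \<in> D \<longleftrightarrow> a \<in> D" "L a \<in> D \<longleftrightarrow> a \<in> D" "sigw H a \<in> D \<longleftrightarrow> a \<in> D" "R a \<in> D \<longleftrightarrow> a \<in> D" for a
    using permutes_inv[OF R] L R sigw by (simp_all add: permutes_in_image)
  then show "bij_betw (rot (underlying H)) S S"
    using permutes_inverses[OF R]
    by (intro bij_betwI[of _ _ _ "\<lambda>(e, b). if b then (R e, False) else (sigw H e, True)"])
       (auto simp: rot_underlying perm_restrict_def split: if_splits)
qed (auto simp: rot_underlying perm_restrict_def)

text \<open>The face permutation of the underlying graph, by \<open>face_eq\<close>. Darts at heads
  trace the c-faces backwards and darts at tails trace the a-faces, so the two kinds never share a
  cycle.\<close>

definition face :: "'e \<times> bool \<Rightarrow> 'e \<times> bool" where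
  "face d = ((if snd d then inv R (fst d) else L (fst d)), snd d)"

lemma face_eq: "rot (underlying H) \<circ> partner (underlying H) = face"
proof
  fix d :: "'e \<times> bool"
  obtain a b where d: "d = (a, b)" by (cases d)
  show "(rot (underlying H) \<circ> partner (underlying H)) d = face d"
  proof (cases "a \<in> D")
    case False
    then have "inv R a = a" "L a = a"
      using permutes_inv[OF R] L by (simp_all add: permutes_not_in)
    then show ?thesis
      using False by (simp add: d rot_underlying partner_underlying perm_restrict_def face_def)
  qed (simp add: d rot_underlying partner_underlying perm_restrict_def face_def)
qed

lemma partner_permutes: "partner (underlying H) permutes S"
proof (rule bij_imp_permutes)
  show "bij_betw (partner (underlying H)) S S"
    by (intro bij_betwI[of _ _ _ "\<lambda>(e, b). (e, \<not> b)"])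
       (auto simp: partner_underlying perm_restrict_def)
qed (auto simp: partner_underlying perm_restrict_def)

lemma face_permutes: "face permutes S"
  using permutes_compose[OF partner_permutes rot_permutes] by (simp add: face_eq)

lemma linked_face_snd: "linked (gr face) d d' \<Longrightarrow> snd d = snd d'"
proof -
  assume "linked (gr face) d d'"
  then have "d' \<in> {c. snd c = snd d}"
    by (rule linked_closed) (auto simp: gr_def face_def)
  then show ?thesis by simp
qed

lemma linked_face_True: "linked (gr face) (a, True) (b, True) \<longleftrightarrow> linked (gr R) a b"
proof
  assume "linked (gr face) (a, True) (b, True)"
  then have "linked (gr (inv R)) (if snd (a, True) then fst (a, True) else a)
      (if snd (b, True) then fst (b, True) else a)"
    by (rule linked_image) (auto simp: gr_def face_def intro!: linked_base)
  then show "linked (gr R) a b" by (simp add: linked_gr_inv[OF R])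
next
  assume "linked (gr R) a b"
  then have "linked (gr (inv R)) a b" by (simp add: linked_gr_inv[OF R])
  then show "linked (gr face) (a, True) (b, True)"
    by (rule linked_image) (auto simp: gr_def face_def intro!: linked_base)
qed

lemma linked_face_False: "linked (gr face) (a, False) (b, False) \<longleftrightarrow> linked (gr L) a b"
proof
  assume "linked (gr face) (a, False) (b, False)"
  then have "linked (gr L) (if snd (a, False) then a else fst (a, False))
      (if snd (b, False) then a else fst (b, False))"
    by (rule linked_image) (auto simp: gr_def face_def intro!: linked_base)
  then show "linked (gr L) a b" by simp
next
  assume "linked (gr L) a b"
  then show "linked (gr face) (a, False) (b, False)"
    by (rule linked_image) (auto simp: gr_def face_def intro!: linked_base)
qed

lemma head_eq: "head H a = {b. linked (gr (sig1 H)) a b}"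
  by (simp add: head_def in_star_def orbit_eq_linked[OF fin sig1])

text \<open>Two steps of the rotation lead from an incoming edge over an outgoing one to the next
  incoming edge, which is its image under \<open>sig1 H\<close>. The map \<open>?h\<close> sends
  each dart to an incoming edge at the same vertex.\<close>

lemma org_eq_iff:
  assumes "d \<in> S" "d' \<in> S"
  shows "org (underlying H) d = org (underlying H) d' \<longleftrightarrow> linked (gr (rot (underlying H))) d d'"
proof -
  let ?h = "\<lambda>d. if snd d then fst d else sigw H (fst d)"
  let ?r = "rot (underlying H)"
  have org: "org (underlying H) d = head H (?h d)" for d
    by (cases d) (simp add: underlying_def tail_def)
  have h: "linked (gr ?r) d (?h d, True)" if "d \<in> S" for d
  proof (cases "snd d")
    case False
    then obtain a where a: "d = (a, False)" "a \<in> D" using \<open>d \<in> S\<close> by (cases d) auto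
    then have "sigw H a \<in> D" using sigw by (simp add: permutes_in_image)
    then have "?r (sigw H a, True) = d" by (simp add: a rot_underlying perm_restrict_def)
    then show ?thesis using linked_gr[of ?r "(sigw H a, True)"] a linked_sym by fastforce
  qed (cases d, simp)
  have "linked (gr (sig1 H)) (?h d) (?h d') \<longleftrightarrow> linked (gr ?r) d d'"
  proof
    assume "linked (gr (sig1 H)) (?h d) (?h d')"
    then have "linked (gr ?r) (?h d, True) (?h d', True)"
    proof (rule linked_image)
      fix u v assume "(u, v) \<in> gr (sig1 H)"
      then have v: "v = sig1 H u" by (auto simp: gr_def)
      show "linked (gr ?r) (u, True) (v, True)"
      proof (cases "u \<in> D")
        case True
        then have "L u \<in> D" using L by (simp add: permutes_in_image)
        then have "(v, True) = ?r (?r (u, True))"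
          using True by (simp add: v rot_underlying perm_restrict_def inv_R)
        then show ?thesis using linked_trans[OF linked_gr linked_gr] by metis
      next
        case False
        then show ?thesis using sig1 by (simp add: v permutes_not_in)
      qed
    qed
    then show "linked (gr ?r) d d'"
      using linked_trans[OF h[OF assms(1)] linked_trans[OF _ linked_sym[OF h[OF assms(2)]]]] by blast
  next
    assume "linked (gr ?r) d d'"
    then show "linked (gr (sig1 H)) (?h d) (?h d')"
    proof (rule linked_image)
      fix u v assume "(u, v) \<in> gr ?r"
      then have v: "v = ?r u" by (auto simp: gr_def)
      obtain a b where u: "u = (a, b)" by (cases u)
      show "linked (gr (sig1 H)) (?h u) (?h v)"
        using linked_gr[of "sig1 H" "sigw H a"]
        by (auto simp: v u rot_underlying perm_restrict_def inv_R)
    qed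
  qed
  then show ?thesis by (simp add: org head_eq cls_eq_iff)
qed

lemma everts_underlying: "everts (underlying H) = org (underlying H) ` S"
proof -
  have "tail H a \<in> head H ` D" if "a \<in> D" for a
    using that sigw by (auto simp: tail_def permutes_in_image)
  then show ?thesis by (auto simp: underlying_def image_iff) blast
qed

lemma card_edges:
  "card ((\<lambda>d. {d, perm_restrict (\<lambda>(e, b). (e, \<not> b)) (A \<times> UNIV) d}) ` (A \<times> (UNIV :: bool set))) = card A"
proof -
  have "(\<lambda>d. {d, perm_restrict (\<lambda>(e, b). (e, \<not> b)) (A \<times> UNIV) d}) ` (A \<times> (UNIV :: bool set)) =
      (\<lambda>a. {a} \<times> UNIV) ` A"
    by (auto simp: perm_restrict_def image_iff UNIV_bool)
  moreover have "inj_on (\<lambda>a. {a} \<times> (UNIV :: bool set)) A" by (auto simp: inj_on_def)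
  ultimately show ?thesis by (simp add: card_image)
qed

lemma components_minus_genus_eq:
  "components_minus_genus M = (real (card (everts M)) -
     real (card (edge_of M ` darts M)) + real (num_faces M)) / 2"
  by (simp add: components_minus_genus_def genus_def graph_of_def)

text \<open>The deletion keeps V and lowers E by 2, so \<open>k - \<gamma>\<close> grows iff F drops
  by less than 2. Removing an edge multiplies the face permutation by a transposition of its darts.
  The first one always merges the c-face and the a-face of \<open>e\<close>; the second splits the
  merged face iff both darts of \<open>f\<close> lie on it, and merges again otherwise.\<close>

theorem deletion_splits_iff:
  assumes e: "e \<in> D" and f: "f \<in> D" and ef: "e \<noteq> f"
  shows "deletion_splits H e f \<longleftrightarrow> linked (gr R) e f \<and> linked (gr L) e f"
proof -
  let ?U = "underlying H"
  let ?M1 = "delete_embedded_edge ?U (e, True)"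
  let ?M2 = "delete_embedded_edge ?M1 (f, True)"
  let ?Y = "(D - {e, f}) \<times> (UNIV :: bool set)"
  \<comment> \<open>The darts of the two edges are kept for now and become their own partners; this
    lets \<open>?q\<close> act on all of \<open>S\<close>, so that it can be compared with
    \<open>face\<close>.\<close>
  let ?rho = "perm_restrict (\<lambda>(e, b). (e, \<not> b)) ?Y"
  let ?q = "rot ?U \<circ> ?rho"
  have eU: "edge_of ?U (e, True) = {e} \<times> UNIV"
    using e by (auto simp: edge_of_def partner_underlying perm_restrict_def)
  have dU: "darts ?U = S" by (simp add: underlying_def)
  have d1: "darts ?M1 = (D - {e}) \<times> UNIV"
    by (auto simp: delete_embedded_edge_def eU dU)
  have p1: "partner ?M1 = perm_restrict (\<lambda>(e, b). (e, \<not> b)) ((D - {e}) \<times> UNIV)"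
    by (auto simp: delete_embedded_edge_def eU dU partner_underlying perm_restrict_def fun_eq_iff)
  have e1: "edge_of ?M1 (f, True) = {f} \<times> UNIV"
    using f ef by (auto simp: edge_of_def p1 perm_restrict_def)
  have d2: "darts ?M2 = ?Y"
    by (auto simp: delete_embedded_edge_def[of ?M1] e1 d1)
  have p2: "partner ?M2 = ?rho"
    by (auto simp: delete_embedded_edge_def[of ?M1] e1 d1 p1 perm_restrict_def fun_eq_iff)
  have r2: "rot ?M2 = perm_delete (f, True) (perm_delete (f, False)
      (perm_delete (e, True) (perm_delete (e, False) (rot ?U))))"
    using e f ef
    by (simp add: delete_embedded_edge_def[of ?M1] p1 perm_restrict_def)
       (simp add: delete_embedded_edge_def partner_underlying perm_restrict_def)
  have rho: "?rho d = d' \<longleftrightarrow> d = d'" if "fst d' \<in> {e, f}" for d d'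
    using that by (cases d; cases d') (auto simp: perm_restrict_def)
  have rho_perm: "?rho permutes S"
  proof (rule bij_imp_permutes)
    show "bij_betw ?rho S S"
      by (intro bij_betwI[of _ _ _ ?rho]) (auto simp: perm_restrict_def)
  qed (auto simp: perm_restrict_def)
  have q: "?q permutes S" by (rule permutes_compose[OF rho_perm rot_permutes])
  have face2: "rot ?M2 \<circ> partner ?M2 = perm_delete (f, True) (perm_delete (f, False)
      (perm_delete (e, True) (perm_delete (e, False) ?q)))"
    unfolding r2 p2 by (simp add: perm_delete_comp rho)
  note del = perm_delete_permutes
  have link2: "linked (gr (rot ?M2 \<circ> partner ?M2)) a b \<longleftrightarrow> linked (gr ?q) a b"
    if "a \<in> ?Y" "b \<in> ?Y" for a b
    unfolding face2
    using that linked_perm_delete'[OF permutes_inj[OF q], of a "(e, False)" b]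
      linked_perm_delete'[OF permutes_inj[OF del[OF q]], of a "(e, True)" b]
      linked_perm_delete'[OF permutes_inj[OF del[OF del[OF q]]], of a "(f, False)" b]
      linked_perm_delete'[OF permutes_inj[OF del[OF del[OF del[OF q]]]], of a "(f, True)" b]
    by (cases a; cases b) simp
  have face2_perm: "rot ?M2 \<circ> partner ?M2 permutes S - {(e, False)} - {(e, True)} - {(f, False)} - {(f, True)}"
    unfolding face2 by (intro del q)
  have "num_faces ?M2 = ncls ?Y (gr ?q) + card (org ?U ` S - org ?U ` ?Y)"
  proof -
    have "org ?M2 = org ?U" "everts ?M2 = org ?U ` S"
      by (simp_all add: delete_embedded_edge_def everts_underlying)
    moreover have "card (orbit (rot ?M2 \<circ> partner ?M2) ` ?Y) = ncls ?Y (gr ?q)"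
      using card_orbits[OF _ face2_perm] ncls_cong[of ?Y, OF link2] finite_S by simp
    ultimately show ?thesis by (simp add: num_faces_def d2)
  qed
  \<comment> \<open>Cycles of \<open>?q\<close> consisting of removed darts only stand for the
    vertices that have become isolated, and \<open>num_faces\<close> counts a face for each of
    them.\<close>
  also have "\<dots> = ncls S (gr ?q)"
    by (rule ncls_delete_darts[OF finite_S rot_permutes q _ _ org_eq_iff, symmetric])
       (auto simp: perm_restrict_def)
  finally have F2: "num_faces ?M2 = ncls S (gr ?q)" .
  have F: "num_faces ?U = ncls S (gr face)"
    unfolding num_faces_def face_eq dU everts_underlying
    using card_orbits[OF finite_S face_permutes] by simp
  have cE: "card (edge_of ?U ` darts ?U) = card D"
    unfolding edge_of_def dU partner_underlying by (rule card_edges)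
  have cE2: "card (edge_of ?M2 ` darts ?M2) = card (D - {e, f})"
    unfolding edge_of_def d2 p2 by (rule card_edges)
  have "card D = card (D - {e, f}) + 2"
    using card_mono[OF fin, of "{e, f}"] e f ef by (simp add: card_Diff_subset)
  moreover have "everts ?M2 = everts ?U" by (simp add: delete_embedded_edge_def)
  ultimately have splits: "deletion_splits H e f \<longleftrightarrow> ncls S (gr face) < ncls S (gr ?q) + 2"
    unfolding deletion_splits_def components_minus_genus_eq cE cE2 F F2 by (simp, arith)
  let ?f1 = "face \<circ> transpose (e, True) (e, False)"
  have q_eq: "?q = ?f1 \<circ> transpose (f, True) (f, False)"
  proof
    fix d :: "'e \<times> bool"
    obtain a b where d: "d = (a, b)" by (cases d)
    show "?q d = (?f1 \<circ> transpose (f, True) (f, False)) d"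
      using e f ef unfolding face_eq[symmetric] comp_apply
      by (auto simp: d transpose_def partner_underlying perm_restrict_def)
  qed
  have nE: "\<not> linked (gr face) (e, True) (e, False)" using linked_face_snd by fastforce
  have f1: "?f1 permutes S"
    using permutes_compose[OF permutes_swap_id face_permutes] e by blast
  have "ncls S (gr face) = Suc (ncls S (gr ?f1))"
    using ncls_transpose_merge[OF finite_S face_permutes _ _ nE] e by simp
  moreover have "linked (gr ?f1) (f, True) (f, False) \<longleftrightarrow> linked (gr R) e f \<and> linked (gr L) e f"
  proof -
    have "\<not> linked (gr face) (a, True) (b, False)" "\<not> linked (gr face) (a, False) (b, True)" for a b
      using linked_face_snd by fastforce+
    then show ?thesis
      unfolding linked_transpose_merge_iff[OF finite_S face_permutes nE] linked_insert
      using linked_sym[of "gr R"] linked_sym[of "gr L"]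
      by (auto simp: linked_face_True linked_face_False)
  qed
  moreover have "linked (gr ?f1) (f, True) (f, False) \<Longrightarrow> ncls S (gr ?q) = Suc (ncls S (gr ?f1))"
    unfolding q_eq using ncls_transpose_split[OF finite_S f1, of "(f, True)" "(f, False)"] f by simp
  moreover have "\<not> linked (gr ?f1) (f, True) (f, False) \<Longrightarrow> ncls S (gr ?f1) = Suc (ncls S (gr ?q))"
    unfolding q_eq using ncls_transpose_merge[OF finite_S f1, of "(f, True)" "(f, False)"] f by simp
  ultimately show ?thesis unfolding splits
    by (cases "linked (gr ?f1) (f, True) (f, False)") auto
qed

end

section \<open>Dimaps with in-degrees at most 2\<close>

locale quartic_dimap = dimap H for H :: "'e dimap" +
  assumes sig1_sig1 [simp]: "sig1 H (sig1 H a) = a"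
begin

sublocale half_edge_map D "sig1 H" L
  by unfold_locales (use fin sig1 L in auto)

text \<open>The right successor of an edge is the left successor of the other edge with the same
  head. So the left and right successors are a dual pair of rotations for the involution
  \<open>sig1 H\<close>.\<close>

lemma R_comp: "R = L \<circ> sig1 H"
proof
  fix a
  have "R (sig1 H (sigw H (L (sig1 H a)))) = L (sig1 H a)" by (rule R_sig1_sigw)
  then show "R a = (L \<circ> sig1 H) a" by simp
qed

lemma R_def': "R a = L (sig1 H a)"
  by (simp add: R_comp)

lemma sigw2_comp: "sigw2 H = L \<circ> sig1 H"
  using R_comp R_eq by simp

lemma orbit_sig1: "orbit (sig1 H) a = {a, sig1 H a}"
proof -
  have "linked (gr (sig1 H)) a b \<Longrightarrow> b \<in> {a, sig1 H a}" for b
    by (erule linked_closed) (auto simp: gr_def)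
  then show ?thesis
    unfolding orbit_eq_linked[OF fin sig1] by (auto intro: linked_gr)
qed

lemma head_eq_iff: "head H a = head H b \<longleftrightarrow> b = a \<or> b = sig1 H a"
  unfolding head_def in_star_def orbit_sig1 using sig1_sig1 by (auto simp: doubleton_eq_iff)

text \<open>The edges leaving a vertex are the left successors of the edges entering it, so the
  degree is twice the in-degree.\<close>

lemma loop_1_iff:
  assumes "e \<in> D"
  shows "loop_1 H e \<longleftrightarrow> sig1 H e = e"
proof -
  have "{f \<in> D. head H f = head H e} = {e, sig1 H e}"
    using assms sig1 by (auto simp: eq_commute[of "head H _" "head H e"] head_eq_iff permutes_in_image)
  moreover have "{f \<in> D. tail H f = head H e} = L ` {e, sig1 H e}"
  proof (intro set_eqI iffI)
    fix f assume "f \<in> {f \<in> D. tail H f = head H e}"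
    then have "sigw H f \<in> {e, sig1 H e}"
      unfolding tail_def by (auto simp: eq_commute[of "head H _" "head H e"] head_eq_iff)
    then show "f \<in> L ` {e, sig1 H e}" using L_sigw by (metis image_eqI)
  next
    fix f assume "f \<in> L ` {e, sig1 H e}"
    then show "f \<in> {f \<in> D. tail H f = head H e}"
      using assms by (auto simp: tail_def head_eq_iff eq_commute[of "head H _" "head H e"])
  qed
  moreover have "card (L ` {e, sig1 H e}) = card {e, sig1 H e}"
    by (rule card_image) (simp add: inj_on_def)
  ultimately show ?thesis
    by (cases "sig1 H e = e") (auto simp: loop_1_def vertex_degree_def)
qed

lemma orbit_singleton_iff:
  assumes "p permutes D"
  shows "orbit p e = {e} \<longleftrightarrow> p e = e"
proof
  show "p e = e" if "orbit p e = {e}"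
    using that linked_gr[of p e] unfolding orbit_eq_linked[OF fin assms] by auto
  assume "p e = e"
  then have "linked (gr p) e b \<longleftrightarrow> b = e" for b
    using linked_fixed_iff[of p e "{}"] permutes_inj[OF assms] by simp
  then show "orbit p e = {e}" unfolding orbit_eq_linked[OF fin assms] by auto
qed

lemma loop_w_iff: "loop_w H e \<longleftrightarrow> L e = e"
  using orbit_singleton_iff[OF sigw] sigw_L L_sigw by (metis a_face_def loop_w_def)

lemma loop_w2_iff: "loop_w2 H e \<longleftrightarrow> R e = e"
  using orbit_singleton_iff[OF R] by (simp add: c_face_def loop_w2_def R_eq)

lemma ultraloop_sig1:
  assumes "e \<in> D" "ultraloop H e"
  shows "sig1 H e = e"
proof -
  have "head H e = head H (sig1 H e)" by (simp add: head_eq_iff)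
  then show ?thesis using assms by (simp add: ultraloop_def)
qed

lemma ultraloopI:
  assumes "e \<in> D" "sig1 H e = e" "L e = e"
  shows "ultraloop H e"
proof -
  have w: "sigw H e = e" using assms(3) sigw_L by metis
  have "f = e" if "f \<in> D" "head H e = head H f \<or> head H e = tail H f" for f
  proof -
    have "f = e \<or> sigw H f = e" using that(2) assms(2) by (auto simp: tail_def head_eq_iff)
    then show ?thesis using assms(3) L_sigw by metis
  qed
  then show ?thesis
    using assms w by (auto simp: ultraloop_def triloop_def loop_w_iff tail_def)
qed

text \<open>With at most two edges into its vertex, a graph loop is followed by itself on one side.
  Hence it is a triloop, and the case in which the rules are silent does not arise.\<close>

lemma semiloop_1_imp: "semiloop_1 H e \<Longrightarrow> L e = e \<or> R e = e"
  unfolding semiloop_1_def tail_def head_eq_iff R_def' by (metis L_sigw sig1_sig1)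

text \<open>An edge always shares a c-face with its right successor, so only the a-face matters; the
  right successor lies on the same a-face as \<open>sig1 H e\<close>, being its left
  successor.\<close>

lemma semiloop_w_iff:
  assumes "e \<in> D"
  shows "semiloop_w H e \<longleftrightarrow> R e = e \<or> linked (gr L) e (sig1 H e)"
proof (cases "R e = e")
  case False
  have "linked (gr L) e (R e) \<longleftrightarrow> linked (gr L) e (sig1 H e)"
    using linked_gr[of L "sig1 H e"] linked_trans linked_sym unfolding R_def' by metis
  then show ?thesis
    using deletion_splits_iff[OF assms, of "R e"] False assms linked_gr[of R e]
    by (auto simp: semiloop_w_def R_def')
qed (simp add: semiloop_w_def)

lemma semiloop_w2_iff:
  assumes "e \<in> D"
  shows "semiloop_w2 H e \<longleftrightarrow> L e = e \<or> linked (gr R) e (sig1 H e)"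
proof (cases "L e = e")
  case False
  have "L e = R (sig1 H e)" by (simp add: R_def')
  then have "linked (gr R) e (L e) \<longleftrightarrow> linked (gr R) e (sig1 H e)"
    using linked_gr[of R "sig1 H e"] linked_trans linked_sym by metis
  then show ?thesis
    using deletion_splits_iff[OF assms, of "L e"] False assms linked_gr[of L e]
    by (auto simp: semiloop_w2_def)
qed (simp add: semiloop_w2_def)

lemma triloop_iff: "e \<in> D \<Longrightarrow> triloop H e \<longleftrightarrow> sig1 H e = e \<or> L e = e \<or> R e = e"
  by (simp add: triloop_def loop_1_iff loop_w_iff loop_w2_iff)

lemma reduce_w_sel:
  "arcs (reduce_w H e) = D - {e}" "sig1 (reduce_w H e) = perm_delete e (sig1 H)"
  "left_succ (reduce_w H e) = perm_delete e L"
proof -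
  show "left_succ (reduce_w H e) = perm_delete e L"
    unfolding L_eq perm_delete_inv[OF sigw]
    by (simp add: fun_eq_iff left_succ_def reduce_w_def Let_def)
qed (simp_all add: reduce_w_def Let_def)

lemma reduce_w2_sel:
  "arcs (reduce_w2 H e) = D - {e}" "sig1 (reduce_w2 H e) = perm_delete e (sig1 H)"
  "left_succ (reduce_w2 H e) = perm_delete e (L \<circ> sig1 H) \<circ> perm_delete e (sig1 H)"
proof -
  have p: "perm_delete e (sig1 H) permutes D - {e}" "perm_delete e (sigw2 H) permutes D - {e}"
    using perm_delete_permutes sig1 R by (auto simp: R_eq)
  have "inv (inv (perm_delete e (sig1 H)) \<circ> inv (perm_delete e (sigw2 H))) =
      perm_delete e (sigw2 H) \<circ> perm_delete e (sig1 H)"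
    using permutes_bij[OF p(1)] permutes_bij[OF p(2)]
    by (simp add: o_inv_distrib bij_imp_bij_inv inv_inv_eq)
  then show "left_succ (reduce_w2 H e) = perm_delete e (L \<circ> sig1 H) \<circ> perm_delete e (sig1 H)"
    by (simp add: fun_eq_iff left_succ_def reduce_w2_def Let_def sigw2_comp[symmetric])
qed (simp_all add: reduce_w2_def Let_def)

lemma alt_reduce_w: "alt_dimap (reduce_w H e)"
proof -
  have p: "perm_delete e (sig1 H) permutes D - {e}" "perm_delete e (sigw H) permutes D - {e}"
    by (intro perm_delete_permutes sig1 sigw)+
  have "perm_delete e (sig1 H) \<circ> perm_delete e (sigw H) permutes D - {e}"
    by (rule permutes_compose[OF p(2,1)])
  then show ?thesis
    using p fin permutes_inv_o(1) permutes_inv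
    by (auto simp: alt_dimap_def reduce_w_def Let_def)
qed

lemma alt_reduce_w2: "alt_dimap (reduce_w2 H e)"
proof -
  have p: "perm_delete e (sig1 H) permutes D - {e}" "perm_delete e (sigw2 H) permutes D - {e}"
    using perm_delete_permutes sig1 R by (auto simp: R_eq)
  have "inv (perm_delete e (sig1 H)) \<circ> inv (perm_delete e (sigw2 H)) permutes D - {e}"
    by (intro permutes_compose permutes_inv p)
  moreover have "perm_delete e (sig1 H) \<circ>
      (inv (perm_delete e (sig1 H)) \<circ> inv (perm_delete e (sigw2 H))) \<circ> perm_delete e (sigw2 H) = id"
    using permutes_inverses[OF p(1)] permutes_inverses[OF p(2)] by (simp add: fun_eq_iff)
  ultimately show ?thesis
    using p fin by (auto simp: alt_dimap_def reduce_w2_def Let_def)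
qed

lemma quartic_reduce_w: "quartic_dimap (reduce_w H e)"
  by unfold_locales (use alt_reduce_w half_edge_map.s_s[OF delete] in \<open>auto simp: reduce_w_sel\<close>)

lemma quartic_reduce_w2: "quartic_dimap (reduce_w2 H e)"
  by unfold_locales (use alt_reduce_w2 half_edge_map.s_s[OF delete] in \<open>auto simp: reduce_w2_sel\<close>)

end

section \<open>Evaluating the rules on plane dimaps\<close>

definition plane_quartic :: "'e dimap \<Rightarrow> bool" where
  "plane_quartic H \<longleftrightarrow> quartic_dimap H \<and> planar_map (arcs H) (sig1 H) (left_succ H)"

definition dimap_sum :: "'r::comm_ring_1 \<Rightarrow> 'e dimap \<Rightarrow> 'r" where
  "dimap_sum x H = state_sum x (arcs H) (sig1 H) (left_succ H)"

lemma plane_quartic_alt: "plane_quartic H \<Longrightarrow> alt_dimap H"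
  by (simp add: plane_quartic_def quartic_dimap_def dimap_def)

lemma plane_quartic_reduce:
  assumes "plane_quartic H" "e \<in> arcs H"
  shows "plane_quartic (reduce_w H e)" "plane_quartic (reduce_w2 H e)"
proof -
  interpret quartic_dimap H using assms(1) by (simp add: plane_quartic_def)
  show "plane_quartic (reduce_w H e)" "plane_quartic (reduce_w2 H e)"
    using assms quartic_reduce_w quartic_reduce_w2 planar_map_delete planar_map_contract
    by (auto simp: plane_quartic_def reduce_w_sel reduce_w2_sel)
qed

lemma dimap_sum_loop_1:
  assumes "plane_quartic H" "e \<in> arcs H" "loop_1 H e"
  shows "dimap_sum x H = dimap_sum x (reduce_triloop H e)"
proof -
  interpret quartic_dimap H using assms(1) by (simp add: plane_quartic_def)
  show ?thesis
    using state_sum_fixed[OF assms(2)] assms(3) loop_1_iff[OF assms(2)]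
    by (simp add: dimap_sum_def reduce_triloop_def reduce_w_sel)
qed

lemma dimap_sum_uses_w:
  assumes "plane_quartic H" "e \<in> arcs H" "uses_reduce_w H e"
  shows "dimap_sum x H = x * dimap_sum x (reduce_w H e)"
proof -
  interpret quartic_dimap H using assms(1) by (simp add: plane_quartic_def)
  consider "proper_semiloop_w2 H e" | "loop_w H e" "\<not> ultraloop H e"
    using assms(3) by (auto simp: uses_reduce_w_def)
  then show ?thesis
  proof cases
    case 1
    then have "sig1 H e \<noteq> e" "L e \<noteq> e" "L (sig1 H e) \<noteq> e" "linked (gr (L \<circ> sig1 H)) e (sig1 H e)"
      using semiloop_w2_iff[OF assms(2)] triloop_iff[OF assms(2)]
      by (auto simp: proper_semiloop_w2_def R_def' R_comp)
    moreover have "planar_half D (sig1 H) L"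
      using assms(1) by (simp add: plane_quartic_def planar_map_def)
    ultimately show ?thesis
      using state_sum_semiloop(1)[OF assms(2)] by (simp add: dimap_sum_def reduce_w_sel)
  next
    case 2
    then have "sig1 H e \<noteq> e" "L e = e" using ultraloopI[OF assms(2)] by (auto simp: loop_w_iff)
    then show ?thesis
      using state_sum_loop[OF assms(2)] by (simp add: dimap_sum_def reduce_w_sel)
  qed
qed

lemma dimap_sum_uses_w2:
  assumes "plane_quartic H" "e \<in> arcs H" "uses_reduce_w2 H e"
  shows "dimap_sum x H = x * dimap_sum x (reduce_w2 H e)"
proof -
  interpret quartic_dimap H using assms(1) by (simp add: plane_quartic_def)
  consider "proper_semiloop_w H e" | "loop_w2 H e" "\<not> ultraloop H e"
    using assms(3) by (auto simp: uses_reduce_w2_def)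
  then show ?thesis
  proof cases
    case 1
    then have "sig1 H e \<noteq> e" "L e \<noteq> e" "L (sig1 H e) \<noteq> e" "linked (gr L) e (sig1 H e)"
      using semiloop_w_iff[OF assms(2)] triloop_iff[OF assms(2)]
      by (auto simp: proper_semiloop_w_def R_def')
    moreover have "planar_half D (sig1 H) (L \<circ> sig1 H)"
      using assms(1) by (simp add: plane_quartic_def planar_map_def)
    ultimately show ?thesis
      using state_sum_semiloop_dual(2)[OF assms(2)] by (simp add: dimap_sum_def reduce_w2_sel)
  next
    case 2
    then have "L (sig1 H e) = e" by (simp add: loop_w2_iff R_def')
    moreover from this have "sig1 H e \<noteq> e" using 2 ultraloopI[OF assms(2)] by auto
    ultimately show ?thesis
      using half_edge_map.state_sum_loop[OF dual assms(2), of x]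
      by (simp add: dimap_sum_def reduce_w2_sel state_sum_contract state_sum_dual)
  qed
qed

lemma dimap_sum_ordinary:
  assumes "plane_quartic H" "e \<in> arcs H" "\<not> semiloop H e"
  shows "dimap_sum x H = dimap_sum x (reduce_w H e) + dimap_sum x (reduce_w2 H e)"
proof -
  interpret quartic_dimap H using assms(1) by (simp add: plane_quartic_def)
  have "L e \<noteq> e" "L (sig1 H e) \<noteq> e" "\<not> linked (gr L) e (sig1 H e)"
    "\<not> linked (gr (L \<circ> sig1 H)) e (sig1 H e)"
    using assms(3) semiloop_w_iff[OF assms(2)] semiloop_w2_iff[OF assms(2)]
    by (auto simp: semiloop_def R_def' R_comp)
  moreover from this have "sig1 H e \<noteq> e" by auto
  ultimately show ?thesis
    using state_sum_ordinary[OF assms(2)] by (simp add: dimap_sum_def reduce_w_sel reduce_w2_sel)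
qed

text \<open>A triloop that is not a 1-loop cannot be an ultraloop and so has a rule. Any other
  semiloop is no graph loop, hence a proper semiloop of one of the other two kinds.\<close>

lemma applicable_rule:
  assumes "plane_quartic H" "e \<in> arcs H"
  shows "loop_1 H e \<or> uses_reduce_w2 H e \<or> uses_reduce_w H e \<or> \<not> semiloop H e"
proof -
  interpret quartic_dimap H using assms(1) by (simp add: plane_quartic_def)
  show ?thesis
    using triloop_iff[OF assms(2)] semiloop_1_imp[of e] ultraloop_sig1[OF assms(2)]
    by (auto simp: uses_reduce_w_def uses_reduce_w2_def loop_1_iff[OF assms(2)] loop_w_iff loop_w2_iff
        proper_semiloop_w_def proper_semiloop_w2_def proper_semiloop_1_def semiloop_def)
qed

lemma dimap_sum_empty: "arcs H = {} \<Longrightarrow> dimap_sum x H = 1"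
proof -
  assume "arcs H = {}"
  then have "smoothings (arcs H) (sig1 H) = {{}}" by (auto simp: smoothings_def)
  then show ?thesis using \<open>arcs H = {}\<close> by (simp add: dimap_sum_def state_sum_def circles_def ncls_def)
qed

lemma Ti_value_dimap_sum: "Ti_value x H t \<Longrightarrow> plane_quartic H \<Longrightarrow> t = dimap_sum x H"
proof (induction rule: Ti_value.induct)
  case (Ti_empty H)
  then show ?case by (simp add: dimap_sum_empty)
next
  case (Ti_loop_1 e H t)
  then show ?case using dimap_sum_loop_1 plane_quartic_reduce(1) by (metis reduce_triloop_def)
next
  case (Ti_w2 e H t)
  then show ?case using dimap_sum_uses_w2 plane_quartic_reduce(2) by metis
next
  case (Ti_w e H t)
  then show ?case using dimap_sum_uses_w plane_quartic_reduce(1) by metis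
next
  case (Ti_ordinary e H s t)
  then show ?case using dimap_sum_ordinary plane_quartic_reduce by metis
qed

lemma Ti_value_exists: "plane_quartic H \<Longrightarrow> \<exists>t. Ti_value x H t"
proof (induction "card (arcs H)" arbitrary: H rule: less_induct)
  case less
  show ?case
  proof (cases "arcs H = {}")
    case False
    then obtain e where e: "e \<in> arcs H" by blast
    have "finite (arcs H)" using plane_quartic_alt[OF less.prems] by (simp add: alt_dimap_def)
    then have "card (arcs H - {e}) < card (arcs H)" using e by (intro psubset_card_mono) auto
    then obtain s t where "Ti_value x (reduce_w H e) s" "Ti_value x (reduce_w2 H e) t"
      using less.hyps[of "reduce_w H e"] less.hyps[of "reduce_w2 H e"]
        plane_quartic_reduce[OF less.prems e]
      by (auto simp: reduce_w_def reduce_w2_def Let_def)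
    then show ?thesis
      using applicable_rule[OF less.prems e] Ti_value.intros(2-5)[OF e]
      unfolding reduce_triloop_def by metis
  qed (auto intro: Ti_empty)
qed

lemma Ti_value_iff: "plane_quartic H \<Longrightarrow> Ti_value x H t \<longleftrightarrow> t = dimap_sum x H"
  using Ti_value_dimap_sum Ti_value_exists by metis

text \<open>At any edge, one applicable rule determines the value from smaller plane dimaps, and the
  state sum obeys the same rule.\<close>

lemma Ti_invariant_dimap_sum:
  assumes "Ti_invariant x T"
  shows "plane_quartic H \<Longrightarrow> T H = dimap_sum x H"
proof (induction "card (arcs H)" arbitrary: H rule: less_induct)
  case less
  have alt: "alt_dimap H" by (rule plane_quartic_alt[OF less.prems])
  show ?case
  proof (cases "arcs H = {}")
    case True
    then show ?thesis using assms alt by (simp add: dimap_sum_empty Ti_invariant_def)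
  next
    case False
    then obtain e where e: "e \<in> arcs H" by blast
    have "finite (arcs H)" using alt by (simp add: alt_dimap_def)
    then have "card (arcs H - {e}) < card (arcs H)" using e by (intro psubset_card_mono) auto
    then have IH: "T (reduce_w H e) = dimap_sum x (reduce_w H e)"
      "T (reduce_w2 H e) = dimap_sum x (reduce_w2 H e)"
      using less.hyps[of "reduce_w H e"] less.hyps[of "reduce_w2 H e"]
        plane_quartic_reduce[OF less.prems e]
      by (simp_all add: reduce_w_def reduce_w2_def Let_def)
    have T: "loop_1 H e \<Longrightarrow> T H = T (reduce_triloop H e)"
      "uses_reduce_w2 H e \<Longrightarrow> T H = x * T (reduce_w2 H e)"
      "uses_reduce_w H e \<Longrightarrow> T H = x * T (reduce_w H e)"
      "\<not> semiloop H e \<Longrightarrow> T H = T (reduce_w H e) + T (reduce_w2 H e)"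
      using assms alt e unfolding Ti_invariant_def by blast+
    show ?thesis
      using applicable_rule[OF less.prems e]
    proof (elim disjE)
      assume "loop_1 H e"
      then show ?thesis
        using T(1) IH dimap_sum_loop_1[OF less.prems e, of x] by (simp add: reduce_triloop_def)
    qed (use T IH dimap_sum_uses_w[OF less.prems e, of x] dimap_sum_uses_w2[OF less.prems e, of x]
        dimap_sum_ordinary[OF less.prems e, of x] in simp_all)
  qed
qed

section \<open>Dimaps of plane graphs\<close>

text \<open>A cycle counts the same in either direction, so \<open>c\<close> may conjugate
  \<open>p\<close> to \<open>q\<close> where \<open>t\<close> holds and to the inverse of
  \<open>q\<close> elsewhere.\<close>

lemma ncls_conj:
  assumes bij: "bij_betw c S S'" and p: "p permutes S" and q: "q permutes S'"
    and t: "\<And>a. a \<in> S \<Longrightarrow> t (p a) \<longleftrightarrow> t a"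
    and pos: "\<And>a. a \<in> S \<Longrightarrow> t a \<Longrightarrow> q (c a) = c (p a)"
    and neg: "\<And>a. a \<in> S \<Longrightarrow> \<not> t a \<Longrightarrow> q (c (p a)) = c a"
  shows "ncls S (gr p) = ncls S' (gr q)"
proof -
  have inv: "inv_into S c (c a) = a" if "a \<in> S" for a
    using bij that by (simp add: bij_betw_def)
  have "linked (gr p) a b \<longleftrightarrow> linked (gr q) (c a) (c b)" if "a \<in> S" "b \<in> S" for a b
  proof
    assume "linked (gr p) a b"
    then show "linked (gr q) (c a) (c b)"
    proof (rule linked_image)
      fix u v assume "(u, v) \<in> gr p"
      then have v: "v = p u" by (auto simp: gr_def)
      show "linked (gr q) (c u) (c v)"
      proof (cases "u \<in> S")
        case True
        then show ?thesis
          using pos[OF True] neg[OF True] linked_gr[of q "c u"] linked_sym[OF linked_gr[of q "c v"]]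
          by (cases "t u") (simp_all add: v)
      qed (use p in \<open>simp add: v permutes_not_in\<close>)
    qed
  next
    assume "linked (gr q) (c a) (c b)"
    then have "linked (gr p) (inv_into S c (c a)) (inv_into S c (c b))"
    proof (rule linked_image)
      fix u v assume "(u, v) \<in> gr q"
      then have v: "v = q u" by (auto simp: gr_def)
      show "linked (gr p) (inv_into S c u) (inv_into S c v)"
      proof (cases "u \<in> S'")
        case True
        then obtain w where w: "w \<in> S" "u = c w" using bij by (auto simp: bij_betw_def)
        define z where "z = inv p w"
        have z: "z \<in> S" "p z = w"
          using w(1) permutes_inv[OF p] permutes_inverses[OF p]
          by (simp_all add: z_def permutes_in_image)
        have pw: "p w \<in> S" using w(1) p by (simp add: permutes_in_image)
        show ?thesis
        proof (cases "t w")
          case True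
          then show ?thesis
            using pos[OF w(1)] linked_gr[of p w] by (simp add: v w(2) inv[OF w(1)] inv[OF pw])
        next
          case False
          then have "q u = c z" using neg[OF z(1)] t[OF z(1)] z(2) by (simp add: w(2))
          then show ?thesis
            using linked_sym[OF linked_gr[of p z]] z(2) by (simp add: v w(2) inv[OF w(1)] inv[OF z(1)])
        qed
      qed (use q in \<open>simp add: v permutes_not_in\<close>)
    qed
    then show "linked (gr p) a b" by (simp add: inv that)
  qed
  then have "ncls S (gr p) = ncls (c ` S) (gr q)" by (rule ncls_image)
  then show ?thesis using bij by (simp add: bij_betw_def)
qed

lemma ncls_piecewise:
  assumes "finite S" "p permutes S" "q permutes S" "m permutes S" "X \<subseteq> S"
    and "\<And>a. a \<in> S \<Longrightarrow> p a \<in> X \<longleftrightarrow> a \<in> X" "\<And>a. a \<in> S \<Longrightarrow> q a \<in> X \<longleftrightarrow> a \<in> X"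
    and "\<And>a. a \<in> X \<Longrightarrow> m a = p a" "\<And>a. a \<in> S - X \<Longrightarrow> m a = q a"
  shows "ncls S (gr m) = ncls X (gr p) + ncls (S - X) (gr q)"
proof -
  have closed: "b \<in> X \<longleftrightarrow> a \<in> X"
    if l: "linked (gr r) a b" and r: "\<And>a. a \<in> S \<Longrightarrow> r a \<in> X \<longleftrightarrow> a \<in> X" "r permutes S" for r a b
  proof -
    have 1: "u \<in> X \<longleftrightarrow> v \<in> X" if "(u, v) \<in> gr r" for u v
      using that r permutes_not_in[OF r(2)] by (cases "u \<in> S") (auto simp: gr_def)
    show ?thesis
      using linked_closed[OF l, of X] linked_closed[OF linked_sym[OF l], of X] 1 by blast
  qed
  have mX: "m a \<in> X \<longleftrightarrow> a \<in> X" if "a \<in> S" for a using assms(6-9) that by (cases "a \<in> X") auto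
  have "linked (gr m) a b \<longleftrightarrow> linked (gr p) a b" if "a \<in> X" for a b
    using ncls_delete_darts_aux[OF assms(1,2,4), of "S - X" a b] closed[OF _ assms(6,2)] that assms(5,8)
    by blast
  then have 1: "ncls X (gr m) = ncls X (gr p)" by (intro ncls_cong) auto
  have "linked (gr m) a b \<longleftrightarrow> linked (gr q) a b" if "a \<in> S - X" for a b
    using ncls_delete_darts_aux[OF assms(1,3,4), of X a b] closed[OF _ assms(7,3)] that assms(5,9)
    by blast
  then have 2: "ncls (S - X) (gr m) = ncls (S - X) (gr q)" by (intro ncls_cong) auto
  let ?c = "\<lambda>a. {b. linked (gr m) a b}"
  have "S = X \<union> (S - X)" using assms(5) by auto
  then have "?c ` S = ?c ` X \<union> ?c ` (S - X)" by (metis image_Un)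
  moreover have "?c ` X \<inter> ?c ` (S - X) = {}"
    using closed[OF _ mX assms(4)] by (auto simp: cls_eq_iff)
  ultimately have "ncls S (gr m) = ncls X (gr m) + ncls (S - X) (gr m)"
    using assms(1) finite_subset[OF assms(5,1)] by (simp add: ncls_def card_Un_disjoint)
  then show ?thesis using 1 2 by simp
qed

text \<open>On the part where \<open>t\<close> holds, the map on \<open>D\<close> is the dual of the map on \<open>D'\<close>;
  elsewhere it is its mirror image.\<close>

locale partial_dual = M: half_edge_map D s L + N: half_edge_map D' s' L'
  for D :: "'a set" and s L and D' :: "'b set" and s' L' +
  fixes c :: "'a \<Rightarrow> 'b" and t :: "'a \<Rightarrow> bool"
  assumes bij: "bij_betw c D D'"
    and c_s: "a \<in> D \<Longrightarrow> c (s a) = s' (c a)"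
    and t_s: "a \<in> D \<Longrightarrow> t (s a) \<longleftrightarrow> t a"
    and t_L: "a \<in> D \<Longrightarrow> t (L a) \<longleftrightarrow> t a"
    and c_pos: "a \<in> D \<Longrightarrow> t a \<Longrightarrow> c (L a) = L' (s' (c a))"
    and c_neg: "a \<in> D \<Longrightarrow> \<not> t a \<Longrightarrow> L' (c (L a)) = c a"
begin

lemma c_in: "a \<in> D \<Longrightarrow> c a \<in> D'"
  using bij by (auto simp: bij_betw_def)

lemma c_eq_iff: "a \<in> D \<Longrightarrow> b \<in> D \<Longrightarrow> c a = c b \<longleftrightarrow> a = b"
  using bij by (auto simp: bij_betw_def inj_on_def)

lemma c_surj: "b \<in> D' \<Longrightarrow> \<exists>a\<in>D. b = c a"
  using bij by (auto simp: bij_betw_def)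

text \<open>The state corresponding to \<open>A\<close>: complemented on the dual part, where
  \<open>t\<close> holds, and only transported on the mirrored part.\<close>

definition flip :: "'a set \<Rightarrow> 'b set" where
  "flip A = c ` {a \<in> D. t a \<noteq> (a \<in> A)}"

lemma flip_iff: "a \<in> D \<Longrightarrow> c a \<in> flip A \<longleftrightarrow> t a \<noteq> (a \<in> A)"
  unfolding flip_def using c_eq_iff by auto

lemma nonfixed: "a \<in> D \<Longrightarrow> s' (c a) = c a \<longleftrightarrow> s a = a"
  using c_s c_eq_iff M.s_in by metis

lemma flip_smoothing:
  assumes "A \<in> smoothings D s" and fpf: "\<And>a. a \<in> D \<Longrightarrow> s a \<noteq> a"
  shows "flip A \<in> smoothings D' s'"
  unfolding smoothings_def
proof (intro CollectI conjI ballI)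
  show "flip A \<subseteq> D'" unfolding flip_def using c_in by auto
  fix b assume "b \<in> flip A"
  then obtain a where a: "a \<in> D" "b = c a" "t a \<noteq> (a \<in> A)" unfolding flip_def by auto
  then show "s' b \<noteq> b" using nonfixed fpf by blast
  have "s' b = c (s a)" using c_s a by simp
  then show "s' b \<in> flip A"
    using a flip_iff[of "s a" A] t_s M.smoothing_s[OF assms(1)] by simp
qed

lemma circles_flip:
  assumes A: "A \<in> smoothings D s" and fpf: "\<And>a. a \<in> D \<Longrightarrow> s a \<noteq> a"
  shows "circles D s L A = circles D' s' L' (flip A)"
proof -
  \<comment> \<open>On the mirrored part the curves run backwards, and the inverse of
    \<open>L' \<circ> swap_on s' (flip A)\<close> applies the swap last, whereas
    \<open>L \<circ> swap_on s A\<close> applies it before the rotation. Composing \<open>c\<close>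
    with the swap restores the order.\<close>
  define d where "d a = (if t a then c a else swap_on s' (flip A) (c a))" for a
  have dswap: "d a = (if \<not> t a \<and> a \<in> A then c (s a) else c a)" if "a \<in> D" for a
    using that flip_iff[OF that, of A] c_s[OF that] by (auto simp: d_def swap_on_def)
  have "bij_betw d D D'"
  proof -
    let ?g = "\<lambda>a. if \<not> t a \<and> a \<in> A then s a else a"
    have "bij_betw ?g D D"
      by (rule bij_betwI[of _ _ _ ?g])
         (use M.smoothing_subset[OF A] M.smoothing_s[OF A] t_s in auto)
    from bij_betw_trans[OF this bij] show ?thesis
      by (rule bij_betw_cong[THEN iffD1, rotated]) (auto simp: dswap)
  qed
  then show ?thesis
    unfolding circles_def
  proof (rule ncls_conj[where t = t])
    show "L \<circ> swap_on s A permutes D" by (rule M.state_permutes[OF A])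
    show "L' \<circ> swap_on s' (flip A) permutes D'"
      by (rule N.state_permutes[OF flip_smoothing[OF assms]])
    fix a assume a: "a \<in> D"
    let ?p = "L \<circ> swap_on s A" and ?q = "L' \<circ> swap_on s' (flip A)"
    have sa: "swap_on s A a \<in> D" "t (swap_on s A a) = t a"
      using a t_s by (auto simp: swap_on_def)
    have pa: "?p a \<in> D" using sa by simp
    show tp: "t (?p a) \<longleftrightarrow> t a" using t_L sa by simp
    show "?q (d a) = d (?p a)" if "t a"
      using that a c_pos[OF sa(1)] sa(2) tp flip_iff[OF a, of A] c_s[OF a]
      by (auto simp: d_def swap_on_def)
    show "?q (d (?p a)) = d a" if "\<not> t a"
    proof -
      have "swap_on s' (flip A) (d (?p a)) = c (?p a)"
        using that tp flip_iff[OF pa, of A] N.smoothing_s[OF flip_smoothing[OF assms], of "c (?p a)"]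
        by (auto simp: d_def swap_on_def)
      then have "?q (d (?p a)) = c (swap_on s A a)" using c_neg[OF sa(1)] sa(2) that by simp
      then show ?thesis using that a by (simp add: dswap swap_on_def)
    qed
  qed
qed

lemma pieces_eq: "pieces D s L = pieces D' s' L'"
proof -
  let ?r = "gr L \<union> gr s" and ?r' = "gr L' \<union> gr s'"
  have inv: "inv_into D c (c a) = a" if "a \<in> D" for a
    using bij that by (simp add: bij_betw_def)
  have "linked ?r a b \<longleftrightarrow> linked ?r' (c a) (c b)" if "a \<in> D" "b \<in> D" for a b
  proof
    assume "linked ?r a b"
    then show "linked ?r' (c a) (c b)"
    proof (rule linked_image)
      fix u v assume "(u, v) \<in> ?r"
      then consider "v = L u" | "v = s u" by (auto simp: gr_def)
      then show "linked ?r' (c u) (c v)"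
      proof cases
        case 1
        show ?thesis
        proof (cases "u \<in> D")
          case True
          show ?thesis
          proof (cases "t u")
            case True
            then show ?thesis
              using c_pos[OF \<open>u \<in> D\<close>] linked_trans[OF linked_gr_Un2[of "gr L'" s' "c u"] linked_gr_Un]
              by (simp add: 1)
          next
            case False
            then show ?thesis
              using c_neg[OF \<open>u \<in> D\<close>] linked_sym[OF linked_gr_Un[of L' "gr s'" "c (L u)"]]
              by (simp add: 1)
          qed
        qed (use M.L_perm in \<open>simp add: 1 permutes_not_in\<close>)
      next
        case 2
        show ?thesis
        proof (cases "u \<in> D")
          case True
          then show ?thesis using c_s[OF True] linked_gr_Un2 by (simp add: 2)
        qed (use M.s_perm in \<open>simp add: 2 permutes_not_in\<close>)
      qed
    qed
  next
    assume "linked ?r' (c a) (c b)"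
    then have "linked ?r (inv_into D c (c a)) (inv_into D c (c b))"
    proof (rule linked_image)
      fix u v assume uv: "(u, v) \<in> ?r'"
      show "linked ?r (inv_into D c u) (inv_into D c v)"
      proof (cases "u \<in> D'")
        case True
        then obtain w where w: "w \<in> D" "u = c w" using c_surj by blast
        from uv consider "v = L' u" "t w" | "v = L' u" "\<not> t w" | "v = s' u" by (auto simp: gr_def)
        then show ?thesis
        proof cases
          case 1
          then have "v = c (L (s w))" using c_pos[of "s w"] c_s w t_s by simp
          moreover have "linked ?r w (L (s w))"
            using linked_trans[OF linked_gr_Un2[of "gr L" s w] linked_gr_Un] .
          ultimately show ?thesis using w inv[of "L (s w)"] inv[OF w(1)] by simp
        next
          case 2
          define z where "z = inv L w"
          have z: "z \<in> D" "L z = w"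
            using w(1) permutes_inv[OF M.L_perm] permutes_inverses[OF M.L_perm]
            by (simp_all add: z_def permutes_in_image)
          then have "v = c z" using c_neg[OF z(1)] t_L[OF z(1)] 2 w(2) by simp
          then show ?thesis
            using inv[OF z(1)] inv[OF w(1)] w(2) linked_sym[OF linked_gr_Un[of L "gr s" z]] z(2) by simp
        next
          case 3
          then have "v = c (s w)" using c_s w by simp
          then show ?thesis using inv[of "s w"] inv[OF w(1)] w linked_gr_Un2[of "gr L" s w] by simp
        qed
      next
        case False
        then have "v = u"
          using uv N.L_perm N.s_perm by (auto simp: gr_def permutes_not_in)
        then show ?thesis by simp
      qed
    qed
    then show "linked ?r a b" by (simp add: inv that)
  qed
  then have "ncls D ?r = ncls (c ` D) ?r'" by (rule ncls_image)
  then show ?thesis using bij by (simp add: pieces_def bij_betw_def)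
qed

theorem state_sum_eq:
  assumes fpf: "\<And>a. a \<in> D \<Longrightarrow> s a \<noteq> a"
  shows "state_sum x D s L = state_sum x D' s' L'"
  unfolding state_sum_def pieces_eq
proof (rule sum.reindex_bij_witness[of _ "\<lambda>B. {a \<in> D. t a \<noteq> (c a \<in> B)}" flip])
  fix A assume A: "A \<in> smoothings D s"
  show "{a \<in> D. t a \<noteq> (c a \<in> flip A)} = A"
    using M.smoothing_subset[OF A] flip_iff[of _ A] by auto
  show "flip A \<in> smoothings D' s'" by (rule flip_smoothing[OF A fpf])
  show "(x - 1) ^ (circles D' s' L' (flip A) - pieces D' s' L') =
      (x - 1) ^ (circles D s L A - pieces D' s' L')"
    by (simp add: circles_flip[OF A fpf])
next
  fix B assume B: "B \<in> smoothings D' s'"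
  show "{a \<in> D. t a \<noteq> (c a \<in> B)} \<in> smoothings D s"
    using fpf c_s t_s N.smoothing_s[OF B] unfolding smoothings_def by auto
  have "flip {a \<in> D. t a \<noteq> (c a \<in> B)} = c ` {a \<in> D. c a \<in> B}"
    unfolding flip_def by (rule arg_cong[where f = "image c"]) auto
  also have "\<dots> = B" using c_surj N.smoothing_subset[OF B] by blast
  finally show "flip {a \<in> D. t a \<noteq> (c a \<in> B)} = B" .
qed

text \<open>On the dual part vertices and faces trade places, and on the mirrored part each keeps
  its role, so V + F is the same although V and F separately need not be.\<close>

lemma euler_eq:
  assumes fpf: "\<And>a. a \<in> D \<Longrightarrow> s a \<noteq> a"
  shows "ncls D (gr L) + ncls D (gr (L \<circ> s)) = ncls D' (gr L') + ncls D' (gr (L' \<circ> s'))"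
proof -
  \<comment> \<open>The image of the dual part: complementing the empty state there gives
    everything, and the mirrored part contributes nothing.\<close>
  let ?X = "flip {}"
  have e: "{} \<in> smoothings D s" "D \<in> smoothings D s"
    using fpf by (simp_all add: smoothings_def)
  note X = flip_smoothing[OF e(1) fpf]
  have X_eq: "?X = c ` {a \<in> D. t a}" by (simp add: flip_def)
  have XD: "?X \<subseteq> D'" using X by (simp add: smoothings_def)
  have flipD: "flip D = D' - ?X"
    unfolding flip_def using bij c_eq_iff by (auto simp: bij_betw_def)
  have s'X: "s' b \<in> ?X \<longleftrightarrow> b \<in> ?X" for b by (rule N.smoothing_s[OF X])
  have L'X: "L' b \<in> ?X \<longleftrightarrow> b \<in> ?X" if b: "b \<in> D'" for b
  proof -
    obtain a where a: "a \<in> D" "b = c a" using c_surj[OF b] by blast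
    show ?thesis
    proof (cases "t a")
      case True
      then have "L' b = c (L (s a))" using c_pos[of "s a"] c_s a t_s by simp
      then show ?thesis using a True flip_iff[of a "{}"] flip_iff[of "L (s a)" "{}"] t_L t_s by simp
    next
      case False
      define z where "z = inv L a"
      have z: "z \<in> D" "L z = a"
        using a(1) permutes_inv[OF M.L_perm] permutes_inverses[OF M.L_perm]
        by (simp_all add: z_def permutes_in_image)
      then have "L' b = c z" using c_neg[OF z(1)] t_L[OF z(1)] False a(2) by simp
      then show ?thesis using a z False flip_iff[of a "{}"] flip_iff[of z "{}"] t_L[OF z(1)] by simp
    qed
  qed
  have Ls': "L' \<circ> s' permutes D'" using N.dual by (rule half_edge_map.L_perm)
  have LsX: "(L' \<circ> s') b \<in> ?X \<longleftrightarrow> b \<in> ?X" if "b \<in> D'" for b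
    using L'X[of "s' b"] s'X that by simp
  have "swap_on s {} = id" by (simp add: swap_on_def fun_eq_iff)
  then have "ncls D (gr L) = circles D' s' L' ?X"
    using circles_flip[OF e(1) fpf] by (simp add: circles_def)
  also have "\<dots> = ncls ?X (gr (L' \<circ> s')) + ncls (D' - ?X) (gr L')"
    unfolding circles_def
    by (rule ncls_piecewise[OF N.fin Ls' N.L_perm N.state_permutes[OF X] XD LsX L'X])
       (auto simp: swap_on_def)
  finally have 1: "ncls D (gr L) = ncls ?X (gr (L' \<circ> s')) + ncls (D' - ?X) (gr L')" .
  have "ncls D (gr (L \<circ> s)) = circles D' s' L' (flip D)"
    using circles_flip[OF e(2) fpf] by (simp add: circles_def M.swap_on_full)
  also have "\<dots> = ncls ?X (gr L') + ncls (D' - ?X) (gr (L' \<circ> s'))"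
    unfolding circles_def
    by (rule ncls_piecewise[OF N.fin N.L_perm Ls' N.state_permutes[OF flip_smoothing[OF e(2) fpf]] XD L'X LsX])
       (auto simp: swap_on_def flipD)
  finally have 2: "ncls D (gr (L \<circ> s)) = ncls ?X (gr L') + ncls (D' - ?X) (gr (L' \<circ> s'))" .
  have 3: "ncls D' (gr L') = ncls ?X (gr L') + ncls (D' - ?X) (gr L')"
    by (rule ncls_piecewise[OF N.fin N.L_perm N.L_perm N.L_perm XD L'X L'X]) auto
  have 4: "ncls D' (gr (L' \<circ> s')) = ncls ?X (gr (L' \<circ> s')) + ncls (D' - ?X) (gr (L' \<circ> s'))"
    by (rule ncls_piecewise[OF N.fin Ls' Ls' Ls' XD LsX LsX]) auto
  show ?thesis using 1 2 3 4 by simp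
qed

end

section \<open>Plane graphs as half-edge maps\<close>

locale rotation_system =
  fixes G :: "('v, 'd) embedding"
  assumes emb: "embedded_graph G"
begin

abbreviation "D \<equiv> darts G"

sublocale half_edge_map D "partner G" "rot G"
proof
  show "partner G (partner G a) = a" for a
    using emb permutes_not_in[of "partner G" D a] unfolding embedded_graph_def
    by (cases "a \<in> D") auto
qed (use emb in \<open>auto simp: embedded_graph_def\<close>)

lemma partner_neq: "d \<in> D \<Longrightarrow> partner G d \<noteq> d"
  using emb by (auto simp: embedded_graph_def)

lemma org_in: "d \<in> D \<Longrightarrow> org G d \<in> everts G"
  using emb by (auto simp: embedded_graph_def)

lemma org_eq_iff: "d \<in> D \<Longrightarrow> d' \<in> D \<Longrightarrow> org G d = org G d' \<longleftrightarrow> linked (gr (rot G)) d d'"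
  using emb orbit_eq_linked[OF fin L_perm] by (auto simp: embedded_graph_def)

text \<open>Half-edge maps do not see vertices without darts. Each such vertex adds one to the
  vertices, the faces and the components, and therefore cancels in Euler's formula and in both
  exponents of the rank sum.\<close>

definition isolated :: nat where
  "isolated = card (everts G - org G ` D)"

lemma finite_everts: "finite (everts G)"
  using emb by (auto simp: embedded_graph_def)

lemma wf_graph_of: "wf_ugraph (graph_of G)"
  unfolding wf_ugraph_def
proof (intro conjI ballI)
  fix e assume "e \<in> edges (graph_of G)"
  then obtain d where d: "d \<in> D" "e = {d, partner G d}" by (auto simp: graph_of_def edge_of_def)
  then show "ends (graph_of G) e \<subseteq> verts (graph_of G)"
    using org_in by (auto simp: graph_of_def)
  show "card (ends (graph_of G) e) = 1 \<or> card (ends (graph_of G) e) = 2"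
    by (cases "org G d = org G (partner G d)") (simp_all add: graph_of_def d)
qed (use finite_everts fin in \<open>auto simp: graph_of_def\<close>)

lemma card_everts: "card (everts G) = ncls D (gr (rot G)) + isolated"
proof -
  have "card (org G ` D) = card ((\<lambda>a. {b. linked (gr (rot G)) a b}) ` (\<lambda>a. a) ` D)"
    by (rule card_image_cong_kernel) (simp only: cls_eq_iff org_eq_iff)
  moreover have "org G ` D \<subseteq> everts G" using org_in by auto
  ultimately show ?thesis
    using finite_everts card_mono[OF finite_everts, of "org G ` D"]
    by (simp add: isolated_def ncls_def card_Diff_subset finite_subset)
qed

lemma edge_disjoint: "edge_of G d \<inter> edge_of G d' \<noteq> {} \<Longrightarrow> edge_of G d = edge_of G d'"
  by (auto simp: edge_of_def)

lemma edge_subset_smoothing: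
  assumes "A \<subseteq> edge_of G ` D"
  shows "\<Union>A \<in> smoothings D (partner G)"
proof -
  have "a \<in> D \<and> partner G a \<in> \<Union>A" if a: "a \<in> \<Union>A" for a
  proof -
    obtain e where e: "e \<in> A" "a \<in> e" using a by blast
    then obtain d where "d \<in> D" "e = {d, partner G d}" using assms by (auto simp: edge_of_def)
    then show ?thesis using e by auto
  qed
  then show ?thesis using partner_neq by (auto simp: smoothings_def)
qed

lemma card_Union_edges:
  assumes "A \<subseteq> edge_of G ` D"
  shows "card (\<Union>A) = 2 * card A"
proof -
  have two: "card e = 2" if "e \<in> A" for e
    using that assms partner_neq by (fastforce simp: edge_of_def)
  have "card (\<Union>A) = (\<Sum>e\<in>A. card e)"
  proof (rule card_Union_disjoint)
    show "pairwise disjnt A"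
      unfolding pairwise_def disjnt_def using assms edge_disjoint by blast
    show "finite e" if "e \<in> A" for e using that assms by (auto simp: edge_of_def)
  qed
  then show ?thesis using two by simp
qed

text \<open>A vertex with darts is a cycle of the rotation, an edge of \<open>A\<close> links the
  cycles of its two darts, and a vertex without darts is a class by itself.\<close>

lemma comps_graph_of:
  assumes A: "A \<subseteq> edge_of G ` D"
  shows "comps (graph_of G) A =
    ncls D (gr (rot G) \<union> gr (swap_on (partner G) (\<Union>A))) + isolated"
proof -
  let ?r = "adj_rel (graph_of G) A"
  let ?t = "gr (rot G) \<union> gr (swap_on (partner G) (\<Union>A))"
  let ?c = "\<lambda>v. {w. linked ?r v w}"
  let ?I = "everts G - org G ` D"
  have r_iff: "(u, v) \<in> ?r \<longleftrightarrow> (\<exists>e\<in>A. \<exists>d\<in>e. \<exists>d'\<in>e. u = org G d \<and> v = org G d')" for u v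
    by (auto simp: adj_rel_def graph_of_def)
  have AD: "d \<in> D" if "d \<in> e" "e \<in> A" for d e
    using that A by (auto simp: edge_of_def)
  have link_e: "linked ?t d d'" if "e \<in> A" "d \<in> e" "d' \<in> e" for e d d'
  proof -
    have "d' = d \<or> d' = partner G d" using that A by (auto simp: edge_of_def)
    moreover have "linked ?t d (partner G d)"
      using that linked_gr_Un2[of "gr (rot G)" "swap_on (partner G) (\<Union>A)" d]
      by (auto simp: swap_on_def split: if_splits)
    ultimately show ?thesis by auto
  qed
  have link_rot: "linked ?t d d'" if "linked (gr (rot G)) d d'" for d d'
    using that by (rule linked_mono) (auto intro: linked_base)
  have "linked ?t a b \<longleftrightarrow> linked ?r (org G a) (org G b)" if ab: "a \<in> D" "b \<in> D" for a b
  proof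
    assume "linked ?t a b"
    then show "linked ?r (org G a) (org G b)"
    proof (rule linked_image)
      fix u v assume "(u, v) \<in> ?t"
      then consider "v = rot G u" | "v = swap_on (partner G) (\<Union>A) u" by (auto simp: gr_def)
      then show "linked ?r (org G u) (org G v)"
      proof cases
        case 1
        then have "org G v = org G u"
        proof (cases "u \<in> D")
          case True
          then show ?thesis using org_eq_iff[of u v] linked_gr[of "rot G" u] 1 by simp
        qed (use L_perm in \<open>simp add: 1 permutes_not_in\<close>)
        then show ?thesis by simp
      next
        case 2
        show ?thesis
        proof (cases "u \<in> \<Union>A")
          case True
          then obtain e where e: "e \<in> A" "u \<in> e" by blast
          then have "partner G u \<in> e" using A by (auto simp: edge_of_def)
          then have "(org G u, org G (partner G u)) \<in> ?r" unfolding r_iff using e by blast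
          then show ?thesis using 2 True by (simp add: swap_on_def linked_base)
        next
          case False
          then show ?thesis using 2 by (simp add: swap_on_def)
        qed
      qed
    qed
  next
    \<comment> \<open>A representative dart for each vertex that has one; \<open>h\<close> is
      evaluated only at origins of darts.\<close>
    define h where "h v = (SOME d. d \<in> D \<and> org G d = v)" for v
    have h: "linked (gr (rot G)) d (h (org G d))" if "d \<in> D" for d
    proof -
      have "h (org G d) \<in> D \<and> org G (h (org G d)) = org G d"
        unfolding h_def by (rule someI[of _ d]) (use that in simp)
      then show ?thesis using org_eq_iff[of d "h (org G d)"] that by simp
    qed
    assume "linked ?r (org G a) (org G b)"
    then have "linked ?t (h (org G a)) (h (org G b))"
    proof (rule linked_image)
      fix u v assume "(u, v) \<in> ?r"
      then obtain e d d' where e: "e \<in> A" "d \<in> e" "d' \<in> e" "u = org G d" "v = org G d'"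
        unfolding r_iff by blast
      have "linked ?t d (h u)" "linked ?t d' (h v)"
        using link_rot[OF h[OF AD[OF e(2,1)]]] link_rot[OF h[OF AD[OF e(3,1)]]] e(4,5) by simp_all
      then show "linked ?t (h u) (h v)"
        using linked_trans[OF linked_sym linked_trans[OF link_e[OF e(1-3)]]] by blast
    qed
    then show "linked ?t a b"
      using linked_trans[OF link_rot[OF h[OF ab(1)]]
          linked_trans[OF _ linked_sym[OF link_rot[OF h[OF ab(2)]]]]] by blast
  qed
  then have 1: "ncls D ?t = ncls (org G ` D) ?r" by (rule ncls_image)
  have iso: "w = v" if "linked ?r v w" "v \<in> ?I" for v w
  proof -
    have "u \<in> {v} \<longleftrightarrow> u' \<in> {v}" if "(u, u') \<in> ?r" for u u'
      using that AD \<open>v \<in> ?I\<close> unfolding r_iff by auto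
    then have "w \<in> {v}" using linked_closed[OF that(1), of "{v}"] by blast
    then show ?thesis by simp
  qed
  have "everts G = org G ` D \<union> ?I" using org_in by auto
  then have "?c ` everts G = ?c ` org G ` D \<union> ?c ` ?I" by (metis image_Un)
  moreover have "?c ` org G ` D \<inter> ?c ` ?I = {}"
  proof -
    have False if "?c v = ?c w" "v \<in> ?I" "w \<in> org G ` D" for v w
      using that iso[of v w] by (simp only: cls_eq_iff) blast
    then show ?thesis by blast
  qed
  moreover have "card (?c ` ?I) = isolated"
    unfolding isolated_def
    by (rule card_image, rule inj_onI) (use iso in \<open>simp only: cls_eq_iff, blast\<close>)
  ultimately have "card (?c ` everts G) = ncls (org G ` D) ?r + isolated"
    using fin finite_everts by (simp add: ncls_def card_Un_disjoint)
  then show ?thesis using 1 by (simp add: comps_def ncls_def graph_of_def)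
qed

lemma Union_edges: "\<Union>(edge_of G ` D) = D"
  by (auto simp: edge_of_def)

lemma edges_graph_of: "edges (graph_of G) = edge_of G ` D" and verts_graph_of: "verts (graph_of G) = everts G"
  by (simp_all add: graph_of_def)

lemma comps_edges: "comps (graph_of G) (edges (graph_of G)) = pieces D (partner G) (rot G) + isolated"
  using comps_graph_of[OF subset_refl] by (simp add: edges_graph_of Union_edges swap_on_full pieces_def)

lemma genus_zero_euler:
  assumes "genus G = 0"
  shows "2 * ncls D (gr (rot G)) + 2 * ncls D (gr (rot G \<circ> partner G)) =
    4 * pieces D (partner G) (rot G) + card D"
proof -
  have "num_faces G = ncls D (gr (rot G \<circ> partner G)) + isolated"
    unfolding num_faces_def isolated_def
    using card_orbits[OF fin half_edge_map.L_perm[OF dual]] by simp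
  moreover have "card D = 2 * card (edge_of G ` D)"
    using card_Union_edges[OF subset_refl] by (simp add: Union_edges)
  moreover have "2 * real (num_components (graph_of G)) =
      real (card (everts G)) - real (card (edges (graph_of G))) + real (num_faces G)"
    using assms by (simp add: genus_def)
  ultimately have "real (2 * ncls D (gr (rot G)) + 2 * ncls D (gr (rot G \<circ> partner G))) =
      real (4 * pieces D (partner G) (rot G) + card D)"
    unfolding num_components_eq comps_edges card_everts unfolding edges_graph_of by simp
  then show ?thesis by (simp only: of_nat_eq_iff)
qed

text \<open>An edge set corresponds to the union of its edges, hence \<open>2 * card A\<close> in
  Euler's formula. The two inequalities ensure that the subtractions are exact, so that the
  exponents add up.\<close>

theorem rank_sum_state_sum:
  assumes "genus G = 0"
  shows "rank_sum x x (graph_of G) = state_sum x D (partner G) (rot G)"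
  unfolding rank_sum_def state_sum_def
proof (rule sum.reindex_bij_witness[of _ "\<lambda>U. edge_of G ` U" Union])
  fix A assume "A \<in> Pow (edges (graph_of G))"
  then have A: "A \<subseteq> edge_of G ` D" by (simp add: edges_graph_of)
  then have *: "e = edge_of G d" if "e \<in> A" "d \<in> e" for e d
    using that by (auto simp: edge_of_def)
  have "e \<noteq> {}" if "e \<in> A" for e using that A by (auto simp: edge_of_def)
  with * show "edge_of G ` \<Union>A = A" by (fastforce simp: image_iff)
  show U: "\<Union>A \<in> smoothings D (partner G)" by (rule edge_subset_smoothing[OF A])
  let ?n = "ncls D (gr (rot G) \<union> gr (swap_on (partner G) (\<Union>A)))"
  have "2 * circles D (partner G) (rot G) (\<Union>A) + 2 * ncls D (gr (rot G)) = 4 * ?n + 2 * card A"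
    using euler_circles[OF partner_neq genus_zero_euler[OF assms] U] card_Union_edges[OF A] by simp
  moreover have "pieces D (partner G) (rot G) + isolated \<le> ?n + isolated"
    using comps_antimono[OF wf_graph_of, of A "edges (graph_of G)"] A
    unfolding comps_edges comps_graph_of[OF A] by (simp add: edges_graph_of)
  moreover have "ncls D (gr (rot G)) + isolated \<le> card A + (?n + isolated)"
    using card_verts_le[OF wf_graph_of, of A] A
    unfolding comps_graph_of[OF A] verts_graph_of card_everts by (simp add: edges_graph_of)
  ultimately have "circles D (partner G) (rot G) (\<Union>A) - pieces D (partner G) (rot G) =
     (?n + isolated - (pieces D (partner G) (rot G) + isolated)) +
     (card A + (?n + isolated) - (ncls D (gr (rot G)) + isolated))"
    by linarith
  then show "(x - 1) ^ (circles D (partner G) (rot G) (\<Union>A) - pieces D (partner G) (rot G)) =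
      (x - 1) ^ (comps (graph_of G) A - comps (graph_of G) (edges (graph_of G))) *
      (x - 1) ^ (card A + comps (graph_of G) A - card (verts (graph_of G)))"
    unfolding comps_edges comps_graph_of[OF A] verts_graph_of card_everts
    by (simp add: power_add)
next
  fix U assume U: "U \<in> smoothings D (partner G)"
  show "\<Union>(edge_of G ` U) = U"
    using smoothing_s[OF U] by (auto simp: edge_of_def)
  show "edge_of G ` U \<in> Pow (edges (graph_of G))"
    using smoothing_subset[OF U] by (auto simp: edges_graph_of)
qed

end

section \<open>The half-edge map of a dimap obtained from a medial graph\<close>

locale medial_dimap =
  fixes G :: "('v, 'd) embedding" and H :: "'e dimap"
    and c :: "'e \<times> bool \<Rightarrow> 'd \<times> bool"
  assumes emb: "embedded_graph G" and alt: "alt_dimap H"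
    and bij: "bij_betw c (arcs H \<times> UNIV) (darts G \<times> UNIV)"
    and c_partner: "\<And>d. d \<in> arcs H \<times> UNIV \<Longrightarrow> c (partner (underlying H) d) = partner (medial G) (c d)"
    and c_rot: "\<And>d. d \<in> arcs H \<times> UNIV \<Longrightarrow> c (rot (underlying H) d) = rot (medial G) (c d)"
begin

sublocale H: dimap H
  using alt by unfold_locales

sublocale G: rotation_system G
  using emb by unfold_locales

definition corner :: "'e \<Rightarrow> 'd" where
  "corner a = fst (c (a, True))"

text \<open>Whether \<open>a\<close> points towards the end \<open>True\<close> of its medial edge.
  Constancy under the successor maps makes this the record of which of the two directions was chosen
  on each component.\<close>

definition same_way :: "'e \<Rightarrow> bool" where
  "same_way a = snd (c (a, True))"

lemma c_eq: "a \<in> arcs H \<Longrightarrow> c (a, b) = (corner a, same_way a \<longleftrightarrow> b)"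
proof -
  assume a: "a \<in> arcs H"
  have "c (a, True) \<in> darts G \<times> UNIV" using bij_betwE[OF bij] a by blast
  moreover have "c (a, False) = partner (medial G) (c (a, True))"
    using c_partner[of "(a, True)"] a by (simp add: H.partner_underlying perm_restrict_def)
  ultimately show ?thesis
    by (cases b; cases "c (a, True)") (auto simp: corner_def same_way_def medial_def perm_restrict_def)
qed

lemma corner_bij: "bij_betw corner (arcs H) (darts G)"
proof (rule bij_betwI')
  have in_D: "c d \<in> darts G \<times> UNIV" if "d \<in> arcs H \<times> UNIV" for d using bij_betwE[OF bij] that by blast
  show "corner a \<in> darts G" if "a \<in> arcs H" for a
    using in_D[of "(a, True)"] that by (auto simp: corner_def)
  show "\<exists>a\<in>arcs H. d = corner a" if "d \<in> darts G" for d
  proof -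
    have "(d, True) \<in> c ` (arcs H \<times> UNIV)" using bij that by (simp add: bij_betw_def)
    then obtain a b where "a \<in> arcs H" "(d, True) = c (a, b)" by auto
    then show ?thesis using c_eq by auto
  qed
  fix a a' assume a: "a \<in> arcs H" "a' \<in> arcs H"
  show "corner a = corner a' \<longleftrightarrow> a = a'"
  proof
    assume eq: "corner a = corner a'"
    have "c (a, True) = c (a', same_way a \<longleftrightarrow> same_way a')"
      using a eq by (auto simp: c_eq)
    then have "(a, True) = (a', same_way a \<longleftrightarrow> same_way a')"
      using bij_betw_imp_inj_on[OF bij] a by (auto dest!: inj_onD)
    then show "a = a'" by simp
  qed simp
qed

lemma corner_in: "a \<in> arcs H \<Longrightarrow> corner a \<in> darts G"
  using bij_betwE[OF corner_bij] by blast

text \<open>One step of the medial rotation from the head of \<open>a\<close>. It always passes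
  between an end \<open>True\<close> and an end \<open>False\<close>, and the next dart in the dimap
  is the tail of the left successor, so the direction persists.\<close>

lemma step_L:
  assumes a: "a \<in> arcs H"
  shows "same_way (left_succ H a) \<longleftrightarrow> same_way a"
    and "corner (left_succ H a) =
      (if same_way a then partner G (rot G (corner a)) else inv (rot G) (corner a))"
proof -
  have La: "left_succ H a \<in> arcs H" using H.L a by (simp add: permutes_in_image)
  have "c (left_succ H a, False) = rot (medial G) (corner a, same_way a)"
    using c_rot[of "(a, True)"] a c_eq[OF a, of True]
    by (simp add: H.rot_underlying perm_restrict_def)
  then have "(corner (left_succ H a), \<not> same_way (left_succ H a)) =
      (if same_way a then (partner G (rot G (corner a)), False) else (inv (rot G) (corner a), True))"
    using corner_in[OF a] by (simp add: c_eq[OF La] medial_def perm_restrict_def)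
  then show "same_way (left_succ H a) \<longleftrightarrow> same_way a"
    "corner (left_succ H a) =
      (if same_way a then partner G (rot G (corner a)) else inv (rot G) (corner a))"
    by (auto split: if_splits)
qed

lemma step_R:
  assumes a: "a \<in> arcs H"
  shows "same_way (inv (right_succ H) a) \<longleftrightarrow> same_way a"
    and "corner (inv (right_succ H) a) =
      (if same_way a then inv (rot G) (corner a) else partner G (rot G (corner a)))"
proof -
  have Ra: "inv (right_succ H) a \<in> arcs H"
    using permutes_inv[OF H.R] a by (simp add: permutes_in_image)
  have "c (inv (right_succ H) a, True) = rot (medial G) (corner a, \<not> same_way a)"
    using c_rot[of "(a, False)"] a c_eq[OF a, of False]
    by (simp add: H.rot_underlying perm_restrict_def)
  then have "(corner (inv (right_succ H) a), same_way (inv (right_succ H) a)) =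
      (if same_way a then (inv (rot G) (corner a), True) else (partner G (rot G (corner a)), False))"
    using corner_in[OF a] by (simp add: c_eq[OF Ra] medial_def perm_restrict_def)
  then show "same_way (inv (right_succ H) a) \<longleftrightarrow> same_way a"
    "corner (inv (right_succ H) a) =
      (if same_way a then inv (rot G) (corner a) else partner G (rot G (corner a)))"
    by (auto split: if_splits)
qed

lemma sig1_eq: "sig1 H a = inv (right_succ H) (left_succ H a)"
  by (simp add: H.inv_R)

text \<open>Where \<open>same_way\<close> holds, the a-faces of \<open>H\<close> are the faces of \<open>G\<close>, elsewhere they are its vertices.
  The rotation makes \<open>sig1 H\<close> correspond to \<open>partner G\<close> in both cases.\<close>

definition dart :: "'e \<Rightarrow> 'd" where
  "dart a = (if same_way a then rot G (corner a) else corner a)"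

lemma inv_rot [simp]: "inv (rot G) (rot G d) = d" "rot G (inv (rot G) d) = d"
  using permutes_inverses[OF G.L_perm] by simp_all

lemma dart_sig1:
  assumes a: "a \<in> arcs H"
  shows "same_way (sig1 H a) \<longleftrightarrow> same_way a" and "dart (sig1 H a) = partner G (dart a)"
proof -
  have La: "left_succ H a \<in> arcs H" using H.L a by (simp add: permutes_in_image)
  show "same_way (sig1 H a) \<longleftrightarrow> same_way a" "dart (sig1 H a) = partner G (dart a)"
    using step_L[OF a] step_R[OF La] by (simp_all add: sig1_eq dart_def)
qed

text \<open>The corners with \<open>same_way\<close> are closed under the inverse rotation, hence
  invariant under the rotation. Rotating these and fixing the others is therefore injective, and
  equal cardinalities give surjectivity.\<close>

lemma dart_bij: "bij_betw dart (arcs H) (darts G)"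
proof -
  let ?Z = "corner ` {a \<in> arcs H. same_way a}"
  have inv_Z: "inv (rot G) d \<in> ?Z" if "d \<in> ?Z" for d
  proof -
    from that obtain a where a: "a \<in> arcs H" "same_way a" "d = corner a" by blast
    have "inv (right_succ H) a \<in> arcs H"
      using permutes_inv[OF H.R] a by (simp add: permutes_in_image)
    then show ?thesis using step_R[OF a(1)] a by (auto simp: image_iff)
  qed
  have "finite ?Z" using H.fin by simp
  have im: "inv (rot G) ` ?Z = ?Z"
    using endo_inj_surj[OF \<open>finite ?Z\<close>, of "inv (rot G)"] inv_Z
      permutes_inj_on[OF permutes_inv[OF G.L_perm]] by blast
  have rot_Z: "rot G d \<in> ?Z \<longleftrightarrow> d \<in> ?Z" for d
  proof
    show "d \<in> ?Z" if "rot G d \<in> ?Z" using inv_Z[OF that] by simp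
    assume "d \<in> ?Z"
    then obtain z where "z \<in> ?Z" "d = inv (rot G) z" using im by blast
    then show "rot G d \<in> ?Z" by simp
  qed
  have inj: "corner a = corner b \<longleftrightarrow> a = b" if "a \<in> arcs H" "b \<in> arcs H" for a b
    using bij_betw_imp_inj_on[OF corner_bij] that by (auto dest: inj_onD)
  have Z: "corner a \<in> ?Z \<longleftrightarrow> same_way a" if "a \<in> arcs H" for a
    using that inj by auto
  have "inj_on dart (arcs H)"
  proof (rule inj_onI)
    fix a b assume ab: "a \<in> arcs H" "b \<in> arcs H" "dart a = dart b"
    have "dart d \<in> ?Z \<longleftrightarrow> same_way d" if "d \<in> arcs H" for d
      using Z[OF that] rot_Z[of "corner d"] by (simp add: dart_def)
    then have "same_way a = same_way b" using ab by metis
    then show "a = b" using ab inj by (auto simp: dart_def split: if_splits)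
  qed
  moreover have "dart ` arcs H \<subseteq> darts G"
    using corner_in by (auto simp: dart_def)
  moreover have "card (arcs H) = card (darts G)" by (rule bij_betw_same_card[OF corner_bij])
  ultimately show ?thesis
    using G.fin by (simp add: bij_betw_def card_image card_subset_eq)
qed

text \<open>A medial vertex is an edge of \<open>G\<close>; its two incoming arcs correspond to the
  two darts of this edge, so \<open>sig1 H\<close> inherits being an involution from
  \<open>partner G\<close>.\<close>

lemma sig1_sig1: "sig1 H (sig1 H a) = a"
proof (cases "a \<in> arcs H")
  case True
  then have s: "sig1 H a \<in> arcs H" "sig1 H (sig1 H a) \<in> arcs H"
    using H.sig1 by (simp_all add: permutes_in_image)
  then have "dart (sig1 H (sig1 H a)) = dart a" using dart_sig1(2) True by simp
  then show ?thesis using bij_betw_imp_inj_on[OF dart_bij] s True by (auto dest: inj_onD)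
qed (use H.sig1 in \<open>simp add: permutes_not_in\<close>)

lemma quartic: "quartic_dimap H"
  using sig1_sig1 by unfold_locales

lemma partial_dual_dart:
  "partial_dual (arcs H) (sig1 H) (left_succ H) (darts G) (partner G) (rot G) dart same_way"
proof -
  interpret quartic_dimap H by (rule quartic)
  show ?thesis
  proof unfold_locales
    fix a assume a: "a \<in> arcs H"
    show "dart (left_succ H a) = rot G (partner G (dart a))" if "same_way a"
      using step_L[OF a] that by (simp add: dart_def)
    show "rot G (dart (left_succ H a)) = dart a" if "\<not> same_way a"
      using step_L[OF a] that by (simp add: dart_def)
  qed (use dart_bij dart_sig1 step_L in auto)
qed

lemma sig1_neq:
  assumes "a \<in> arcs H"
  shows "sig1 H a \<noteq> a"
proof -
  have "dart a \<in> darts G" using bij_betwE[OF dart_bij] assms by blast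
  then show ?thesis using dart_sig1(2)[OF assms] G.partner_neq by metis
qed

lemma dimap_of_plane_graph:
  assumes "genus G = 0"
  shows "plane_quartic H" and "dimap_sum x H = rank_sum x x (graph_of G)"
proof -
  interpret quartic_dimap H by (rule quartic)
  interpret partial_dual "arcs H" "sig1 H" "left_succ H" "darts G" "partner G" "rot G" dart same_way
    by (rule partial_dual_dart)
  have "card (arcs H) = card (darts G)" by (rule bij_betw_same_card[OF dart_bij])
  then have "2 * ncls (arcs H) (gr (left_succ H)) + 2 * ncls (arcs H) (gr (left_succ H \<circ> sig1 H)) =
      4 * pieces (arcs H) (sig1 H) (left_succ H) + card (arcs H)"
    using euler_eq[OF sig1_neq] G.genus_zero_euler[OF assms] pieces_eq by simp
  then show "plane_quartic H"
    using euler_planar_map[OF sig1_neq] quartic by (simp add: plane_quartic_def)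
  show "dimap_sum x H = rank_sum x x (graph_of G)"
    unfolding dimap_sum_def G.rank_sum_state_sum[OF assms] by (rule state_sum_eq[OF sig1_neq])
qed

end

theorem theorem26:
  fixes G :: "('v, 'd) embedding" and H :: "'e dimap" and x :: "'r::comm_ring_1"
  assumes "plane_graph G" and "is_alt_i G H"
  shows "(\<forall>t. Ti_value x H t \<longleftrightarrow> t = tutte (graph_of G) x x) \<and>
         (\<forall>T. Ti_invariant x T \<longrightarrow> tutte (graph_of G) x x = T H)"
proof -
  have emb: "embedded_graph G" and genus: "genus G = 0" using assms(1) by (simp_all add: plane_graph_def)
  have alt: "alt_dimap H" and iso: "embedding_iso (underlying H) (medial G)"
    using assms(2) by (simp_all add: is_alt_i_def)
  obtain c where c: "bij_betw c (arcs H \<times> UNIV) (darts G \<times> UNIV)"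
    "\<And>d. d \<in> arcs H \<times> UNIV \<Longrightarrow> c (partner (underlying H) d) = partner (medial G) (c d)"
    "\<And>d. d \<in> arcs H \<times> UNIV \<Longrightarrow> c (rot (underlying H) d) = rot (medial G) (c d)"
  proof -
    have "darts (underlying H) = arcs H \<times> UNIV" "darts (medial G) = darts G \<times> UNIV"
      by (simp_all add: underlying_def medial_def)
    then show thesis using iso that unfolding embedding_iso_def by metis
  qed
  interpret medial_dimap G H c using emb alt c by unfold_locales
  have plane: "plane_quartic H" by (rule dimap_of_plane_graph(1)[OF genus])
  have "tutte (graph_of G) x x = rank_sum x x (graph_of G)"
    by (rule tutte_eq_rank_sum[OF G.wf_graph_of])
  also have "\<dots> = dimap_sum x H"
    by (rule dimap_of_plane_graph(2)[OF genus, symmetric])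
  finally show ?thesis
    using Ti_value_iff[OF plane] Ti_invariant_dimap_sum[OF _ plane] by metis
qed

end
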